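(* Let $\Gamma$ be a crystallographic group in dimension $n$, with natural unitary representation $\pi$ on $L^2(\mathbb{R}^n)$, and let $\Pi,\mathcal{L}^*,\Gamma^*,R$ be as in the context. A closed subspace $V \subset L^2(\mathbb{R}^n)$ is $\pi$-invariant if and only if there exists a measurable range function $r \mapsto K_r$ from $R$ into the closed subspaces of $l^2(\mathcal{L}^* )$, uniquely determined almost everywhere by $V$, such that $V$ consists of all $f \in L^2(\mathbb{R}^n)$ satisfying $$\widehat{f}(\chi_{M(r+z)}) = \chi_z(x_M)\,\langle F(r),\delta_M \otimes \delta_{z}\rangle$$ for a.e. $r\in R$ and all $[z,M]\in \Gamma^*$, for some $F\in \int_R^\oplus l^2(\Pi)\otimes K_r \,dr$, where $x_M$ comes from any cross-section $\gamma:\Pi \to \Gamma$, $\gamma(M) = [x_M, M]$. Moreover, every $\pi$-invariant closed subspace of $L^2(\mathbb{R}^n)$ arises in this way, and the correspondence $V \leftrightarrow \{K_r\}_{r\in R}$ is one-to-one, up to modification on a null subset of $R$.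
   Context: For $x\in\mathbb{R}^n$ and $L\in \mathrm{GL}(n,\mathbb{R})$, $[x,L]$ denotes the affine map $[x,L]u=L(u+x)$; thus $[x,L][y,M]=[M^{-1}x+y,LM]$ and $[x,L]^{-1}=[-Lx,L^{-1}]$. A crystallographic group $\Gamma$ in dimension $n$ is a discrete subgroup of the isometry group $\{[x,L]:x\in\mathbb{R}^n, L\in \mathrm{O}(n)\}$ with $\mathbb{R}^n/\Gamma$ compact. Its point group is the finite group $\Pi=\{L:[x,L]\in\Gamma\text{ for some }x\}$; its lattice is $\mathcal{L}=\{x:[x,\mathrm{id}]\in\Gamma\}$; the dual lattice is $\mathcal{L}^*=\{z\in\mathbb{R}^n: x\cdot z\in\mathbb{Z}\ \forall x\in\mathcal{L}\}$; and $\Gamma^*=\{[z,M]:z\in\mathcal{L}^*,M\in\Pi\}$, which is again a crystallographic group. A cross-section is a map $\gamma:\Pi\to\Gamma$ of the form $\gamma(M)=[x_M,M]$. $R$ is a fixed fundamental domain for $\Gamma^*$: $R\subset\mathbb{R}^n$ is open and connected, the sets $gR$ ($g\in\Gamma^*$) are mutually disjoint, and $\bigcup_{g\in\Gamma^*} g\overline{R}=\mathbb{R}^n$; moreover $R$ is convex and locally finite (each point of $\mathbb{R}^n$ has a neighbourhood meeting only finitely many of the sets $g\overline R$). $R$ carries Lebesgue measure. The representation $\pi$ of $\Gamma$ on $L^2(\mathbb{R}^n)$ is $(\pi[x,L]f)(u)=f([x,L]^{-1}u)=f(L^{-1}u-x)$. A closed subspace $V$ is $\pi$-invariant if $\pi[x,L]V\subset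 V$ for all $[x,L]\in\Gamma$. For $y\in\mathbb{R}^n$, $\chi_y(u)=e^{2\pi i y\cdot u}$; $\widehat f(\chi_y)=\int_{\mathbb{R}^n} f(u)\chi_y(u)\,du$ for $f\in L^1\cap L^2$, extended by continuity to $L^2(\mathbb{R}^n)$ (Plancherel transform). A map $r\mapsto K_r$ from $R$ to closed subspaces of a separable Hilbert space $\mathscr{K}$ is a measurable range function if $r\mapsto\langle P_{K_r}a,b\rangle$ is measurable for all $a,b\in\mathscr{K}$, where $P_{K_r}$ is the orthogonal projection onto $K_r$. $\int_R^\oplus l^2(\Pi)\otimes K_r\,dr$ is the closed subspace of $L^2(R;l^2(\Pi)\otimes l^2(\mathcal{L}^* ))$ consisting of those $F$ with $F(r)\in l^2(\Pi)\otimes K_r$ for a.e. $r$. $\delta_M,\delta_z$ denote the standard basis vectors of $l^2(\Pi)$, $l^2(\mathcal{L}^* )$. *)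

theory Defs
  imports "HOL-Analysis.Analysis" "HOL-Algebra.Group"
begin

section \<open>Affine maps and crystallographic groups\<close>

text \<open>The affine map \<open>[x, L] u = L (u + x)\<close> is represented by the pair \<open>(x, L)\<close>.\<close>

type_synonym 'n affine = "(real^'n) \<times> (real^'n^'n)"

definition aff_act :: "'n::finite affine \<Rightarrow> real^'n \<Rightarrow> real^'n" where
  "aff_act g u = snd g *v (u + fst g)"

definition isometry_group :: "'n::finite affine monoid" where
  "isometry_group =
     \<lparr>carrier = {(x, L). orthogonal_matrix L},
      monoid.mult = (\<lambda>(x, L) (y, M). (matrix_inv M *v x + y, L ** M)),
      one = (0, mat 1)\<rparr>"

lemma aff_act_mult:
  assumes "g \<in> carrier isometry_group" "h \<in> carrier isometry_group"
  shows "aff_act (g \<otimes>\<^bsub>isometry_group\<^esub> h) u = aff_act g (aff_act h u)"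
proof -
  obtain x L y M where gh: "g = (x, L)" "h = (y, M)" by (metis surj_pair)
  have "M ** transpose M = mat 1 \<and> transpose M ** M = mat 1"
    using assms(2) gh by (simp add: isometry_group_def orthogonal_matrix_def)
  then have MM: "M ** matrix_inv M = mat 1"
    unfolding matrix_inv_def by (rule someI2) simp
  have "M *v (u + (matrix_inv M *v x + y)) = x + M *v (u + y)"
    by (simp add: matrix_vector_right_distrib matrix_vector_mul_assoc MM)
  then have "(L ** M) *v (u + (matrix_inv M *v x + y)) = L *v (M *v (u + y) + x)"
    by (simp only: matrix_vector_mul_assoc[symmetric] add.commute[of x])
  then show ?thesis
    by (simp add: gh aff_act_def isometry_group_def)
qed

text \<open>A discrete subgroup of the isometry group with compact orbit space. The orbit space is the
  topological space \<open>X\<close>, on the set of orbits, for which the orbit map is a quotient map.\<close>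

definition crystallographic :: "'n::finite affine set \<Rightarrow> bool" where
  "crystallographic \<Gamma> \<longleftrightarrow>
     subgroup \<Gamma> isometry_group \<and> discrete \<Gamma> \<and>
     (\<exists>X. quotient_map euclidean X (\<lambda>u. (\<lambda>g. aff_act g u) ` \<Gamma>) \<and> compact_space X)"

definition point_group :: "'n::finite affine set \<Rightarrow> (real^'n^'n) set" where
  "point_group \<Gamma> = {L. \<exists>x. (x, L) \<in> \<Gamma>}"

definition lattice :: "'n::finite affine set \<Rightarrow> (real^'n) set" where
  "lattice \<Gamma> = {x. (x, mat 1) \<in> \<Gamma>}"

definition dual_lattice :: "'n::finite affine set \<Rightarrow> (real^'n) set" where
  "dual_lattice \<Gamma> = {z. \<forall>x\<in>lattice \<Gamma>. x \<bullet> z \<in> \<int>}"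

definition dual_group :: "'n::finite affine set \<Rightarrow> 'n affine set" where
  "dual_group \<Gamma> = {(z, M). z \<in> dual_lattice \<Gamma> \<and> M \<in> point_group \<Gamma>}"

definition cross_section :: "'n::finite affine set \<Rightarrow> (real^'n^'n \<Rightarrow> 'n affine) \<Rightarrow> bool" where
  "cross_section \<Gamma> \<gamma> \<longleftrightarrow> (\<forall>M\<in>point_group \<Gamma>. \<gamma> M \<in> \<Gamma> \<and> snd (\<gamma> M) = M)"

definition fundamental_domain :: "'n::finite affine set \<Rightarrow> (real^'n) set \<Rightarrow> bool" where
  "fundamental_domain G R \<longleftrightarrow>
     open R \<and> connected R \<and>
     disjoint_family_on (\<lambda>g. aff_act g ` R) G \<and>
     (\<Union>g\<in>G. aff_act g ` closure R) = UNIV \<and>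
     convex R \<and>
     locally_finite_in euclidean ((\<lambda>g. aff_act g ` closure R) ` G)"


section \<open>Square-integrable functions\<close>

text \<open>Elements of \<open>L\<^sup>2\<close> are represented by functions rather than by classes of functions modulo
  null sets. In particular \<open>l\<^sup>2(A)\<close> is \<open>L2 (count_space A)\<close>, where two functions represent the
  same element iff they agree on \<open>A\<close>.\<close>

definition L2 :: "'a measure \<Rightarrow> ('a \<Rightarrow> complex) set" where
  "L2 N = {f \<in> borel_measurable N. integrable N (\<lambda>x. (cmod (f x))\<^sup>2)}"

definition L2_inner :: "'a measure \<Rightarrow> ('a \<Rightarrow> complex) \<Rightarrow> ('a \<Rightarrow> complex) \<Rightarrow> complex" where
  "L2_inner N f g = (\<integral>x. f x * cnj (g x) \<partial>N)"

definition L2_norm :: "'a measure \<Rightarrow> ('a \<Rightarrow> complex) \<Rightarrow> real" where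
  "L2_norm N f = sqrt (\<integral>x. (cmod (f x))\<^sup>2 \<partial>N)"

definition L2_tendsto :: "'a measure \<Rightarrow> (nat \<Rightarrow> 'a \<Rightarrow> complex) \<Rightarrow> ('a \<Rightarrow> complex) \<Rightarrow> bool" where
  "L2_tendsto N s f \<longleftrightarrow>
     (\<forall>k. s k \<in> L2 N) \<and> f \<in> L2 N \<and> (\<lambda>k. L2_norm N (\<lambda>x. s k x - f x)) \<longlonglongrightarrow> 0"

text \<open>Closure under limits of constant sequences makes a closed subspace a union of classes modulo
  null sets, so that equality of such sets is equality of subspaces of the Hilbert space.\<close>

definition closed_L2_subspace :: "'a measure \<Rightarrow> ('a \<Rightarrow> complex) set \<Rightarrow> bool" where
  "closed_L2_subspace N V \<longleftrightarrow>
     V \<subseteq> L2 N \<and> (\<lambda>_. 0) \<in> V \<and>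
     (\<forall>f\<in>V. \<forall>g\<in>V. (\<lambda>x. f x + g x) \<in> V) \<and>
     (\<forall>c. \<forall>f\<in>V. (\<lambda>x. c * f x) \<in> V) \<and>
     (\<forall>s f. (\<forall>k. s k \<in> V) \<and> L2_tendsto N s f \<longrightarrow> f \<in> V)"

lemma closed_L2_subspace_AE:
  assumes "closed_L2_subspace N V" "f \<in> V" "g \<in> L2 N" "AE x in N. f x = g x"
  shows "g \<in> V"
proof -
  have "(\<integral>x. (cmod (f x - g x))\<^sup>2 \<partial>N) = 0"
    by (rule integral_eq_zero_AE) (use assms(4) in \<open>eventually_elim, simp\<close>)
  moreover have "f \<in> L2 N"
    using assms(1,2) unfolding closed_L2_subspace_def by (elim conjE) (rule subsetD)
  ultimately have "L2_tendsto N (\<lambda>_. f) g"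
    using assms(3) by (simp add: L2_tendsto_def L2_norm_def)
  moreover have "\<forall>s f. (\<forall>k. s k \<in> V) \<and> L2_tendsto N s f \<longrightarrow> f \<in> V"
    using assms(1) unfolding closed_L2_subspace_def by (elim conjE)
  ultimately show ?thesis
    using assms(2) by (elim allE[of _ "\<lambda>_. f"] allE[of _ g]) simp
qed

text \<open>Orthogonal projection onto a closed subspace, determined up to null sets.\<close>

definition L2_proj :: "'a measure \<Rightarrow> ('a \<Rightarrow> complex) set \<Rightarrow> ('a \<Rightarrow> complex) \<Rightarrow> ('a \<Rightarrow> complex)" where
  "L2_proj N V a = (SOME p. p \<in> V \<and> (\<forall>w\<in>V. L2_inner N (\<lambda>x. a x - p x) w = 0))"

definition delta :: "'a \<Rightarrow> 'a \<Rightarrow> complex" where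
  "delta a = (\<lambda>x. if x = a then 1 else 0)"

definition tensor :: "('a \<Rightarrow> complex) \<Rightarrow> ('b \<Rightarrow> complex) \<Rightarrow> ('a \<times> 'b \<Rightarrow> complex)" where
  "tensor a b = (\<lambda>(x, y). a x * b y)"

text \<open>For \<open>S \<subseteq> l\<^sup>2(A)\<close> and \<open>T \<subseteq> l\<^sup>2(B)\<close>, the Hilbert space tensor product of \<open>S\<close> and \<open>T\<close> inside
  \<open>l\<^sup>2(A) \<otimes> l\<^sup>2(B) = l\<^sup>2(A \<times> B)\<close>: the closed linear span of the elementary tensors.\<close>

definition l2_tensor ::
  "'a set \<Rightarrow> 'b set \<Rightarrow> ('a \<Rightarrow> complex) set \<Rightarrow> ('b \<Rightarrow> complex) set \<Rightarrow> ('a \<times> 'b \<Rightarrow> complex) set" where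
  "l2_tensor A B S T =
     \<Inter>{W. closed_L2_subspace (count_space (A \<times> B)) W \<and> (\<forall>a\<in>S. \<forall>b\<in>T. tensor a b \<in> W)}"

text \<open>The space \<open>L\<^sup>2(N; H)\<close> for the Hilbert space \<open>H\<close> given by \<open>L2 N'\<close>. Measurability is weak
  measurability, which is equivalent to strong measurability for separable \<open>H\<close>.\<close>

definition L2_valued :: "'a measure \<Rightarrow> 'b measure \<Rightarrow> ('a \<Rightarrow> 'b \<Rightarrow> complex) set" where
  "L2_valued N N' =
     {F. (\<forall>r\<in>space N. F r \<in> L2 N') \<and>
         (\<forall>a\<in>L2 N'. (\<lambda>r. L2_inner N' (F r) a) \<in> borel_measurable N) \<and>
         integrable N (\<lambda>r. (L2_norm N' (F r))\<^sup>2)}"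


section \<open>The Plancherel transform\<close>

definition chi :: "real^'n::finite \<Rightarrow> real^'n \<Rightarrow> complex" where
  "chi y u = cis (2 * pi * (y \<bullet> u))"

definition fourier :: "(real^'n::finite \<Rightarrow> complex) \<Rightarrow> real^'n \<Rightarrow> complex" where
  "fourier f y = (\<integral>u. f u * chi y u \<partial>lebesgue)"

text \<open>The extension by continuity of \<open>fourier\<close> from \<open>L\<^sup>1 \<inter> L\<^sup>2\<close> to \<open>L\<^sup>2\<close>. By Plancherel's theorem
  such a \<open>g\<close> exists for every \<open>f\<close> in \<open>L\<^sup>2\<close> and is determined up to null sets.\<close>

definition plancherel :: "(real^'n::finite \<Rightarrow> complex) \<Rightarrow> real^'n \<Rightarrow> complex" where
  "plancherel f =
     (SOME g. \<exists>s. (\<forall>k. integrable lebesgue (s k)) \<and> L2_tendsto lebesgue s f \<and>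
                  L2_tendsto lebesgue (\<lambda>k. fourier (s k)) g)"


section \<open>Invariant subspaces and range functions\<close>

definition crys_rep ::
  "'n::finite affine \<Rightarrow> (real^'n \<Rightarrow> complex) \<Rightarrow> real^'n \<Rightarrow> complex" where
  "crys_rep g f = (\<lambda>u. f (matrix_inv (snd g) *v u - fst g))"

definition crys_invariant :: "'n::finite affine set \<Rightarrow> (real^'n \<Rightarrow> complex) set \<Rightarrow> bool" where
  "crys_invariant \<Gamma> V \<longleftrightarrow> (\<forall>g\<in>\<Gamma>. crys_rep g ` V \<subseteq> V)"

text \<open>Measurable range functions from \<open>R\<close> to the closed subspaces of \<open>l\<^sup>2(A)\<close>; only the values on
  \<open>R\<close> are relevant.\<close>

definition measurable_range_function ::
  "(real^'n::finite) set \<Rightarrow> 'a set \<Rightarrow> (real^'n \<Rightarrow> ('a \<Rightarrow> complex) set) \<Rightarrow> bool" where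
  "measurable_range_function R A K \<longleftrightarrow>
     (\<forall>r\<in>R. closed_L2_subspace (count_space A) (K r)) \<and>
     (\<forall>a\<in>L2 (count_space A). \<forall>b\<in>L2 (count_space A).
        (\<lambda>r. L2_inner (count_space A) (L2_proj (count_space A) (K r) a) b)
          \<in> borel_measurable (lebesgue_on R))"

text \<open>The direct integral of the spaces \<open>l\<^sup>2(P) \<otimes> K r\<close> over \<open>R\<close>.\<close>

definition direct_integral ::
  "(real^'n::finite) set \<Rightarrow> 'p set \<Rightarrow> 'a set \<Rightarrow> (real^'n \<Rightarrow> ('a \<Rightarrow> complex) set)
    \<Rightarrow> (real^'n \<Rightarrow> 'p \<times> 'a \<Rightarrow> complex) set" where
  "direct_integral R P A K =
     {F \<in> L2_valued (lebesgue_on R) (count_space (P \<times> A)).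
        AE r in lebesgue_on R. F r \<in> l2_tensor P A (L2 (count_space P)) (K r)}"

definition range_space ::
  "'n::finite affine set \<Rightarrow> (real^'n) set \<Rightarrow> (real^'n^'n \<Rightarrow> 'n affine)
    \<Rightarrow> (real^'n \<Rightarrow> (real^'n \<Rightarrow> complex) set) \<Rightarrow> (real^'n \<Rightarrow> complex) set" where
  "range_space \<Gamma> R \<gamma> K =
     {f \<in> L2 lebesgue.
        \<exists>F\<in>direct_integral R (point_group \<Gamma>) (dual_lattice \<Gamma>) K.
          AE r in lebesgue_on R. \<forall>(z, M)\<in>dual_group \<Gamma>.
            plancherel f (M *v (r + z)) =
              chi z (fst (\<gamma> M)) *
              L2_inner (count_space (point_group \<Gamma> \<times> dual_lattice \<Gamma>))
                (F r) (tensor (delta M) (delta z))}"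

end

theory Submission
  imports Defs "HOL-Analysis.Function_Metric" "HOL-Probability.Characteristic_Functions"
begin

text \<open>Write \<open>\<Lambda>\<close> for the lattice, \<open>A\<close> for its dual and \<open>P\<close> for the point group. The Plancherel
  transform carries the representation of \<open>\<Gamma>\<close> to a representation \<open>dual_rep\<close> on \<open>L\<^sup>2(\<real>\<^sup>n)\<close> by
  weighted compositions \<open>\<phi> \<mapsto> \<chi>\<^sub>x(L\<^sup>-\<^sup>1 y) \<phi>(L\<^sup>-\<^sup>1 y)\<close>, in which the translations \<open>x \<in> \<Lambda>\<close> act as
  multiplication by characters. So everything reduces to closed subspaces \<open>V\<close> of \<open>L\<^sup>2(\<real>\<^sup>n)\<close> that
  are invariant under \<open>dual_rep\<close>. For \<open>r \<in> R\<close> call \<open>z \<mapsto> \<phi>(r + z)\<close>, with \<open>z \<in> A\<close>, the fibre of \<open>\<phi>\<close>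
  over \<open>r\<close>. Up to a scalar of modulus 1, the component of the element \<open>F(r)\<close> of
  \<open>l\<^sup>2(P) \<otimes> l\<^sup>2(A)\<close> at \<open>M\<close> is the fibre of a translate of \<open>\<phi>\<close> under \<open>dual_rep\<close> (\<open>dual_rep_fibre\<close>).
  Hence the space described by a range function \<open>K\<close> consists of the \<open>\<phi>\<close> all of whose translates
  have fibres in \<open>K r\<close> for almost every \<open>r\<close> (\<open>range_space_eq\<close>); this is independent of the
  cross-section, and closed and invariant.

  The multiplications by characters \<open>\<chi>\<^sub>x\<close>, \<open>x \<in> \<Lambda>\<close>, generate those by indicators of the sets
  \<open>E + A\<close>: the points that these characters do not separate are exactly those that differ by an
  element of \<open>A\<close>, so by the Stone--Weierstrass theorem an integrable function orthogonal to the
  characters has integral 0 over each \<open>E + A\<close> (\<open>annihilated_by_characters\<close>). Therefore the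
  orthogonal projection onto an invariant \<open>V\<close> acts fibre by fibre. Let \<open>K r\<close> be the closed span of
  the fibres over \<open>r\<close> of the projections of the basis fields \<open>r \<mapsto> \<rho>(r) \<delta>\<^sub>w\<close>, for \<open>w \<in> A\<close>, where
  \<open>\<rho>\<close> is a positive square-integrable weight. The projection onto \<open>K r\<close> is then
  given by these fibres (\<open>range_fun_proj_delta\<close>), which makes \<open>K\<close> measurable, and \<open>V\<close> consists of the functions described by \<open>K\<close> (\<open>eq_invariant_fibre_space\<close>).
  Conversely \<open>K\<close> is recovered from the space that it describes, since this space contains the
  functions whose fibres are \<open>\<rho>(r)\<close> times the projection of \<open>\<delta>\<^sub>z\<close> onto \<open>K r\<close>
  (\<open>proj_field_invariant\<close>).

  Plancherel's theorem itself is derived from the Gaussians: modulated translates of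
  \<open>exp (- \<pi> |u|\<^sup>2)\<close> are permuted by the Fourier transform up to scalars, and they are total in
  \<open>L\<^sup>2\<close> by \<open>annihilated_by_characters\<close> applied to all characters of \<open>\<real>\<^sup>n\<close>.\<close>

section \<open>Hilbert space geometry of square-integrable functions\<close>

definition sqnorm :: "'a measure \<Rightarrow> ('a \<Rightarrow> complex) \<Rightarrow> real" where
  "sqnorm N f = (\<integral>x. (cmod (f x))\<^sup>2 \<partial>N)"

lemma borel_measurable_cnj [measurable (raw)]:
  "f \<in> borel_measurable N \<Longrightarrow> (\<lambda>x. cnj (f x)) \<in> borel_measurable N"
  by (rule borel_measurable_continuous_on[where f=cnj]) (auto intro: continuous_intros)

lemma sqnorm_nonneg: "0 \<le> sqnorm N f"
  unfolding sqnorm_def by simp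

lemma L2_norm_squared: "(L2_norm N f)\<^sup>2 = sqnorm N f"
  unfolding L2_norm_def sqnorm_def by simp

lemma L2I: "f \<in> borel_measurable N \<Longrightarrow> integrable N (\<lambda>x. (cmod (f x))\<^sup>2) \<Longrightarrow> f \<in> L2 N"
  unfolding L2_def by simp

lemma L2_measurable: "f \<in> L2 N \<Longrightarrow> f \<in> borel_measurable N"
  unfolding L2_def by simp

lemma L2_integrable: "f \<in> L2 N \<Longrightarrow> integrable N (\<lambda>x. (cmod (f x))\<^sup>2)"
  unfolding L2_def by simp

lemma cmod_add_squared_le: "(cmod (a + b))\<^sup>2 \<le> 2 * (cmod a)\<^sup>2 + 2 * (cmod b)\<^sup>2"
proof -
  have "(cmod (a + b))\<^sup>2 \<le> (cmod a + cmod b)\<^sup>2"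
    by (simp add: norm_triangle_ineq power_mono)
  also have "\<dots> \<le> 2 * (cmod a)\<^sup>2 + 2 * (cmod b)\<^sup>2"
    using sum_squares_bound[of "cmod a" "cmod b"] by (simp add: power2_sum)
  finally show ?thesis .
qed

lemma L2_add:
  assumes "f \<in> L2 N" "g \<in> L2 N" shows "(\<lambda>x. f x + g x) \<in> L2 N"
proof (rule L2I)
  note [measurable] = assms[THEN L2_measurable]
  show "(\<lambda>x. f x + g x) \<in> borel_measurable N" by simp
  show "integrable N (\<lambda>x. (cmod (f x + g x))\<^sup>2)"
    by (rule Bochner_Integration.integrable_bound
        [of _ "\<lambda>x. 2 * (cmod (f x))\<^sup>2 + 2 * (cmod (g x))\<^sup>2"])
       (use assms[THEN L2_integrable] in \<open>auto intro!: cmod_add_squared_le\<close>)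
qed

lemma L2_scale: "f \<in> L2 N \<Longrightarrow> (\<lambda>x. c * f x) \<in> L2 N"
  unfolding L2_def by (auto simp: norm_mult power_mult_distrib)

lemma L2_diff: "f \<in> L2 N \<Longrightarrow> g \<in> L2 N \<Longrightarrow> (\<lambda>x. f x - g x) \<in> L2 N"
  using L2_add[of f N "\<lambda>x. -1 * g x"] L2_scale[of g N "-1"] by simp

lemma L2_zero: "(\<lambda>_. 0) \<in> L2 N"
  unfolding L2_def by simp

lemma L2_cnj: "f \<in> L2 N \<Longrightarrow> (\<lambda>x. cnj (f x)) \<in> L2 N"
  unfolding L2_def by auto

lemma L2_dominated:
  assumes "g \<in> L2 N" "f \<in> borel_measurable N" "AE x in N. cmod (f x) \<le> cmod (g x)"
  shows "f \<in> L2 N"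
proof (rule L2I)
  note [measurable] = assms(2)
  show "integrable N (\<lambda>x. (cmod (f x))\<^sup>2)"
    by (rule Bochner_Integration.integrable_bound[OF L2_integrable[OF assms(1)]])
       (use assms(3) in \<open>auto elim!: eventually_mono intro: power_mono\<close>)
qed fact

lemma L2_cong: "(\<And>x. x \<in> space N \<Longrightarrow> f x = g x) \<Longrightarrow> f \<in> L2 N \<longleftrightarrow> g \<in> L2 N"
  unfolding L2_def
  by (auto cong: measurable_cong Bochner_Integration.integrable_cong)

lemma cmod_mult_le: "cmod (a * b) \<le> (cmod a)\<^sup>2 + (cmod b)\<^sup>2"
proof -
  have "2 * (cmod a * cmod b) \<le> (cmod a)\<^sup>2 + (cmod b)\<^sup>2"
    using sum_squares_bound[of "cmod a" "cmod b"] by simp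
  moreover have "0 \<le> cmod a * cmod b" by simp
  ultimately show ?thesis unfolding norm_mult by linarith
qed

lemma L2_mult_integrable:
  assumes "f \<in> L2 N" "g \<in> L2 N" shows "integrable N (\<lambda>x. f x * g x)"
proof (rule Bochner_Integration.integrable_bound
    [of _ "\<lambda>x. (cmod (f x))\<^sup>2 + (cmod (g x))\<^sup>2"])
  show "integrable N (\<lambda>x. (cmod (f x))\<^sup>2 + (cmod (g x))\<^sup>2)"
    using assms[THEN L2_integrable] by simp
  show "(\<lambda>x. f x * g x) \<in> borel_measurable N"
    using assms[THEN L2_measurable] by simp
qed (simp add: cmod_mult_le)

lemma L2_inner_integrable:
  "f \<in> L2 N \<Longrightarrow> g \<in> L2 N \<Longrightarrow> integrable N (\<lambda>x. f x * cnj (g x))"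
  by (intro L2_mult_integrable L2_cnj)

lemma L2_inner_add:
  "f \<in> L2 N \<Longrightarrow> g \<in> L2 N \<Longrightarrow> h \<in> L2 N \<Longrightarrow>
    L2_inner N (\<lambda>x. f x + g x) h = L2_inner N f h + L2_inner N g h"
  unfolding L2_inner_def by (simp add: distrib_right L2_inner_integrable)

lemma L2_inner_diff:
  "f \<in> L2 N \<Longrightarrow> g \<in> L2 N \<Longrightarrow> h \<in> L2 N \<Longrightarrow>
    L2_inner N (\<lambda>x. f x - g x) h = L2_inner N f h - L2_inner N g h"
  unfolding L2_inner_def by (simp add: left_diff_distrib L2_inner_integrable)

lemma L2_inner_scale: "L2_inner N (\<lambda>x. c * f x) h = c * L2_inner N f h"
  unfolding L2_inner_def by (simp add: mult.assoc)

lemma L2_inner_commute: "L2_inner N g f = cnj (L2_inner N f g)"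
proof -
  have "L2_inner N g f = (\<integral>x. cnj (f x * cnj (g x)) \<partial>N)"
    by (simp add: L2_inner_def mult.commute)
  then show ?thesis by (simp only: Bochner_Integration.integral_cnj L2_inner_def)
qed

lemma L2_inner_scale_right: "L2_inner N h (\<lambda>x. c * f x) = cnj c * L2_inner N h f"
  by (metis L2_inner_commute L2_inner_scale complex_cnj_mult)

lemma L2_inner_zero_sym: "L2_inner N f g = 0 \<longleftrightarrow> L2_inner N g f = 0"
  by (metis L2_inner_commute complex_cnj_zero_iff)

lemma L2_inner_self: "L2_inner N f f = of_real (sqnorm N f)"
  unfolding L2_inner_def sqnorm_def
  by (simp add: complex_norm_square[symmetric] del: of_real_power)

lemma sqnorm_cong_AE:
  assumes "f \<in> borel_measurable N" "g \<in> borel_measurable N" "AE x in N. f x = g x"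
  shows "sqnorm N f = sqnorm N g"
  unfolding sqnorm_def by (rule integral_cong_AE) (use assms in auto)

lemma sqnorm_zero_iff:
  assumes "f \<in> L2 N" shows "sqnorm N f = 0 \<longleftrightarrow> (AE x in N. f x = 0)"
  unfolding sqnorm_def
  by (subst integral_nonneg_eq_0_iff_AE) (use L2_integrable[OF assms] in auto)

lemma sqnorm_add_le:
  assumes "f \<in> L2 N" "g \<in> L2 N"
  shows "sqnorm N (\<lambda>x. f x + g x) \<le> 2 * sqnorm N f + 2 * sqnorm N g"
proof -
  have "sqnorm N (\<lambda>x. f x + g x) \<le> (\<integral>x. 2 * (cmod (f x))\<^sup>2 + 2 * (cmod (g x))\<^sup>2 \<partial>N)"
    unfolding sqnorm_def
    by (rule integral_mono)
       (use assms[THEN L2_integrable] L2_integrable[OF L2_add[OF assms]] in \<open>auto intro!: cmod_add_squared_le\<close>)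
  then show ?thesis
    using assms[THEN L2_integrable] by (simp add: sqnorm_def)
qed

lemma sqnorm_scale: "sqnorm N (\<lambda>x. c * f x) = (cmod c)\<^sup>2 * sqnorm N f"
  unfolding sqnorm_def by (simp add: norm_mult power_mult_distrib)

lemma sqnorm_minus_commute: "sqnorm N (\<lambda>x. f x - g x) = sqnorm N (\<lambda>x. g x - f x)"
  unfolding sqnorm_def by (simp add: norm_minus_commute)

lemma sqnorm_diff_le:
  assumes "f \<in> L2 N" "g \<in> L2 N" "h \<in> L2 N"
  shows "sqnorm N (\<lambda>x. f x - h x) \<le> 2 * sqnorm N (\<lambda>x. f x - g x) + 2 * sqnorm N (\<lambda>x. g x - h x)"
  using sqnorm_add_le[of "\<lambda>x. f x - g x" N "\<lambda>x. g x - h x"] assms by (simp add: L2_diff)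

lemma sqnorm_add:
  assumes "f \<in> L2 N" "g \<in> L2 N"
  shows "sqnorm N (\<lambda>x. f x + g x) = sqnorm N f + 2 * Re (L2_inner N f g) + sqnorm N g"
proof -
  have "of_real (sqnorm N (\<lambda>x. f x + g x)) = L2_inner N (\<lambda>x. f x + g x) (\<lambda>x. f x + g x)"
    by (simp add: L2_inner_self)
  also have "\<dots> = L2_inner N f (\<lambda>x. f x + g x) + L2_inner N g (\<lambda>x. f x + g x)"
    using assms by (intro L2_inner_add L2_add)
  also have "\<dots> = cnj (L2_inner N f f + L2_inner N g f) + cnj (L2_inner N f g + L2_inner N g g)"
    using assms by (simp add: L2_inner_commute[of N _ "\<lambda>x. f x + g x"] L2_inner_add)
  also have "\<dots> = of_real (sqnorm N f + sqnorm N g) + (cnj (L2_inner N f g) + L2_inner N f g)"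
    by (simp add: L2_inner_commute[of N g f] L2_inner_self)
  also have "\<dots> = of_real (sqnorm N f + 2 * Re (L2_inner N f g) + sqnorm N g)"
    by (simp add: complex_eq_iff)
  finally show ?thesis by (simp only: of_real_eq_iff)
qed

lemma L2_inner_Cauchy_Schwarz:
  assumes "f \<in> L2 N" "g \<in> L2 N"
  shows "(cmod (L2_inner N f g))\<^sup>2 \<le> sqnorm N f * sqnorm N g"
proof -
  define p where "p = L2_inner N f g"
  have expand: "sqnorm N (\<lambda>x. f x + c * g x) = sqnorm N f + 2 * Re (cnj c * p) + (cmod c)\<^sup>2 * sqnorm N g" for c
    using sqnorm_add[OF assms(1) L2_scale[OF assms(2), of c]]
    by (simp only: sqnorm_scale L2_inner_scale_right p_def)
  show ?thesis
  proof (cases "sqnorm N g = 0")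
    case True
    have "0 \<le> sqnorm N f - 2 * t * (cmod p)\<^sup>2" for t :: real
      using sqnorm_nonneg[of N "\<lambda>x. f x + (- of_real t * p) * g x"] True
      unfolding expand
      by (simp add: cmod_power2) (simp add: algebra_simps power2_eq_square)
    from this[of "(sqnorm N f + 1) / (cmod p)\<^sup>2"] have "p = 0"
      using sqnorm_nonneg[of N f] by (cases "p = 0") auto
    then show ?thesis
      using True by (simp add: p_def)
  next
    case False
    then have pos: "sqnorm N g > 0" using sqnorm_nonneg[of N g] by simp
    define t where "t = 1 / sqnorm N g"
    have "0 \<le> sqnorm N f - 2 * t * (cmod p)\<^sup>2 + (t * cmod p)\<^sup>2 * sqnorm N g"
      using sqnorm_nonneg[of N "\<lambda>x. f x + (- of_real t * p) * g x"]
      unfolding expand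
      by (simp add: norm_mult power_mult_distrib cmod_power2) (simp add: algebra_simps power2_eq_square)
    then have "0 \<le> sqnorm N f - (cmod p)\<^sup>2 / sqnorm N g"
      using pos by (simp add: t_def power2_eq_square field_simps)
    then show ?thesis
      using pos by (simp add: p_def field_simps)
  qed
qed

subsection \<open>Convergence and completeness\<close>

lemma L2_tendsto_iff:
  "L2_tendsto N s f \<longleftrightarrow>
     (\<forall>k. s k \<in> L2 N) \<and> f \<in> L2 N \<and> (\<lambda>k. sqnorm N (\<lambda>x. s k x - f x)) \<longlonglongrightarrow> 0"
proof -
  have "(\<lambda>k. L2_norm N (\<lambda>x. s k x - f x)) \<longlonglongrightarrow> 0 \<longleftrightarrow>
        (\<lambda>k. sqnorm N (\<lambda>x. s k x - f x)) \<longlonglongrightarrow> 0"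
  proof
    assume "(\<lambda>k. L2_norm N (\<lambda>x. s k x - f x)) \<longlonglongrightarrow> 0"
    then show "(\<lambda>k. sqnorm N (\<lambda>x. s k x - f x)) \<longlonglongrightarrow> 0"
      using tendsto_power[of _ 0 _ 2] by (fastforce simp flip: L2_norm_squared)
  next
    assume "(\<lambda>k. sqnorm N (\<lambda>x. s k x - f x)) \<longlonglongrightarrow> 0"
    from tendsto_real_sqrt[OF this] show "(\<lambda>k. L2_norm N (\<lambda>x. s k x - f x)) \<longlonglongrightarrow> 0"
      by (simp add: sqnorm_def L2_norm_def)
  qed
  then show ?thesis by (simp add: L2_tendsto_def)
qed

lemma sqnorm_tendsto_0:
  assumes "\<And>k. sqnorm N (g k) \<le> u k" "u \<longlonglongrightarrow> 0"
  shows "(\<lambda>k. sqnorm N (g k)) \<longlonglongrightarrow> 0"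
  using tendsto_sandwich[OF _ _ tendsto_const assms(2), of "\<lambda>k. sqnorm N (g k)"] assms(1)
  by (simp add: sqnorm_nonneg)

lemma L2_inner_tendsto:
  assumes "L2_tendsto N s f" "g \<in> L2 N"
  shows "(\<lambda>k. L2_inner N (s k) g) \<longlonglongrightarrow> L2_inner N f g"
proof -
  have s: "\<And>k. s k \<in> L2 N" and f: "f \<in> L2 N"
    and lim: "(\<lambda>k. sqnorm N (\<lambda>x. s k x - f x)) \<longlonglongrightarrow> 0"
    using assms(1) by (auto simp: L2_tendsto_iff)
  have "(\<lambda>k. sqrt (sqnorm N (\<lambda>x. s k x - f x) * sqnorm N g)) \<longlonglongrightarrow> 0"
    using tendsto_real_sqrt[OF tendsto_mult_left_zero[OF lim, of "sqnorm N g"]] by simp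
  then have "(\<lambda>k. L2_inner N (s k) g - L2_inner N f g) \<longlonglongrightarrow> 0"
  proof (rule Lim_null_comparison[rotated])
    show "\<forall>\<^sub>F k in sequentially. norm (L2_inner N (s k) g - L2_inner N f g)
            \<le> sqrt (sqnorm N (\<lambda>x. s k x - f x) * sqnorm N g)"
      using L2_inner_Cauchy_Schwarz[OF L2_diff[OF s f] assms(2)]
      by (simp add: L2_inner_diff[OF s f assms(2)] real_le_rsqrt)
  qed
  then show ?thesis by (simp add: LIM_zero_iff)
qed

lemma sqnorm_tendsto:
  assumes "L2_tendsto N s f"
  shows "(\<lambda>k. sqnorm N (s k)) \<longlonglongrightarrow> sqnorm N f"
proof -
  have s: "\<And>k. s k \<in> L2 N" and f: "f \<in> L2 N"
    and lim: "(\<lambda>k. sqnorm N (\<lambda>x. s k x - f x)) \<longlonglongrightarrow> 0"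
    using assms by (auto simp: L2_tendsto_iff)
  have "sqnorm N (s k) = sqnorm N (\<lambda>x. s k x - f x) + 2 * Re (L2_inner N (s k) f - L2_inner N f f) + sqnorm N f" for k
    using sqnorm_add[OF L2_diff[OF s f] f, of k] by (simp add: L2_inner_diff[OF s f f])
  moreover have "(\<lambda>k. sqnorm N (\<lambda>x. s k x - f x) + 2 * Re (L2_inner N (s k) f - L2_inner N f f) + sqnorm N f)
      \<longlonglongrightarrow> 0 + 2 * Re (L2_inner N f f - L2_inner N f f) + sqnorm N f"
    by (intro tendsto_intros lim L2_inner_tendsto[OF assms f])
  ultimately show ?thesis by simp
qed

text \<open>Riesz--Fischer. Along a subsequence the squared increments \<open>d\<^sub>k\<close> have integrals at most
  \<open>4\<^sup>-\<^sup>k\<close>, so \<open>\<Sum>k. 2\<^sup>k d\<^sub>k\<close> has a finite integral. At almost every point it is finite, which forces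
  geometric decay of the increments there, and Fatou's lemma identifies the pointwise limit as the
  limit in the mean.\<close>

lemma L2_complete:
  assumes s: "\<And>k. s k \<in> L2 N"
    and cauchy: "\<And>e. e > 0 \<Longrightarrow> \<exists>K. \<forall>j\<ge>K. \<forall>k\<ge>K. sqnorm N (\<lambda>x. s j x - s k x) < e"
  obtains f where "L2_tendsto N s f"
proof -
  have [measurable]: "\<And>k. s k \<in> borel_measurable N" using s L2_measurable by blast
  have "\<exists>m. \<forall>i. (\<forall>j\<ge>m i. \<forall>k\<ge>m i. sqnorm N (\<lambda>x. s j x - s k x) < (1/4)^i)"
    using cauchy[of "(1/4)^_"] by (intro choice) simp
  then obtain m where m: "\<And>i j k. j \<ge> m i \<Longrightarrow> k \<ge> m i \<Longrightarrow> sqnorm N (\<lambda>x. s j x - s k x) < (1/4)^i"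
    by blast
  \<comment> \<open>a subsequence that exceeds every \<open>m i\<close> and tends to infinity\<close>
  define r where "r i = (\<Sum>l\<le>i. m l) + i" for i
  have r_ge: "r i \<ge> m i" "r (Suc i) \<ge> m i" "r i \<ge> i" for i
    using member_le_sum[of i "{..i}" m] by (auto simp: r_def)
  define d where "d i x = (cmod (s (r (Suc i)) x - s (r i) x))\<^sup>2" for i x
  have d_int: "integrable N (d i)" for i
    unfolding d_def by (intro L2_integrable L2_diff s)
  have [measurable]: "d i \<in> borel_measurable N" for i
    using d_int by blast
  have d_le: "(\<integral>x. d i x \<partial>N) \<le> (1/4)^i" for i
    using m[OF r_ge(2) r_ge(1), of i] by (simp add: sqnorm_def d_def)
  have "(\<integral>\<^sup>+x. (\<Sum>i. ennreal (2^i * d i x)) \<partial>N) = (\<Sum>i. \<integral>\<^sup>+x. ennreal (2^i * d i x) \<partial>N)"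
    by (rule nn_integral_suminf) auto
  also have "\<dots> = (\<Sum>i. ennreal (\<integral>x. 2^i * d i x \<partial>N))"
    by (intro arg_cong[where f=suminf] ext nn_integral_eq_integral integrable_mult_right d_int) (auto simp: d_def)
  also have "\<dots> \<le> (\<Sum>i. ennreal ((1/2)^i))"
  proof (intro suminf_le ennreal_leI summableI)
    fix i
    have "(\<integral>x. 2^i * d i x \<partial>N) \<le> 2^i * (1/4)^i"
      using d_le by simp
    also have "\<dots> = (1/2)^i"
      by (simp add: power_mult_distrib[symmetric])
    finally show "(\<integral>x. 2^i * d i x \<partial>N) \<le> (1/2)^i" .
  qed
  also have "\<dots> < \<infinity>"
    by (subst suminf_ennreal2) (auto simp: summable_geometric)
  finally have "AE x in N. (\<Sum>i. ennreal (2^i * d i x)) \<noteq> \<infinity>"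
    by (intro nn_integral_PInf_AE) auto
  then have conv: "AE x in N. convergent (\<lambda>i. s (r i) x)"
  proof eventually_elim
    case (elim x)
    then have "summable (\<lambda>i. 2^i * d i x)"
      by (intro summable_suminf_not_top) (auto simp: d_def)
    from summable_LIMSEQ_zero[OF this] have "Bseq (\<lambda>i. 2^i * d i x)"
      by (intro convergent_imp_Bseq) (auto simp: convergent_def)
    then obtain C where C: "C > 0" "\<And>i. norm (2^i * d i x) \<le> C"
      by (auto simp: Bseq_def)
    have decay: "cmod (s (r (Suc i)) x - s (r i) x) \<le> sqrt C * (sqrt (1/2))^i" for i
    proof -
      have "d i x \<le> C * (1/2)^i"
        using C(2)[of i] by (simp add: d_def power_divide field_simps)
      then have "sqrt (d i x) \<le> sqrt (C * (1/2)^i)" by simp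
      then show ?thesis by (simp add: d_def real_sqrt_mult real_sqrt_power)
    qed
    have "norm (sqrt (1/2 :: real)) < 1" by simp
    then have "summable (\<lambda>i. sqrt C * (sqrt (1/2))^i)"
      by (intro summable_mult summable_geometric)
    then have "summable (\<lambda>i. s (r (Suc i)) x - s (r i) x)"
      by (rule summable_comparison_test'[of _ 0]) (rule decay)
    then have "convergent (\<lambda>i. \<Sum>k<i. s (r (Suc k)) x - s (r k) x)"
      by (simp add: summable_iff_convergent)
    then have "convergent (\<lambda>i. s (r i) x - s (r 0) x)"
      by (simp add: sum_lessThan_telescope[of "\<lambda>k. s (r k) x"])
    then show ?case
      using convergent_add_const_right_iff[of "\<lambda>i. s (r i) x" "- s (r 0) x"] by simp
  qed
  define f where "f x = lim (\<lambda>i. s (r i) x)" for x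
  have [measurable]: "f \<in> borel_measurable N"
    unfolding f_def by simp
  have lim_f: "AE x in N. (\<lambda>i. s (r i) x) \<longlonglongrightarrow> f x"
    using conv by eventually_elim (simp add: f_def convergent_LIMSEQ_iff)
  have fatou: "(\<integral>\<^sup>+x. ennreal ((cmod (s k x - f x))\<^sup>2) \<partial>N) \<le> ennreal e"
    if k: "\<And>j. j \<ge> k \<Longrightarrow> sqnorm N (\<lambda>x. s k x - s j x) \<le> e" for k e
  proof -
    have "(\<integral>\<^sup>+x. ennreal ((cmod (s k x - f x))\<^sup>2) \<partial>N)
        = (\<integral>\<^sup>+x. liminf (\<lambda>i. ennreal ((cmod (s k x - s (r i) x))\<^sup>2)) \<partial>N)"
    proof (rule nn_integral_cong_AE)
      show "AE x in N. ennreal ((cmod (s k x - f x))\<^sup>2)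
              = liminf (\<lambda>i. ennreal ((cmod (s k x - s (r i) x))\<^sup>2))"
        using lim_f
      proof eventually_elim
        case (elim x)
        have "(\<lambda>i. ennreal ((cmod (s k x - s (r i) x))\<^sup>2)) \<longlonglongrightarrow> ennreal ((cmod (s k x - f x))\<^sup>2)"
          by (intro tendsto_intros tendsto_ennrealI elim)
        then show ?case
          by (intro lim_imp_Liminf[symmetric]) simp_all
      qed
    qed
    also have "\<dots> \<le> liminf (\<lambda>i. \<integral>\<^sup>+x. ennreal ((cmod (s k x - s (r i) x))\<^sup>2) \<partial>N)"
      by (rule nn_integral_liminf) auto
    also have "\<dots> = liminf (\<lambda>i. ennreal (sqnorm N (\<lambda>x. s k x - s (r i) x)))"
      unfolding sqnorm_def
      by (intro arg_cong[where f=liminf] ext nn_integral_eq_integral L2_integrable L2_diff s) auto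
    also have "\<dots> \<le> limsup (\<lambda>i. ennreal (sqnorm N (\<lambda>x. s k x - s (r i) x)))"
      by (rule Liminf_le_Limsup) auto
    also have "\<dots> \<le> ennreal e"
    proof (rule Limsup_bounded)
      have "\<forall>\<^sub>F i in sequentially. i \<ge> k" by (rule eventually_ge_at_top)
      then show "\<forall>\<^sub>F i in sequentially. ennreal (sqnorm N (\<lambda>x. s k x - s (r i) x)) \<le> ennreal e"
        by eventually_elim (rule ennreal_leI[OF k[OF order_trans[OF _ r_ge(3)]]])
    qed
    finally show ?thesis .
  qed
  have diff_L2: "(\<lambda>x. s k x - f x) \<in> L2 N" and diff_le: "sqnorm N (\<lambda>x. s k x - f x) \<le> e"
    if k: "\<And>j. j \<ge> k \<Longrightarrow> sqnorm N (\<lambda>x. s k x - s j x) \<le> e" for k e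
  proof -
    have "e \<ge> 0" using k[OF order_refl] sqnorm_nonneg[of N] by (meson order_trans)
    have int: "integrable N (\<lambda>x. (cmod (s k x - f x))\<^sup>2)"
      using fatou[OF k] by (auto simp: integrable_iff_bounded intro: le_less_trans)
    then show "(\<lambda>x. s k x - f x) \<in> L2 N"
      by (auto intro: L2I)
    show "sqnorm N (\<lambda>x. s k x - f x) \<le> e"
      using fatou[OF k] nn_integral_eq_integral[OF int] \<open>e \<ge> 0\<close>
      by (simp add: sqnorm_def)
  qed
  have "f \<in> L2 N"
  proof -
    obtain K where "\<And>j. j \<ge> K \<Longrightarrow> sqnorm N (\<lambda>x. s K x - s j x) \<le> 1"
      using cauchy[of 1] by (auto intro: less_imp_le)
    from L2_diff[OF s diff_L2[OF this], of K] show ?thesis by simp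
  qed
  moreover have "(\<lambda>k. sqnorm N (\<lambda>x. s k x - f x)) \<longlonglongrightarrow> 0"
  proof (rule LIMSEQ_I)
    fix e :: real assume "e > 0"
    then obtain K where K: "\<And>j k. j \<ge> K \<Longrightarrow> k \<ge> K \<Longrightarrow> sqnorm N (\<lambda>x. s j x - s k x) < e/2"
      using cauchy[of "e/2"] by auto
    have "sqnorm N (\<lambda>x. s k x - f x) < e" if "k \<ge> K" for k
      using diff_le[of k "e/2"] K[OF that] \<open>e > 0\<close> that by (force intro: less_imp_le)
    then show "\<exists>K. \<forall>k\<ge>K. norm (sqnorm N (\<lambda>x. s k x - f x) - 0) < e"
      using sqnorm_nonneg[of N] by auto
  qed
  ultimately show ?thesis
    using that[of f] s by (auto simp: L2_tendsto_iff)
qed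

subsection \<open>Closed subspaces and orthogonal projection\<close>

lemma closed_L2_subspaceD:
  assumes "closed_L2_subspace N V"
  shows "V \<subseteq> L2 N" "(\<lambda>_. 0) \<in> V"
    "\<And>f g. f \<in> V \<Longrightarrow> g \<in> V \<Longrightarrow> (\<lambda>x. f x + g x) \<in> V"
    "\<And>c f. f \<in> V \<Longrightarrow> (\<lambda>x. c * f x) \<in> V"
    "\<And>s f. (\<And>k. s k \<in> V) \<Longrightarrow> L2_tendsto N s f \<Longrightarrow> f \<in> V"
proof -
  show "\<And>s f. (\<And>k. s k \<in> V) \<Longrightarrow> L2_tendsto N s f \<Longrightarrow> f \<in> V"
    using assms unfolding closed_L2_subspace_def by meson
qed (use assms in \<open>auto simp: closed_L2_subspace_def\<close>)

lemma closed_L2_subspaceI: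
  assumes "V \<subseteq> L2 N" "(\<lambda>_. 0) \<in> V"
    "\<And>f g. f \<in> V \<Longrightarrow> g \<in> V \<Longrightarrow> (\<lambda>x. f x + g x) \<in> V"
    "\<And>c f. f \<in> V \<Longrightarrow> (\<lambda>x. c * f x) \<in> V"
    "\<And>s f. (\<And>k. s k \<in> V) \<Longrightarrow> L2_tendsto N s f \<Longrightarrow> f \<in> V"
  shows "closed_L2_subspace N V"
  unfolding closed_L2_subspace_def
proof (intro conjI allI impI)
  show "\<And>s f. (\<forall>k. s k \<in> V) \<and> L2_tendsto N s f \<Longrightarrow> f \<in> V"
    using assms(5) by blast
qed (use assms(1-4) in auto)

lemma closed_L2_subspace_UNIV: "closed_L2_subspace N (L2 N)"
  by (rule closed_L2_subspaceI) (auto simp: L2_zero L2_add L2_scale L2_tendsto_def)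

lemma closed_L2_subspace_diff:
  assumes "closed_L2_subspace N V" "f \<in> V" "g \<in> V"
  shows "(\<lambda>x. f x - g x) \<in> V"
  using closed_L2_subspaceD(3)[OF assms(1,2) closed_L2_subspaceD(4)[OF assms(1,3), of "-1"]] by simp

lemma closed_L2_subspace_Inter:
  assumes "\<And>V. V \<in> \<V> \<Longrightarrow> closed_L2_subspace N V" "\<V> \<noteq> {}"
  shows "closed_L2_subspace N (\<Inter>\<V>)"
proof (rule closed_L2_subspaceI)
  show "\<Inter>\<V> \<subseteq> L2 N" using assms closed_L2_subspaceD(1) by blast
next
  fix s f assume "\<And>k. s k \<in> \<Inter>\<V>" "L2_tendsto N s f"
  then show "f \<in> \<Inter>\<V>"
    using closed_L2_subspaceD(5)[OF assms(1)] by (meson InterD InterI)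
qed (use closed_L2_subspaceD(2-4)[OF assms(1)] in auto)

lemma L2_tendsto_add:
  assumes "L2_tendsto N s f" "L2_tendsto N t g"
  shows "L2_tendsto N (\<lambda>k x. s k x + t k x) (\<lambda>x. f x + g x)"
proof -
  have 1: "\<And>k. s k \<in> L2 N" "f \<in> L2 N" "\<And>k. t k \<in> L2 N" "g \<in> L2 N"
    and lim: "(\<lambda>k. sqnorm N (\<lambda>x. s k x - f x)) \<longlonglongrightarrow> 0" "(\<lambda>k. sqnorm N (\<lambda>x. t k x - g x)) \<longlonglongrightarrow> 0"
    using assms by (auto simp: L2_tendsto_iff)
  have "(\<lambda>k. 2 * sqnorm N (\<lambda>x. s k x - f x) + 2 * sqnorm N (\<lambda>x. t k x - g x)) \<longlonglongrightarrow> 2 * 0 + 2 * 0"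
    by (intro tendsto_intros lim)
  then have "(\<lambda>k. sqnorm N (\<lambda>x. (s k x + t k x) - (f x + g x))) \<longlonglongrightarrow> 0"
    using sqnorm_add_le[OF L2_diff[OF 1(1,2)] L2_diff[OF 1(3,4)]]
    by (intro sqnorm_tendsto_0) (auto simp: add_diff_add)
  then show ?thesis
    using 1 by (simp add: L2_tendsto_iff L2_add)
qed

lemma L2_tendsto_scale:
  assumes "L2_tendsto N s f"
  shows "L2_tendsto N (\<lambda>k x. c * s k x) (\<lambda>x. c * f x)"
proof -
  have "(\<lambda>k. (cmod c)\<^sup>2 * sqnorm N (\<lambda>x. s k x - f x)) \<longlonglongrightarrow> 0"
    using assms by (auto simp: L2_tendsto_iff intro: tendsto_mult_right_zero)
  then have "(\<lambda>k. sqnorm N (\<lambda>x. c * s k x - c * f x)) \<longlonglongrightarrow> 0"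
    by (simp add: sqnorm_scale right_diff_distrib[symmetric])
  then show ?thesis
    using assms by (simp add: L2_tendsto_iff L2_scale)
qed

lemma L2_tendsto_Cauchy:
  assumes "L2_tendsto N s f" "e > 0"
  shows "\<exists>K. \<forall>j\<ge>K. \<forall>k\<ge>K. sqnorm N (\<lambda>x. s j x - s k x) < e"
proof -
  have s: "\<And>k. s k \<in> L2 N" and f: "f \<in> L2 N"
    and lim: "(\<lambda>k. sqnorm N (\<lambda>x. s k x - f x)) \<longlonglongrightarrow> 0"
    using assms by (auto simp: L2_tendsto_iff)
  obtain K where K: "\<And>k. k \<ge> K \<Longrightarrow> sqnorm N (\<lambda>x. s k x - f x) < e/4"
    using order_tendstoD(2)[OF lim, of "e/4"] assms(2) by (auto simp: eventually_sequentially)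
  have "sqnorm N (\<lambda>x. s j x - s k x) < e" if "j \<ge> K" "k \<ge> K" for j k
    using sqnorm_diff_le[OF s f s, of j k] K[OF that(1)] K[OF that(2)]
    by (simp add: sqnorm_minus_commute[of N f])
  then show ?thesis by blast
qed

lemma orthogonal_complement_closed:
  assumes "D \<subseteq> L2 N"
  shows "closed_L2_subspace N {f \<in> L2 N. \<forall>g\<in>D. L2_inner N f g = 0}"
proof (rule closed_L2_subspaceI)
  fix s f assume s: "\<And>k. s k \<in> {f \<in> L2 N. \<forall>g\<in>D. L2_inner N f g = 0}" and lim: "L2_tendsto N s f"
  have "L2_inner N f g = 0" if "g \<in> D" for g
    using L2_inner_tendsto[OF lim, of g] s that assms by (auto simp: LIMSEQ_const_iff)
  then show "f \<in> {f \<in> L2 N. \<forall>g\<in>D. L2_inner N f g = 0}"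
    using lim by (simp add: L2_tendsto_def)
next
  show "(\<lambda>_. 0) \<in> {f \<in> L2 N. \<forall>g\<in>D. L2_inner N f g = 0}"
    using L2_zero[of N] by (auto simp: L2_inner_def)
qed (use assms in \<open>auto simp: L2_add L2_scale L2_inner_scale L2_inner_add[OF _ _ subsetD]\<close>)

text \<open>A point of minimal distance. By the parallelogram law a minimizing sequence is Cauchy, and
  minimality forbids any gain from moving along an element of \<open>V\<close>, which is orthogonality.\<close>

lemma L2_projection_exists:
  assumes V: "closed_L2_subspace N V" and a: "a \<in> L2 N"
  shows "\<exists>p. p \<in> V \<and> (\<forall>w\<in>V. L2_inner N (\<lambda>x. a x - p x) w = 0)"
proof -
  note VL2 = subsetD[OF closed_L2_subspaceD(1)[OF V]]
  define dist2 where "dist2 v = sqnorm N (\<lambda>x. a x - v x)" for v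
  define d where "d = (INF v\<in>V. dist2 v)"
  have bdd: "bdd_below (dist2 ` V)"
    by (rule bdd_belowI[of _ 0]) (auto simp: dist2_def sqnorm_nonneg)
  have d_le: "d \<le> dist2 v" if "v \<in> V" for v
    unfolding d_def by (rule cINF_lower[OF bdd that])
  have "\<exists>v\<in>V. dist2 v < d + 1 / real (Suc k)" for k
    using cINF_less_iff[OF _ bdd, of "d + 1 / real (Suc k)"] closed_L2_subspaceD(2)[OF V]
    by (auto simp: d_def[symmetric])
  then obtain v where v: "\<And>k. v k \<in> V" "\<And>k. dist2 (v k) < d + 1 / real (Suc k)"
    by metis
  have par: "sqnorm N (\<lambda>x. v j x - v k x) \<le> 2 / real (Suc j) + 2 / real (Suc k)" for j k
  proof -
    define f g where "f x = a x - v j x" and "g x = a x - v k x" for x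
    have fg: "f \<in> L2 N" "g \<in> L2 N"
      unfolding f_def g_def by (intro L2_diff a VL2 v(1))+
    have mid: "(\<lambda>x. (1/2) * (v j x + v k x)) \<in> V"
      by (intro closed_L2_subspaceD(3,4)[OF V] v)
    have "sqnorm N (\<lambda>x. f x + g x) + sqnorm N (\<lambda>x. f x + (-1) * g x) = 2 * sqnorm N f + 2 * sqnorm N g"
      unfolding sqnorm_add[OF fg] sqnorm_add[OF fg(1) L2_scale[OF fg(2)]] sqnorm_scale
        L2_inner_scale_right
      by simp
    moreover have "sqnorm N (\<lambda>x. f x + g x) = 4 * dist2 (\<lambda>x. (1/2) * (v j x + v k x))"
    proof -
      have "sqnorm N (\<lambda>x. f x + g x) = sqnorm N (\<lambda>x. 2 * (a x - (1/2) * (v j x + v k x)))"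
        by (simp add: f_def g_def algebra_simps)
      then show ?thesis unfolding sqnorm_scale dist2_def by simp
    qed
    moreover have "sqnorm N (\<lambda>x. f x + (-1) * g x) = sqnorm N (\<lambda>x. v j x - v k x)"
      by (subst sqnorm_minus_commute) (simp add: f_def g_def)
    moreover have "sqnorm N f = dist2 (v j)" "sqnorm N g = dist2 (v k)"
      by (simp_all add: f_def[abs_def] g_def[abs_def] dist2_def)
    ultimately show ?thesis
      using d_le[OF mid] v(2)[of j] v(2)[of k] by simp
  qed
  have "\<exists>K. \<forall>j\<ge>K. \<forall>k\<ge>K. sqnorm N (\<lambda>x. v j x - v k x) < e" if e: "e > 0" for e
  proof -
    obtain K where K: "1 / real (Suc K) < e / 4"
      using nat_approx_posE[of "e/4"] e by auto
    have "sqnorm N (\<lambda>x. v j x - v k x) < e" if "j \<ge> K" "k \<ge> K" for j k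
    proof -
      have "1 / real (Suc j) \<le> 1 / real (Suc K)" "1 / real (Suc k) \<le> 1 / real (Suc K)"
        using that by (auto intro!: divide_left_mono)
      then show ?thesis using par[of j k] K by simp
    qed
    then show ?thesis by blast
  qed
  then obtain p where p: "L2_tendsto N v p"
    using L2_complete[of v N] v(1) VL2 by metis
  have pV: "p \<in> V"
    using closed_L2_subspaceD(5)[OF V v(1) p] .
  have "L2_inner N (\<lambda>x. a x - p x) w = 0" if w: "w \<in> V" for w
  proof -
    have orth_seq: "(cmod (L2_inner N (\<lambda>x. a x - v k x) w))\<^sup>2 \<le> (1 / real (Suc k)) * sqnorm N w" for k
    proof (cases "sqnorm N w = 0")
      case True
      then show ?thesis
        using L2_inner_Cauchy_Schwarz[OF L2_diff[OF a VL2[OF v(1)]] VL2[OF w], of k] by simp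
    next
      case False
      then have pos: "sqnorm N w > 0" using sqnorm_nonneg[of N w] by simp
      define q where "q = L2_inner N (\<lambda>x. a x - v k x) w"
      \<comment> \<open>the optimal step along \<open>w\<close>\<close>
      define c where "c = q / of_real (sqnorm N w)"
      have "d \<le> dist2 (\<lambda>x. v k x + c * w x)"
        by (intro d_le closed_L2_subspaceD(3,4)[OF V] v w)
      also have "\<dots> = sqnorm N (\<lambda>x. (a x - v k x) + (- c) * w x)"
        by (simp add: dist2_def algebra_simps)
      also have "\<dots> = dist2 (v k) - 2 * Re (cnj c * q) + (cmod c)\<^sup>2 * sqnorm N w"
        unfolding sqnorm_add[OF L2_diff[OF a VL2[OF v(1)]] L2_scale[OF VL2[OF w]]] sqnorm_scale
          L2_inner_scale_right
        by (simp add: dist2_def q_def)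
      also have "\<dots> = dist2 (v k) - (cmod q)\<^sup>2 / sqnorm N w"
      proof -
        have "cnj c * q = of_real ((cmod q)\<^sup>2 / sqnorm N w)"
          using complex_norm_square[of q] by (simp add: c_def mult.commute)
        then have "Re (cnj c * q) = (cmod q)\<^sup>2 / sqnorm N w"
          by (simp only: Re_complex_of_real)
        moreover have "(cmod c)\<^sup>2 * sqnorm N w = (cmod q)\<^sup>2 / sqnorm N w"
          using pos by (simp add: c_def norm_divide power_divide power2_eq_square)
        ultimately show ?thesis by simp
      qed
      finally have "(cmod q)\<^sup>2 / sqnorm N w \<le> 1 / real (Suc k)"
        using v(2)[of k] by simp
      then show ?thesis using pos by (simp add: q_def field_simps)
    qed
    have "L2_tendsto N (\<lambda>k x. a x + (-1) * v k x) (\<lambda>x. a x + (-1) * p x)"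
      by (intro L2_tendsto_add L2_tendsto_scale p) (simp add: L2_tendsto_iff a sqnorm_def)
    then have "(\<lambda>k. L2_inner N (\<lambda>x. a x - v k x) w) \<longlonglongrightarrow> L2_inner N (\<lambda>x. a x - p x) w"
      using L2_inner_tendsto VL2[OF w] by fastforce
    then have "(\<lambda>k. (cmod (L2_inner N (\<lambda>x. a x - v k x) w))\<^sup>2) \<longlonglongrightarrow> (cmod (L2_inner N (\<lambda>x. a x - p x) w))\<^sup>2"
      by (intro tendsto_intros)
    moreover have "(\<lambda>k. (1 / real (Suc k)) * sqnorm N w) \<longlonglongrightarrow> 0"
      using tendsto_mult_left_zero[OF LIMSEQ_inverse_real_of_nat] by (simp add: inverse_eq_divide)
    ultimately have "(cmod (L2_inner N (\<lambda>x. a x - p x) w))\<^sup>2 \<le> 0"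
      using orth_seq by (intro LIMSEQ_le) auto
    then show ?thesis by simp
  qed
  with pV show ?thesis by blast
qed

lemma L2_proj:
  assumes "closed_L2_subspace N V" "a \<in> L2 N"
  shows "L2_proj N V a \<in> V"
    and "\<And>w. w \<in> V \<Longrightarrow> L2_inner N (\<lambda>x. a x - L2_proj N V a x) w = 0"
  using someI_ex[OF L2_projection_exists[OF assms]] unfolding L2_proj_def by auto

lemma L2_proj_L2: "closed_L2_subspace N V \<Longrightarrow> a \<in> L2 N \<Longrightarrow> L2_proj N V a \<in> L2 N"
  using L2_proj(1) closed_L2_subspaceD(1) by blast

lemma L2_proj_inner:
  assumes "closed_L2_subspace N V" "a \<in> L2 N" "w \<in> V"
  shows "L2_inner N (L2_proj N V a) w = L2_inner N a w"
  using L2_proj(2)[OF assms] assms L2_proj_L2[OF assms(1,2)] closed_L2_subspaceD(1)[OF assms(1)]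
  by (simp add: L2_inner_diff subset_iff)

lemma L2_proj_unique:
  assumes V: "closed_L2_subspace N V" and a: "a \<in> L2 N"
    and p: "p \<in> V" "\<And>w. w \<in> V \<Longrightarrow> L2_inner N (\<lambda>x. a x - p x) w = 0"
  shows "AE x in N. L2_proj N V a x = p x"
proof -
  define q where "q x = L2_proj N V a x - p x" for x
  have L2: "p \<in> L2 N" "L2_proj N V a \<in> L2 N"
    using p(1) L2_proj_L2[OF V a] closed_L2_subspaceD(1)[OF V] by auto
  have qV: "q \<in> V"
    unfolding q_def by (intro closed_L2_subspace_diff[OF V] L2_proj(1)[OF V a] p)
  then have qL2: "q \<in> L2 N" using closed_L2_subspaceD(1)[OF V] by auto
  have "L2_inner N q q = L2_inner N (\<lambda>x. (a x - p x) - (a x - L2_proj N V a x)) q"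
    by (simp add: q_def[abs_def])
  also have "\<dots> = 0"
    using p(2)[OF qV] L2_proj(2)[OF V a qV] a L2 qL2
    by (subst L2_inner_diff) (auto intro: L2_diff)
  finally have "sqnorm N q = 0" by (simp add: L2_inner_self)
  then show ?thesis
    using sqnorm_zero_iff[OF qL2] by (simp add: q_def)
qed

lemma L2_proj_self_adjoint:
  assumes V: "closed_L2_subspace N V" and "a \<in> L2 N" "b \<in> L2 N"
  shows "L2_inner N (L2_proj N V a) b = L2_inner N a (L2_proj N V b)"
proof -
  have "L2_inner N (L2_proj N V a) b = L2_inner N (L2_proj N V a) (L2_proj N V b)"
    using L2_proj_inner[OF V assms(3) L2_proj(1)[OF V assms(2)]]
    by (metis L2_inner_commute)
  also have "\<dots> = L2_inner N a (L2_proj N V b)"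
    by (rule L2_proj_inner[OF V assms(2) L2_proj(1)[OF V assms(3)]])
  finally show ?thesis .
qed

lemma L2_proj_sqnorm_le:
  assumes V: "closed_L2_subspace N V" and a: "a \<in> L2 N"
  shows "sqnorm N (L2_proj N V a) \<le> sqnorm N a"
proof -
  note p = L2_proj_L2[OF V a]
  have "sqnorm N (\<lambda>x. (a x - L2_proj N V a x) + L2_proj N V a x)
      = sqnorm N (\<lambda>x. a x - L2_proj N V a x) + sqnorm N (L2_proj N V a)"
    unfolding sqnorm_add[OF L2_diff[OF a p] p] by (simp add: L2_proj(2)[OF V a L2_proj(1)[OF V a]])
  then show ?thesis using sqnorm_nonneg[of N "\<lambda>x. a x - L2_proj N V a x"] by simp
qed

lemma L2_proj_fixed:
  assumes V: "closed_L2_subspace N V" and a: "a \<in> L2 N"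
    and "L2_inner N a (\<lambda>x. a x - L2_proj N V a x) = 0"
  shows "a \<in> V"
proof -
  define w where "w x = a x - L2_proj N V a x" for x
  note p = L2_proj(1)[OF V a] L2_proj_L2[OF V a]
  have w: "w \<in> L2 N" unfolding w_def by (rule L2_diff[OF a p(2)])
  have "L2_inner N (L2_proj N V a) w = 0"
    using L2_proj(2)[OF V a p(1)] L2_inner_zero_sym unfolding w_def by blast
  then have "L2_inner N w w = 0"
    using assms(3) L2_inner_diff[OF a p(2) w] by (simp add: w_def[abs_def])
  then have "AE x in N. w x = 0"
    using sqnorm_zero_iff[OF w] by (simp add: L2_inner_self)
  then have "AE x in N. L2_proj N V a x = a x"
    by eventually_elim (simp add: w_def)
  then show ?thesis by (rule closed_L2_subspace_AE[OF V p(1) a])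
qed

text \<open>A linear subspace with trivial orthogonal complement is dense: its closure is a closed
  subspace, and the difference of a function and its projection onto it is orthogonal to everything.\<close>

lemma L2_dense_subspace:
  assumes D: "D \<subseteq> L2 N" "(\<lambda>_. 0) \<in> D"
      "\<And>f g. f \<in> D \<Longrightarrow> g \<in> D \<Longrightarrow> (\<lambda>x. f x + g x) \<in> D"
      "\<And>c f. f \<in> D \<Longrightarrow> (\<lambda>x. c * f x) \<in> D"
    and total: "\<And>f. f \<in> L2 N \<Longrightarrow> (\<And>g. g \<in> D \<Longrightarrow> L2_inner N f g = 0) \<Longrightarrow> AE x in N. f x = 0"
    and f: "f \<in> L2 N"
  obtains s where "\<And>k. s k \<in> D" "L2_tendsto N s f"
proof -
  define V where "V = {f. \<exists>s. (\<forall>k. s k \<in> D) \<and> L2_tendsto N s f}"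
  have const: "g \<in> V" if "g \<in> D" for g
    unfolding V_def using that D(1)
    by (auto simp: L2_tendsto_iff sqnorm_def intro!: exI[of _ "\<lambda>_. g"])
  have V: "closed_L2_subspace N V"
  proof (rule closed_L2_subspaceI)
    show "V \<subseteq> L2 N" by (auto simp: V_def L2_tendsto_def)
    show "(\<lambda>_. 0) \<in> V" by (rule const[OF D(2)])
    fix g h assume "g \<in> V" "h \<in> V"
    then obtain s t where "\<forall>k. s k \<in> D" "L2_tendsto N s g" "\<forall>k. t k \<in> D" "L2_tendsto N t h"
      by (auto simp: V_def)
    then show "(\<lambda>x. g x + h x) \<in> V"
      unfolding V_def using L2_tendsto_add D(3)
      by (intro CollectI exI[of _ "\<lambda>k x. s k x + t k x"]) auto
  next
    fix c g assume "g \<in> V"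
    then obtain s where "\<forall>k. s k \<in> D" "L2_tendsto N s g"
      by (auto simp: V_def)
    then show "(\<lambda>x. c * g x) \<in> V"
      unfolding V_def using L2_tendsto_scale D(4)
      by (intro CollectI exI[of _ "\<lambda>k x. c * s k x"]) auto
  next
    fix s g assume "\<And>k. s k \<in> V" and sg: "L2_tendsto N s g"
    then obtain t where t: "\<And>k l. t k l \<in> D" "\<And>k. L2_tendsto N (t k) (s k)"
      unfolding V_def mem_Collect_eq by metis
    have "\<exists>l. sqnorm N (\<lambda>x. t k l x - s k x) < 1 / real (Suc k)" for k
    proof -
      have "(\<lambda>l. sqnorm N (\<lambda>x. t k l x - s k x)) \<longlonglongrightarrow> 0"
        using t(2)[of k] by (simp add: L2_tendsto_iff)
      from order_tendstoD(2)[OF this, of "1 / real (Suc k)"] show ?thesis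
        by (auto simp: eventually_sequentially)
    qed
    then obtain l where l: "\<And>k. sqnorm N (\<lambda>x. t k (l k) x - s k x) < 1 / real (Suc k)"
      by metis
    have L2: "t k (l k) \<in> L2 N" "s k \<in> L2 N" "g \<in> L2 N" for k
      using t D(1) sg by (auto simp: L2_tendsto_iff)
    have "(\<lambda>k. 2 * (1 / real (Suc k)) + 2 * sqnorm N (\<lambda>x. s k x - g x)) \<longlonglongrightarrow> 2 * 0 + 2 * 0"
      using sg LIMSEQ_inverse_real_of_nat
      by (intro tendsto_add tendsto_mult_left) (simp_all only: L2_tendsto_iff inverse_eq_divide)
    then have lim: "(\<lambda>k. 2 * (1 / real (Suc k)) + 2 * sqnorm N (\<lambda>x. s k x - g x)) \<longlonglongrightarrow> 0"
      by (simp only: mult_zero_right add_0)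
    have "sqnorm N (\<lambda>x. t k (l k) x - g x)
             \<le> 2 * (1 / real (Suc k)) + 2 * sqnorm N (\<lambda>x. s k x - g x)" for k
      using sqnorm_diff_le[OF L2(1)[of k] L2(2)[of k] L2(3)] l[of k] by argo
    from sqnorm_tendsto_0[OF this lim] have "L2_tendsto N (\<lambda>k. t k (l k)) g"
      using L2 by (simp add: L2_tendsto_iff)
    then show "g \<in> V"
      unfolding V_def mem_Collect_eq by (intro exI[of _ "\<lambda>k. t k (l k)"] conjI allI t(1))
  qed
  define p where "p = L2_proj N V f"
  have p: "p \<in> V" "p \<in> L2 N"
    unfolding p_def using L2_proj(1)[OF V f] L2_proj_L2[OF V f] by auto
  have "AE x in N. f x - p x = 0"
    using L2_proj(2)[OF V f] const by (intro total L2_diff f p) (auto simp: p_def)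
  then have "AE x in N. p x = f x"
    by (rule eventually_mono) simp
  then have "f \<in> V"
    by (rule closed_L2_subspace_AE[OF V p(1) f])
  then show ?thesis
    using that by (auto simp: V_def)
qed

section \<open>Characters and the functions they annihilate\<close>

lemma cmod_chi [simp]: "cmod (chi y u) = 1"
  by (simp add: chi_def)

lemma chi_nonzero [simp]: "chi y u \<noteq> 0"
  by (simp add: chi_def cis_neq_zero)

lemma chi_commute: "chi y u = chi u y"
  by (simp add: chi_def inner_commute)

lemma chi_zero [simp]: "chi 0 u = 1" "chi y 0 = 1"
  by (simp_all add: chi_def)

lemma chi_add: "chi (y + z) u = chi y u * chi z u" "chi y (u + v) = chi y u * chi y v"
  by (simp_all add: chi_def cis_mult inner_add_left inner_add_right distrib_left)

lemma chi_minus: "chi (- y) u = cnj (chi y u)" "chi y (- u) = cnj (chi y u)"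
  by (simp_all add: chi_def cis_cnj)

lemma chi_mult_cnj [simp]: "chi y u * cnj (chi y u) = 1" "cnj (chi y u) * chi y u = 1"
  by (simp_all add: chi_def cis_cnj cis_mult)

lemma chi_diff: "chi (y - z) u = chi y u * cnj (chi z u)" "chi y (u - v) = chi y u * cnj (chi y v)"
  using chi_add(1)[of y "- z" u] chi_add(2)[of y u "- v"] by (simp_all add: chi_minus)

lemma chi_eq_1_iff: "chi y u = 1 \<longleftrightarrow> y \<bullet> u \<in> \<int>"
proof
  assume "chi y u = 1"
  then have "cos (2 * pi * (y \<bullet> u)) = 1"
    by (simp add: chi_def complex_eq_iff)
  then obtain n :: int where "2 * pi * (y \<bullet> u) = real_of_int n * 2 * pi"
    by (auto simp: cos_one_2pi_int)
  then have "y \<bullet> u = of_int n" by simp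
  then show "y \<bullet> u \<in> \<int>" by simp
qed (simp add: chi_def)

lemma chi_matrix: "chi (M *v y) u = chi y (transpose M *v u)"
  unfolding chi_def by (metis dot_lmul_matrix inner_commute transpose_matrix_vector)

lemma continuous_on_chi [continuous_intros]:
  "continuous_on S f \<Longrightarrow> continuous_on S g \<Longrightarrow> continuous_on S (\<lambda>x. chi (f x) (g x))"
  unfolding chi_def cis_conv_exp by (intro continuous_intros)

lemma borel_measurable_chi [measurable (raw)]:
  assumes "f \<in> borel_measurable M" "g \<in> borel_measurable M"
  shows "(\<lambda>x. chi (f x) (g x)) \<in> borel_measurable M"
proof -
  have "(\<lambda>t. cis (2 * pi * t)) \<in> borel_measurable borel"
    unfolding cis_conv_exp by (intro borel_measurable_continuous_onI continuous_intros)
  then show ?thesis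
    unfolding chi_def using borel_measurable_inner[OF assms] by (rule measurable_compose_rev)
qed

lemma lebesgue_measurable_of_borel [measurable (raw)]:
  "f \<in> borel_measurable borel \<Longrightarrow> f \<in> borel_measurable lebesgue"
  by (auto intro: measurable_completion)

lemma integrable_chi_mult:
  fixes h :: "real^'n::finite \<Rightarrow> complex"
  assumes "integrable lebesgue h"
  shows "integrable lebesgue (\<lambda>u. h u * chi y u)"
  by (rule Bochner_Integration.integrable_bound[OF assms])
     (use borel_measurable_integrable[OF assms] in \<open>auto simp: norm_mult\<close>)

inductive_set trig_polys :: "(real^'n::finite) set \<Rightarrow> (real^'n \<Rightarrow> complex) set" for \<Lambda> where
  trig_polys_zero: "(\<lambda>_. 0) \<in> trig_polys \<Lambda>"
| trig_polys_step: "q \<in> trig_polys \<Lambda> \<Longrightarrow> x \<in> \<Lambda> \<Longrightarrow> (\<lambda>y. q y + c * chi x y) \<in> trig_polys \<Lambda>"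

lemma trig_polys_add:
  assumes "p \<in> trig_polys \<Lambda>" "q \<in> trig_polys \<Lambda>"
  shows "(\<lambda>y. p y + q y) \<in> trig_polys \<Lambda>"
  using assms(2,1)
proof induction
  case (trig_polys_step q x c)
  then show ?case
    using trig_polys.trig_polys_step[of "\<lambda>y. p y + q y" \<Lambda> x c] by (simp add: add.assoc)
qed simp

lemma trig_polys_char: "x \<in> \<Lambda> \<Longrightarrow> (\<lambda>y. c * chi x y) \<in> trig_polys \<Lambda>"
  using trig_polys_step[OF trig_polys_zero] by simp

lemma trig_polys_mult:
  assumes add: "\<And>x y. x \<in> \<Lambda> \<Longrightarrow> y \<in> \<Lambda> \<Longrightarrow> x + y \<in> \<Lambda>"
    and "p \<in> trig_polys \<Lambda>" "q \<in> trig_polys \<Lambda>"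
  shows "(\<lambda>y. p y * q y) \<in> trig_polys \<Lambda>"
proof -
  have char: "(\<lambda>y. p y * (c * chi x y)) \<in> trig_polys \<Lambda>" if x: "x \<in> \<Lambda>" for x c
    using \<open>p \<in> trig_polys \<Lambda>\<close>
  proof induction
    case (trig_polys_step p x' c')
    then have "(\<lambda>y. p y * (c * chi x y) + (c' * c) * chi (x' + x) y) \<in> trig_polys \<Lambda>"
      using x by (intro trig_polys.trig_polys_step add)
    then show ?case by (simp add: chi_add algebra_simps)
  qed (simp add: trig_polys_zero)
  show ?thesis
    using \<open>q \<in> trig_polys \<Lambda>\<close>
  proof induction
    case (trig_polys_step q x c)
    then show ?case
      using trig_polys_add[OF trig_polys_step.IH char[of x c]] by (simp add: distrib_left)
  qed (simp add: trig_polys_zero)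
qed

lemma integral_trig_poly:
  assumes h: "integrable lebesgue h" and ann: "\<And>x. x \<in> \<Lambda> \<Longrightarrow> (\<integral>y. h y * chi x y \<partial>lebesgue) = 0"
    and "q \<in> trig_polys \<Lambda>"
  shows "integrable lebesgue (\<lambda>y. h y * q y) \<and> (\<integral>y. h y * q y \<partial>lebesgue) = 0"
  using \<open>q \<in> trig_polys \<Lambda>\<close>
proof induction
  case (trig_polys_step q x c)
  have "h y * (q y + c * chi x y) = h y * q y + c * (h y * chi x y)" for y
    by (simp add: algebra_simps)
  then show ?case
    using trig_polys_step integrable_chi_mult[OF h, of x] ann[of x] by simp
qed simp

text \<open>The map sending \<open>y\<close> to the values \<open>\<chi>\<^sub>x(y)\<close>, with \<open>x\<close> in a countable dense subset of \<open>\<Lambda>\<close>, goes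
  into a compact metrizable torus, on which the coordinates and their conjugates generate an
  algebra that separates points. So by Stone--Weierstrass the hypothesis \<open>\<integral> h \<chi>\<^sub>x = 0\<close> extends to
  all continuous functions on the torus, and by approximation to the indicator of the image of a
  compact set, whose preimage consists of the points not separated from that set by characters.\<close>

lemma annihilated_by_characters_compact:
  fixes h :: "real^'n::finite \<Rightarrow> complex"
  assumes \<Lambda>: "0 \<in> \<Lambda>" "\<And>x y. x \<in> \<Lambda> \<Longrightarrow> y \<in> \<Lambda> \<Longrightarrow> x + y \<in> \<Lambda>" "\<And>x. x \<in> \<Lambda> \<Longrightarrow> - x \<in> \<Lambda>"
    and h: "integrable lebesgue h"
    and ann: "\<And>x. x \<in> \<Lambda> \<Longrightarrow> (\<integral>y. h y * chi x y \<partial>lebesgue) = 0"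
    and C: "compact C"
  shows "(\<integral>y. h y * indicator {y. \<exists>c\<in>C. \<forall>x\<in>\<Lambda>. x \<bullet> (y - c) \<in> \<int>} y \<partial>lebesgue) = 0"
proof (cases "C = {}")
  case False
  have [measurable]: "h \<in> borel_measurable lebesgue"
    using h by (rule borel_measurable_integrable)
  obtain D where D: "countable D" "D \<subseteq> \<Lambda>" "\<Lambda> \<subseteq> closure D"
    by (rule separable)
  then have "D \<noteq> {}" using \<Lambda>(1) by auto
  define e where "e = from_nat_into D"
  have e: "range e = D" unfolding e_def by (rule range_from_nat_into[OF \<open>D \<noteq> {}\<close> D(1)])
  define \<Theta> :: "real^'n \<Rightarrow> nat \<Rightarrow> complex" where "\<Theta> y = (\<lambda>k. chi (e k) y)" for y
  define T :: "(nat \<Rightarrow> complex) set" where "T = (\<Pi>\<^sub>E k\<in>UNIV. sphere 0 1)"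
  have \<Theta>T: "\<Theta> y \<in> T" for y by (auto simp: \<Theta>_def T_def)
  have cont_\<Theta>: "continuous_on UNIV \<Theta>"
    unfolding \<Theta>_def by (intro continuous_on_coordinatewise_then_product continuous_intros)
  have "compactin (product_topology (\<lambda>_. euclidean) UNIV) T"
    unfolding T_def by (subst compactin_PiE) auto
  then have T: "compact T" by (simp add: euclidean_product_topology)
  define \<A> where "\<A> = {p :: (nat \<Rightarrow> complex) \<Rightarrow> real.
      continuous_on T p \<and> (\<lambda>y. of_real (p (\<Theta> y))) \<in> trig_polys \<Lambda>}"
  \<comment> \<open>real and imaginary part are trigonometric polynomials because \<open>\<Lambda>\<close> is closed under negation\<close>
  have ReIm: "(\<lambda>t. Re (t k)) \<in> \<A>" "(\<lambda>t. Im (t k)) \<in> \<A>" for k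
  proof -
    have ek: "e k \<in> \<Lambda>" using e D(2) by auto
    have cont: "continuous_on T (\<lambda>t. t k)"
      by (rule continuous_on_subset[OF continuous_on_product_coordinates]) simp
    have "(\<lambda>y. (1/2) * chi (e k) y + (1/2) * chi (- e k) y) \<in> trig_polys \<Lambda>"
         "(\<lambda>y. (1/(2*\<i>)) * chi (e k) y + (- 1/(2*\<i>)) * chi (- e k) y) \<in> trig_polys \<Lambda>"
      by (intro trig_polys_add trig_polys_char ek \<Lambda>(3))+
    moreover have "(1/2) * chi (e k) y + (1/2) * chi (- e k) y = of_real (Re (\<Theta> y k))"
         "(1/(2*\<i>)) * chi (e k) y + (- 1/(2*\<i>)) * chi (- e k) y = of_real (Im (\<Theta> y k))" for y
      by (simp_all add: \<Theta>_def chi_minus complex_eq_iff)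
    ultimately show "(\<lambda>t. Re (t k)) \<in> \<A>" "(\<lambda>t. Im (t k)) \<in> \<A>"
      unfolding \<A>_def using continuous_on_Re[OF cont] continuous_on_Im[OF cont] by simp_all
  qed
  interpret function_ring_on \<A> T
  proof
    show "compact T" by (rule T)
    show "continuous_on T f" if "f \<in> \<A>" for f using that by (simp add: \<A>_def)
    show "(\<lambda>x. f x + g x) \<in> \<A>" if "f \<in> \<A>" "g \<in> \<A>" for f g
      using that trig_polys_add[of "\<lambda>y. of_real (f (\<Theta> y))" \<Lambda> "\<lambda>y. of_real (g (\<Theta> y))"]
      by (simp add: \<A>_def continuous_on_add)
    show "(\<lambda>x. f x * g x) \<in> \<A>" if "f \<in> \<A>" "g \<in> \<A>" for f g
      using that trig_polys_mult[OF \<Lambda>(2), of "\<lambda>y. of_real (f (\<Theta> y))" "\<lambda>y. of_real (g (\<Theta> y))"]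
      by (simp add: \<A>_def continuous_on_mult)
    show "(\<lambda>_. c) \<in> \<A>" for c
      using trig_polys_char[OF \<Lambda>(1), of "of_real c"] by (simp add: \<A>_def)
    fix s t assume "s \<in> T" "t \<in> T" "s \<noteq> t"
    then obtain k where "s k \<noteq> t k" by (auto simp: fun_eq_iff)
    then have "Re (s k) \<noteq> Re (t k) \<or> Im (s k) \<noteq> Im (t k)" by (simp add: complex_eq_iff)
    then show "\<exists>f\<in>\<A>. f s \<noteq> f t"
      by (elim disjE) (rule bexI[OF _ ReIm(1)[of k]] bexI[OF _ ReIm(2)[of k]], assumption)+
  qed
  have comp_meas [measurable]: "(\<lambda>y. of_real (f (\<Theta> y)) :: complex) \<in> borel_measurable lebesgue"
    if "continuous_on UNIV f" for f :: "(nat \<Rightarrow> complex) \<Rightarrow> real"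
  proof -
    have "continuous_on UNIV (\<lambda>y. of_real (f (\<Theta> y)) :: complex)"
      by (intro continuous_intros continuous_on_compose2[OF that cont_\<Theta>]) simp
    then show ?thesis
      by (intro lebesgue_measurable_of_borel borel_measurable_continuous_onI)
  qed
  have continuous_zero: "(\<integral>y. h y * of_real (f (\<Theta> y)) \<partial>lebesgue) = 0"
    if f: "continuous_on UNIV f" for f :: "(nat \<Rightarrow> complex) \<Rightarrow> real"
  proof -
    have fT: "continuous_on T f" by (rule continuous_on_subset[OF f]) simp
    have bound: "cmod (\<integral>y. h y * of_real (f (\<Theta> y)) \<partial>lebesgue) \<le> \<epsilon> * (\<integral>y. cmod (h y) \<partial>lebesgue)"
      if \<epsilon>: "\<epsilon> > 0" for \<epsilon>
    proof -
      obtain g where g: "g \<in> \<A>" "\<And>t. t \<in> T \<Longrightarrow> \<bar>f t - g t\<bar> < \<epsilon>"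
        using Stone_Weierstrass_basic[OF fT \<epsilon>] by blast
      have gi: "integrable lebesgue (\<lambda>y. h y * of_real (g (\<Theta> y)))"
        and g0: "(\<integral>y. h y * of_real (g (\<Theta> y)) \<partial>lebesgue) = 0"
        using integral_trig_poly[OF h ann, of \<Lambda>] g(1) by (auto simp: \<A>_def)
      have le: "cmod (h y * of_real (f (\<Theta> y)) - h y * of_real (g (\<Theta> y))) \<le> \<epsilon> * cmod (h y)" for y
      proof -
        have "cmod (h y * of_real (f (\<Theta> y)) - h y * of_real (g (\<Theta> y))) = cmod (h y) * \<bar>f (\<Theta> y) - g (\<Theta> y)\<bar>"
          by (simp only: right_diff_distrib[symmetric] of_real_diff[symmetric] norm_mult norm_of_real)
        then show ?thesis
          using mult_right_mono[OF less_imp_le[OF g(2)[OF \<Theta>T, of y]], of "cmod (h y)"]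
          by (simp add: mult.commute)
      qed
      have di: "integrable lebesgue (\<lambda>y. h y * of_real (f (\<Theta> y)) - h y * of_real (g (\<Theta> y)))"
        by (rule Bochner_Integration.integrable_bound[of _ "\<lambda>y. \<epsilon> * cmod (h y)"])
           (use h f gi le \<epsilon> in \<open>auto intro!: comp_meas borel_measurable_diff borel_measurable_times dest: borel_measurable_integrable\<close>)
      have fi: "integrable lebesgue (\<lambda>y. h y * of_real (f (\<Theta> y)))"
        using Bochner_Integration.integrable_add[OF di gi] by simp
      have "(\<integral>y. h y * of_real (f (\<Theta> y)) \<partial>lebesgue)
          = (\<integral>y. h y * of_real (f (\<Theta> y)) - h y * of_real (g (\<Theta> y)) \<partial>lebesgue)"
        using fi gi g0 by simp
      also have "cmod \<dots> \<le> (\<integral>y. \<epsilon> * cmod (h y) \<partial>lebesgue)"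
        by (rule Bochner_Integration.integral_norm_bound_integral[OF di]) (use h le in auto)
      finally show ?thesis by simp
    qed
    have "((\<lambda>\<epsilon>. \<epsilon> * (\<integral>y. cmod (h y) \<partial>lebesgue)) \<longlongrightarrow> 0 * (\<integral>y. cmod (h y) \<partial>lebesgue)) (at_right 0)"
      by (intro tendsto_intros)
    then have "cmod (\<integral>y. h y * of_real (f (\<Theta> y)) \<partial>lebesgue) \<le> 0 * (\<integral>y. cmod (h y) \<partial>lebesgue)"
      by (rule tendsto_lowerbound)
         (use bound in \<open>auto simp: eventually_at_right_field intro!: exI[of _ 1]\<close>)
    then show ?thesis by simp
  qed
  define K where "K = \<Theta> ` C"
  have K: "closed K" "K \<noteq> {}"
    using compact_continuous_image[OF continuous_on_subset[OF cont_\<Theta>] C] False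
    by (auto simp: K_def compact_imp_closed)
  \<comment> \<open>continuous functions decreasing to the indicator of \<open>K\<close>\<close>
  define f where "f j t = max 0 (1 - real j * infdist t K)" for j t
  have f_cont: "continuous_on UNIV (f j)" for j
    unfolding f_def by (intro continuous_intros)
  have f_lim: "(\<lambda>j. f j t) \<longlonglongrightarrow> indicator K t" for t
  proof (cases "t \<in> K")
    case False
    then have pos: "infdist t K > 0" using K by (meson infdist_pos_not_in_closed)
    obtain J where J: "real J * infdist t K > 1"
      using reals_Archimedean3[OF pos] by blast
    have "f j t = 0" if "j \<ge> J" for j
    proof -
      have "real J * infdist t K \<le> real j * infdist t K"
        using that pos by (intro mult_right_mono) auto
      then show ?thesis using J by (simp add: f_def)
    qed
    then have "\<forall>\<^sub>F j in sequentially. f j t = 0" by (auto simp: eventually_sequentially)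
    then show ?thesis using False by (simp add: tendsto_eventually)
  qed (simp add: f_def)
  have f_le: "\<bar>f j t\<bar> \<le> 1" for j t by (simp add: f_def infdist_nonneg)
  have "(\<lambda>j. \<integral>y. h y * of_real (f j (\<Theta> y)) \<partial>lebesgue) \<longlonglongrightarrow> (\<integral>y. h y * of_real (indicator K (\<Theta> y)) \<partial>lebesgue)"
  proof (rule integral_dominated_convergence[where w = "\<lambda>y. cmod (h y)"])
    show lim: "AE y in lebesgue. (\<lambda>j. h y * of_real (f j (\<Theta> y))) \<longlonglongrightarrow> h y * of_real (indicator K (\<Theta> y))"
      by (intro AE_I2 tendsto_mult_left tendsto_of_real f_lim)
    show meas: "(\<lambda>y. h y * of_real (f j (\<Theta> y))) \<in> borel_measurable lebesgue" for j
      using comp_meas[OF f_cont] by measurable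
    show "(\<lambda>y. h y * of_real (indicator K (\<Theta> y))) \<in> borel_measurable lebesgue"
      by (rule borel_measurable_LIMSEQ_metric[where f = "\<lambda>j y. h y * of_real (f j (\<Theta> y))"])
         (rule meas, intro tendsto_mult_left tendsto_of_real f_lim)
    show "AE y in lebesgue. cmod (h y * of_real (f j (\<Theta> y))) \<le> cmod (h y)" for j
      using f_le by (auto simp: norm_mult intro!: mult_left_le)
  qed (use h in simp)
  then have "(\<integral>y. h y * of_real (indicator K (\<Theta> y)) \<partial>lebesgue) = 0"
    using continuous_zero[OF f_cont] by (simp add: LIMSEQ_const_iff)
  moreover have "\<Theta> y = \<Theta> c \<longleftrightarrow> (\<forall>x\<in>\<Lambda>. x \<bullet> (y - c) \<in> \<int>)" for y c
  proof -
    have "\<Theta> y = \<Theta> c \<longleftrightarrow> (\<forall>x\<in>D. chi x (y - c) = 1)"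
      unfolding \<Theta>_def fun_eq_iff e[symmetric] ball_simps
      by (simp add: chi_diff) (metis chi_mult_cnj mult.assoc mult.right_neutral mult.left_neutral)
    also have "\<dots> \<longleftrightarrow> (\<forall>x\<in>\<Lambda>. chi x (y - c) = 1)"
    proof
      assume *: "\<forall>x\<in>D. chi x (y - c) = 1"
      have "closed {x. chi x (y - c) = 1}"
        by (intro closed_Collect_eq continuous_intros)
      then have "closure D \<subseteq> {x. chi x (y - c) = 1}"
        using * by (intro closure_minimal) auto
      then show "\<forall>x\<in>\<Lambda>. chi x (y - c) = 1" using D(3) by blast
    qed (use D(2) in blast)
    finally show ?thesis by (simp add: chi_eq_1_iff)
  qed
  then have "indicator {y. \<exists>c\<in>C. \<forall>x\<in>\<Lambda>. x \<bullet> (y - c) \<in> \<int>} y = (of_real (indicator K (\<Theta> y)) :: complex)" for y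
    by (auto simp: indicator_def K_def image_iff)
  ultimately show ?thesis by simp
qed simp

lemma lebesgue_measurable_translates:
  fixes E :: "(real^'n::finite) set"
  assumes "countable A" "E \<in> sets lebesgue"
  shows "(\<Union>z\<in>A. (+) z ` E) \<in> sets lebesgue"
  using lebesgue_sets_translation[OF assms(2)] by (intro sets.countable_UN'[OF assms(1)]) auto

text \<open>A measurable set is a countable union of compact sets up to a null set, and countably many
  translates of a null set form a null set. So the case of compact sets suffices.\<close>

lemma annihilated_by_characters:
  fixes h :: "real^'n::finite \<Rightarrow> complex"
  assumes \<Lambda>: "0 \<in> \<Lambda>" "\<And>x y. x \<in> \<Lambda> \<Longrightarrow> y \<in> \<Lambda> \<Longrightarrow> x + y \<in> \<Lambda>" "\<And>x. x \<in> \<Lambda> \<Longrightarrow> - x \<in> \<Lambda>"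
    and h: "integrable lebesgue h"
    and ann: "\<And>x. x \<in> \<Lambda> \<Longrightarrow> (\<integral>y. h y * chi x y \<partial>lebesgue) = 0"
    and A: "A = {z. \<forall>x\<in>\<Lambda>. x \<bullet> z \<in> \<int>}" "countable A"
    and E: "E \<in> sets lebesgue"
  shows "(\<integral>y. h y * indicator (\<Union>z\<in>A. (+) z ` E) y \<partial>lebesgue) = 0"
proof -
  have [measurable]: "h \<in> borel_measurable lebesgue"
    using h by (rule borel_measurable_integrable)
  obtain B T where B: "fsigma B" and T: "T \<in> null_sets lebesgue" and BT: "B \<union> T = E"
    using lebesgue_set_almost_fsigma[OF E] by metis
  obtain F :: "nat \<Rightarrow> (real^'n) set" where "range F \<subseteq> Collect compact" "B = (\<Union>i. F i)"
    using B fsigma_Union_compact by metis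
  then have F: "\<And>i. compact (F i)" "B = (\<Union>i. F i)" by auto
  define S where "S X = (\<Union>z\<in>A. (+) z ` X)" for X :: "(real^'n) set"
  have S_sets [measurable]: "S X \<in> sets lebesgue" if "X \<in> sets lebesgue" for X
    unfolding S_def by (rule lebesgue_measurable_translates[OF A(2) that])
  have S_eq: "S X = {y. \<exists>c\<in>X. \<forall>x\<in>\<Lambda>. x \<bullet> (y - c) \<in> \<int>}" for X
  proof (intro equalityI subsetI)
    fix y assume "y \<in> {y. \<exists>c\<in>X. \<forall>x\<in>\<Lambda>. x \<bullet> (y - c) \<in> \<int>}"
    then obtain c where "c \<in> X" "y - c \<in> A" by (auto simp: A(1))
    moreover have "y = (y - c) + c" by simp
    ultimately show "y \<in> S X" unfolding S_def by blast
  next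
    fix y assume "y \<in> S X"
    then obtain z c where "z \<in> A" "c \<in> X" "y = z + c" by (auto simp: S_def)
    then have "\<forall>x\<in>\<Lambda>. x \<bullet> (y - c) \<in> \<int>" by (simp add: A(1))
    then show "y \<in> {y. \<exists>c\<in>X. \<forall>x\<in>\<Lambda>. x \<bullet> (y - c) \<in> \<int>}"
      using \<open>c \<in> X\<close> by blast
  qed
  define G where "G j = (\<Union>i\<le>j. F i)" for j
  have G: "compact (G j)" for j unfolding G_def using F(1) by auto
  then have G_sets: "G j \<in> sets lebesgue" for j by (simp add: lmeasurable_compact fmeasurableD)
  have B_sets: "B \<in> sets lebesgue"
    unfolding F(2) using F(1) by (intro sets.countable_UN) (auto simp: lmeasurable_compact fmeasurableD)
  have "(\<lambda>j. \<integral>y. h y * indicator (S (G j)) y \<partial>lebesgue) \<longlonglongrightarrow> (\<integral>y. h y * indicator (S B) y \<partial>lebesgue)"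
  proof (rule integral_dominated_convergence[where w = "\<lambda>y. cmod (h y)"])
    show "AE y in lebesgue. (\<lambda>j. h y * indicator (S (G j)) y) \<longlonglongrightarrow> h y * indicator (S B) y"
    proof (intro AE_I2 tendsto_intros)
      fix y
      have "incseq (\<lambda>j. S (G j))"
        unfolding S_def G_def by (intro monoI) (fastforce intro: order_trans)
      from LIMSEQ_indicator_incseq[OF this, of y]
      show "(\<lambda>j. indicator (S (G j)) y) \<longlonglongrightarrow> (indicator (S B) y :: complex)"
        by (rule back_subst[of "\<lambda>X. (\<lambda>j. indicator (S (G j)) y) \<longlonglongrightarrow> (indicator X y :: complex)"])
           (auto simp: S_def F(2) G_def)
    qed
    show "AE y in lebesgue. cmod (h y * indicator (S (G j)) y) \<le> cmod (h y)" for j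
      by (auto simp: indicator_def)
  qed (use h G_sets B_sets in \<open>auto intro!: borel_measurable_times borel_measurable_indicator S_sets\<close>)
  moreover have "(\<integral>y. h y * indicator (S (G j)) y \<partial>lebesgue) = 0" for j
    unfolding S_eq by (rule annihilated_by_characters_compact[OF \<Lambda> h ann G])
  ultimately have 0: "(\<integral>y. h y * indicator (S B) y \<partial>lebesgue) = 0"
    by (simp add: LIMSEQ_const_iff)
  have "S T \<in> null_sets lebesgue"
    unfolding S_def
  proof (rule null_sets_UN'[OF A(2)])
    show "(+) z ` T \<in> null_sets lebesgue" for z
      using T negligible_translation[of T z] by (simp add: negligible_iff_null_sets)
  qed
  then have "AE y in lebesgue. y \<notin> S T" by (rule AE_not_in)
  then have "(\<integral>y. h y * indicator (S E) y \<partial>lebesgue) = (\<integral>y. h y * indicator (S B) y \<partial>lebesgue)"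
  proof (intro integral_cong_AE)
    show "AE y in lebesgue. h y * indicator (S E) y = h y * indicator (S B) y"
      using \<open>AE y in lebesgue. y \<notin> S T\<close>
      by eventually_elim (auto simp: indicator_def S_def BT[symmetric])
  qed (use E B_sets in \<open>auto intro!: borel_measurable_times borel_measurable_indicator S_sets\<close>)
  with 0 show ?thesis by (simp add: S_def)
qed

lemma sigma_finite_lebesgue: "sigma_finite_measure (lebesgue :: 'a::euclidean_space measure)"
proof
  let ?A = "range (\<lambda>i::nat. cball (0::'a) (real i))"
  have "x \<in> \<Union>?A" for x :: 'a
    using real_arch_simple[of "norm x"] by auto
  moreover have "emeasure lebesgue (cball (0::'a) r) \<noteq> \<infinity>" for r
    using fmeasurableD2[OF lmeasurable_cball] by simp
  ultimately show "\<exists>A. countable A \<and> A \<subseteq> sets lebesgue \<and> \<Union>A = space lebesgue \<and>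
      (\<forall>a\<in>A. emeasure (lebesgue :: 'a measure) a \<noteq> \<infinity>)"
    by (intro exI[of _ ?A]) auto
qed

text \<open>For \<open>\<Lambda> = \<real>\<^sup>n\<close> no nonzero point is dual to \<open>\<Lambda>\<close>: a function with vanishing Fourier transform
  vanishes.\<close>

corollary fourier_injective:
  fixes h :: "real^'n::finite \<Rightarrow> complex"
  assumes h: "integrable lebesgue h" and 0: "\<And>y. fourier h y = 0"
  shows "AE u in lebesgue. h u = 0"
proof -
  have A: "{0 :: real^'n} = {z. \<forall>x\<in>UNIV. x \<bullet> z \<in> \<int>}"
  proof (intro equalityI subsetI)
    fix z :: "real^'n" assume "z \<in> {z. \<forall>x\<in>UNIV. x \<bullet> z \<in> \<int>}"
    then have *: "x \<bullet> z \<in> \<int>" for x by simp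
    have "z = 0"
    proof (rule ccontr)
      assume "z \<noteq> 0"
      then have "((1 / (2 * (z \<bullet> z))) *\<^sub>R z) \<bullet> z = 1/2" by simp
      then have "(1/2 :: real) \<in> \<int>" using * by metis
      then obtain n :: int where "(1/2 :: real) = of_int n" by (auto elim: Ints_cases)
      then have "2 * n = 1" by linarith
      then show False by presburger
    qed
    then show "z \<in> {0}" by simp
  qed simp
  have "(\<integral>y. h y * indicator (\<Union>z\<in>{0}. (+) z ` E) y \<partial>lebesgue) = 0" if "E \<in> sets lebesgue" for E
    by (rule annihilated_by_characters[OF _ _ _ h _ A _ that])
       (use 0 in \<open>auto simp: fourier_def\<close>)
  then show ?thesis
    by (intro sigma_finite_measure.density_zero[OF sigma_finite_lebesgue h])
       (simp add: set_lebesgue_integral_def scaleR_conv_of_real mult.commute of_real_indicator)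
qed

section \<open>Invariance of Lebesgue measure under isometries\<close>

lemma orthogonal_matrix_inv:
  fixes M :: "real^'n::finite^'n"
  assumes "orthogonal_matrix M"
  shows "matrix_inv M = transpose M"
proof -
  have "M ** transpose M = mat 1 \<and> transpose M ** M = mat 1"
    using assms by (simp add: orthogonal_matrix_def)
  then have "M ** matrix_inv M = mat 1"
    unfolding matrix_inv_def by (rule someI2) simp
  then have "(transpose M ** M) ** matrix_inv M = transpose M"
    by (simp add: matrix_mul_assoc[symmetric])
  then show ?thesis
    using assms by (simp add: orthogonal_matrix_def)
qed

lemma orthogonal_matrix_cancel:
  fixes M :: "real^'n::finite^'n"
  assumes "orthogonal_matrix M"
  shows "M *v (transpose M *v u) = u" "transpose M *v (M *v u) = u"
  using assms
  by (simp_all only: matrix_vector_mul_assoc orthogonal_matrix_def orthogonal_matrix matrix_vector_mul_lid)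

lemma orthogonal_matrix_inner:
  fixes M :: "real^'n::finite^'n"
  assumes "orthogonal_matrix M"
  shows "(M *v u) \<bullet> v = u \<bullet> (transpose M *v v)"
  by (metis dot_lmul_matrix inner_commute transpose_matrix_vector)

lemma orthogonal_matrix_norm:
  fixes M :: "real^'n::finite^'n"
  assumes "orthogonal_matrix M"
  shows "norm (M *v u) = norm u"
  unfolding norm_eq_sqrt_inner
  by (simp only: orthogonal_matrix_inner[OF assms] orthogonal_matrix_cancel[OF assms])

lemma borel_measurable_matrix_vector [measurable]:
  "(\<lambda>u. (M :: real^'n::finite^'n) *v u) \<in> borel_measurable borel"
  by (intro borel_measurable_continuous_onI) (rule matrix_vector_mult_linear_continuous_on)

lemma nn_integral_lborel_translation:
  fixes f :: "'a::euclidean_space \<Rightarrow> ennreal"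
  assumes [measurable]: "f \<in> borel_measurable borel"
  shows "(\<integral>\<^sup>+u. f (a + u) \<partial>lborel) = (\<integral>\<^sup>+u. f u \<partial>lborel)"
  by (subst (2) lborel_distr_plus[of a, symmetric]) (simp add: nn_integral_distr)

text \<open>Uniqueness of Haar measure: for a translation invariant measure \<open>\<nu>\<close>, Fubini's theorem gives
  \<open>\<nu>(B) \<lambda>(A) = \<lambda>(B) \<nu>(A)\<close> with \<open>B\<close> the unit ball, whose symmetry replaces the reflection of one
  of the two variables. The image of Lebesgue measure under an orthogonal map is such a \<open>\<nu>\<close>, and it
  gives \<open>B\<close> the measure \<open>\<lambda>(B)\<close>.\<close>

lemma lborel_distr_orthogonal:
  fixes M :: "real^'n::finite^'n"
  assumes M: "orthogonal_matrix M"
  shows "distr lborel borel (\<lambda>u. M *v u) = lborel"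
proof -
  define \<nu> where "\<nu> = distr lborel borel (\<lambda>u. M *v u)"
  have sets [simp, measurable_cong]: "sets \<nu> = sets borel" and [simp]: "space \<nu> = UNIV"
    by (simp_all add: \<nu>_def)
  have inj: "inj (\<lambda>u. M *v u)"
    by (rule inj_on_inverseI[of _ "\<lambda>u. transpose M *v u"]) (rule orthogonal_matrix_cancel(2)[OF M])
  define B where "B = ball (0 :: real^'n) 1"
  have [measurable]: "B \<in> sets borel" by (simp add: B_def)
  have "(\<lambda>u. M *v u) -` ball 0 r = ball 0 r" for r
    using orthogonal_matrix_norm[OF M] by auto
  then have \<nu>_ball: "emeasure \<nu> (ball 0 r) = emeasure lborel (ball (0 :: real^'n) r)" for r
    by (simp add: \<nu>_def emeasure_distr)
  interpret \<nu>: sigma_finite_measure \<nu>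
  proof
    let ?A = "range (\<lambda>i::nat. ball (0::real^'n) (real i))"
    have "x \<in> \<Union>?A" for x :: "real^'n"
      using reals_Archimedean2[of "norm x"] by auto
    then show "\<exists>A. countable A \<and> A \<subseteq> sets \<nu> \<and> \<Union>A = space \<nu> \<and> (\<forall>a\<in>A. emeasure \<nu> a \<noteq> \<infinity>)"
      using emeasure_lborel_ball_finite
      by (intro exI[of _ ?A]) (auto simp: \<nu>_ball less_top[symmetric] intro: less_imp_neq)
  qed
  interpret pair_sigma_finite lborel \<nu> ..
  have shift: "(\<integral>\<^sup>+u. f (a + u) \<partial>\<nu>) = (\<integral>\<^sup>+u. f u \<partial>\<nu>)" if [measurable]: "f \<in> borel_measurable borel" for f a
  proof -
    have "(\<integral>\<^sup>+u. f (a + u) \<partial>\<nu>) = (\<integral>\<^sup>+u. f (M *v (transpose M *v a + u)) \<partial>lborel)"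
      by (simp add: \<nu>_def nn_integral_distr matrix_vector_right_distrib orthogonal_matrix_cancel[OF M] del: transpose_matrix_vector)
    also have "\<dots> = (\<integral>\<^sup>+u. f (M *v u) \<partial>lborel)"
      by (rule nn_integral_lborel_translation[of "\<lambda>u. f (M *v u)"]) simp
    finally show ?thesis by (simp add: \<nu>_def nn_integral_distr)
  qed
  have eq: "emeasure lborel B * emeasure \<nu> A = emeasure \<nu> B * emeasure lborel A"
    if [measurable]: "A \<in> sets borel" for A
  proof -
    have "emeasure \<nu> B * emeasure lborel A = (\<integral>\<^sup>+x. indicator B x * (\<integral>\<^sup>+y. indicator A y \<partial>lborel) \<partial>\<nu>)"
      by (subst nn_integral_multc) auto
    also have "\<dots> = (\<integral>\<^sup>+x. (\<integral>\<^sup>+y. indicator B x * indicator A (x + y) \<partial>lborel) \<partial>\<nu>)"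
      by (subst nn_integral_cmult) (auto simp del: nn_integral_indicator simp: nn_integral_lborel_translation)
    also have "\<dots> = (\<integral>\<^sup>+y. (\<integral>\<^sup>+x. indicator B x * indicator A (x + y) \<partial>\<nu>) \<partial>lborel)"
      by (rule Fubini') simp
    also have "\<dots> = (\<integral>\<^sup>+y. (\<integral>\<^sup>+x. indicator B (x - y) * indicator A x \<partial>\<nu>) \<partial>lborel)"
    proof (rule nn_integral_cong)
      show "(\<integral>\<^sup>+x. indicator B x * indicator A (x + y) \<partial>\<nu>) = (\<integral>\<^sup>+x. indicator B (x - y) * indicator A x \<partial>\<nu>)" for y
        using shift[of "\<lambda>x. indicator B (x - y) * indicator A x" y] by (simp add: add.commute)
    qed
    also have "\<dots> = (\<integral>\<^sup>+x. (\<integral>\<^sup>+y. indicator B (x - y) * indicator A x \<partial>lborel) \<partial>\<nu>)"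
      by (rule Fubini'[symmetric]) simp
    also have "\<dots> = (\<integral>\<^sup>+x. (\<integral>\<^sup>+y. indicator B (- x + y) \<partial>lborel) * indicator A x \<partial>\<nu>)"
      by (subst nn_integral_multc[symmetric])
         (auto simp: B_def norm_minus_commute indicator_def intro!: nn_integral_cong)
    also have "\<dots> = (\<integral>\<^sup>+x. emeasure lborel B * indicator A x \<partial>\<nu>)"
    proof -
      have "(\<integral>\<^sup>+y. indicator B (- x + y) \<partial>lborel) = emeasure lborel B" for x
        by (rule trans[OF nn_integral_lborel_translation]) simp_all
      then show ?thesis by (simp only:)
    qed
    also have "\<dots> = emeasure lborel B * emeasure \<nu> A"
      by (subst nn_integral_cmult) auto
    finally show ?thesis by simp
  qed
  have B: "emeasure lborel B \<noteq> \<infinity>" "emeasure lborel B \<noteq> 0"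
    using emeasure_lborel_ball_finite[of "0::real^'n" 1] content_ball_pos[of 1 "0::real^'n"]
    by (auto simp: B_def measure_def)
  have "emeasure lborel A = emeasure \<nu> A" if "A \<in> sets borel" for A
    using eq[OF that] B \<nu>_ball[of 1] unfolding B_def[symmetric]
    by (simp add: ennreal_mult_cancel_left)
  then show ?thesis
    unfolding \<nu>_def[symmetric] by (intro measure_eqI) auto
qed

lemma
  fixes M :: "real^'n::finite^'n"
  assumes M: "orthogonal_matrix M"
  shows lebesgue_measurable_isometry: "(\<lambda>u. M *v (u + x)) \<in> lebesgue \<rightarrow>\<^sub>M lebesgue"
    and lebesgue_distr_isometry: "distr lebesgue lebesgue (\<lambda>u. M *v (u + x)) = lebesgue"
proof -
  let ?T = "\<lambda>u. M *v (u + x)"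
  have T: "?T \<in> lebesgue \<rightarrow>\<^sub>M lborel"
    by (intro measurable_completion) simp
  have "distr lebesgue lborel ?T = distr lborel borel ?T"
    by (subst distr_completion) (auto intro: distr_cong)
  also have "\<dots> = distr (distr lborel borel ((+) x)) borel (\<lambda>u. M *v u)"
    by (subst distr_distr) (auto simp: comp_def add.commute)
  also have "\<dots> = lborel"
    by (simp add: lborel_distr_plus lborel_distr_orthogonal[OF M])
  finally have D: "distr lebesgue lborel ?T = lborel" .
  show "?T \<in> lebesgue \<rightarrow>\<^sub>M lebesgue"
    by (rule completion.measurable_completion2[OF T]) (simp add: D)
  show "distr lebesgue lebesgue ?T = lebesgue"
    using completion.completion_distr_eq[OF T] by (simp add: D)
qed

lemma lebesgue_integral_isometry:
  fixes f :: "real^'n::finite \<Rightarrow> 'b::{banach, second_countable_topology}"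
  assumes "orthogonal_matrix M" "f \<in> borel_measurable lebesgue"
  shows "(\<integral>u. f (M *v (u + x)) \<partial>lebesgue) = (\<integral>u. f u \<partial>lebesgue)"
  using integral_distr[OF lebesgue_measurable_isometry[OF assms(1), of x] assms(2)]
  by (simp add: lebesgue_distr_isometry[OF assms(1)])

lemma lebesgue_integral_translation:
  fixes f :: "real^'n::finite \<Rightarrow> complex"
  assumes "f \<in> borel_measurable lebesgue"
  shows "(\<integral>u. f (u + x) \<partial>lebesgue) = (\<integral>u. f u \<partial>lebesgue)"
  using lebesgue_integral_isometry[OF _ assms, of "mat 1" x] by (simp add: orthogonal_matrix_id)

lemma L2_isometry:
  fixes f :: "real^'n::finite \<Rightarrow> complex"
  assumes "orthogonal_matrix M" "f \<in> L2 lebesgue"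
  shows "(\<lambda>u. f (M *v (u + x))) \<in> L2 lebesgue"
proof (rule L2I)
  note T = lebesgue_measurable_isometry[OF assms(1), of x]
  show "(\<lambda>u. f (M *v (u + x))) \<in> borel_measurable lebesgue"
    by (rule measurable_compose[OF T L2_measurable[OF assms(2)]])
  show "integrable lebesgue (\<lambda>u. (cmod (f (M *v (u + x))))\<^sup>2)"
    using integrable_distr[OF T, of "\<lambda>u. (cmod (f u))\<^sup>2"] L2_integrable[OF assms(2)]
    by (simp add: lebesgue_distr_isometry[OF assms(1)])
qed

lemma AE_lebesgue_isometry:
  fixes M :: "real^'n::finite^'n"
  assumes "orthogonal_matrix M" "AE u in lebesgue. P u"
  shows "AE u in lebesgue. P (M *v (u + x))"
proof -
  have "AE u in distr lebesgue lebesgue (\<lambda>u. M *v (u + x)). P u"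
    unfolding lebesgue_distr_isometry[OF assms(1)] by (rule assms(2))
  then show ?thesis
    by (rule AE_distrD[OF lebesgue_measurable_isometry[OF assms(1)]])
qed

section \<open>The Fourier transform of Gaussians\<close>

text \<open>The characteristic function of the standard normal distribution, rescaled by \<open>sqrt (2 * pi)\<close>.\<close>

lemma gaussian_fourier_real:
  "(\<integral>x. exp (of_real (- pi * x\<^sup>2) + \<i> * of_real (2 * pi * (y * x))) \<partial>lborel)
     = complex_of_real (exp (- pi * y\<^sup>2))"
proof -
  define c where "c = sqrt (2 * pi)"
  have c: "c > 0" "c\<^sup>2 = 2 * pi" by (simp_all add: c_def)
  have "complex_of_real (exp (- pi * y\<^sup>2)) = char std_normal_distribution (c * y)"
    by (simp add: char_std_normal_distribution power_mult_distrib c)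
  also have "\<dots> = (\<integral>x. std_normal_density x *\<^sub>R iexp (c * y * x) \<partial>lborel)"
    unfolding char_def by (subst integral_density) (auto simp: normal_density_nonneg)
  also have "\<dots> = (\<integral>x. c *\<^sub>R (std_normal_density (c * x) *\<^sub>R iexp (c * y * (c * x))) \<partial>lborel)"
    using c by (subst lborel_integral_real_affine[where c = c and t = 0]) (auto simp del: scaleR_scaleR)
  also have "\<dots> = (\<integral>x. exp (of_real (- pi * x\<^sup>2) + \<i> * of_real (2 * pi * (y * x))) \<partial>lborel)"
  proof (intro Bochner_Integration.integral_cong refl)
    fix x
    have "c * std_normal_density (c * x) = exp (- pi * x\<^sup>2)"
      using c by (simp add: std_normal_density_def c_def[symmetric] power_mult_distrib)
    moreover have "c * y * (c * x) = 2 * pi * (y * x)"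
      using c(2) by (simp add: power2_eq_square)
    ultimately show "c *\<^sub>R (std_normal_density (c * x) *\<^sub>R iexp (c * y * (c * x)))
        = exp (of_real (- pi * x\<^sup>2) + \<i> * of_real (2 * pi * (y * x)))"
      unfolding scaleR_scaleR
      by (simp only: scaleR_conv_of_real exp_add exp_of_real mult.commute[of "\<i>"])
  qed
  finally show ?thesis by simp
qed

text \<open>Centred at \<open>a\<close> and modulated by \<open>\<chi>\<^sub>b\<close>: the smallest family containing \<open>exp (- \<pi> |u|\<^sup>2)\<close> that is
  invariant, up to scalars, under translations, modulations and the Fourier transform.\<close>

definition gaussian :: "real^'n::finite \<Rightarrow> real^'n \<Rightarrow> real^'n \<Rightarrow> complex" where
  "gaussian a b u = of_real (exp (- pi * (norm (u - a))\<^sup>2)) * chi b u"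

lemma borel_measurable_gaussian [measurable]: "gaussian a b \<in> borel_measurable borel"
  unfolding gaussian_def by measurable

lemma lebesgue_measurable_gaussian [measurable]: "gaussian a b \<in> borel_measurable lebesgue"
  by measurable

text \<open>Lebesgue measure on \<open>\<real>\<^sup>n\<close> is the product measure of the coordinates and the integrand is a
  product of functions of one coordinate each.\<close>

lemma gaussian_fourier_origin:
  fixes y :: "real^'n::finite"
  shows "(\<integral>u. gaussian 0 y u \<partial>lebesgue) = of_real (exp (- pi * (norm y)\<^sup>2))"
proof -
  interpret product_sigma_finite "\<lambda>_ :: real^'n. lborel :: real measure" ..
  define g where "g b x = exp (complex_of_real (- pi * x\<^sup>2) + \<i> * of_real (2 * pi * ((y \<bullet> b) * x)))" for b x
  have g_int: "integral\<^sup>L lborel (g b) = of_real (exp (- pi * (y \<bullet> b)\<^sup>2))" for b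
    unfolding g_def by (rule gaussian_fourier_real)
  have g_integrable: "integrable lborel (g b)" for b
    using g_int[of b] not_integrable_integral_eq[of lborel "g b"] by auto
  have coord: "(\<Sum>b'\<in>Basis. f b' *\<^sub>R b') \<bullet> b = f b" if "b \<in> Basis" for f :: "real^'n \<Rightarrow> real" and b
    using that by simp
  have prod: "gaussian 0 y (\<Sum>b\<in>Basis. f b *\<^sub>R b) = (\<Prod>b\<in>Basis. g b (f b))" for f :: "real^'n \<Rightarrow> real"
  proof -
    define u where "u = (\<Sum>b\<in>Basis. f b *\<^sub>R b)"
    have "(norm u)\<^sup>2 = (\<Sum>b\<in>Basis. (f b)\<^sup>2)"
      unfolding power2_norm_eq_inner euclidean_inner[of u u]
      by (intro sum.cong refl) (simp add: u_def power2_eq_square)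
    moreover have "y \<bullet> u = (\<Sum>b\<in>Basis. (y \<bullet> b) * f b)"
      unfolding euclidean_inner[of y u] by (intro sum.cong refl) (simp add: u_def)
    ultimately have "gaussian 0 y u
        = exp (of_real (- pi * (\<Sum>b\<in>Basis. (f b)\<^sup>2)) + \<i> * of_real (2 * pi * (\<Sum>b\<in>Basis. (y \<bullet> b) * f b)))"
      by (simp only: gaussian_def chi_def cis_conv_exp exp_add exp_of_real diff_zero)
    also have "\<dots> = exp (\<Sum>b\<in>Basis. of_real (- pi * (f b)\<^sup>2) + \<i> * of_real (2 * pi * ((y \<bullet> b) * f b)))"
      by (simp add: sum.distrib sum_distrib_left sum_negf sum_subtractf)
    also have "\<dots> = (\<Prod>b\<in>Basis. g b (f b))"
      unfolding g_def by (rule exp_sum) simp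
    finally show ?thesis by (simp add: u_def)
  qed
  have "(\<integral>u. gaussian 0 y u \<partial>lebesgue) = (\<integral>u. gaussian 0 y u \<partial>lborel)"
    by (rule integral_completion) simp
  also have "\<dots> = (\<integral>f. (\<Prod>b\<in>Basis. g b (f b)) \<partial>(\<Pi>\<^sub>M b\<in>Basis. lborel))"
    by (subst lborel_eq, subst integral_distr) (auto simp: prod)
  also have "\<dots> = (\<Prod>b\<in>Basis. of_real (exp (- pi * (y \<bullet> b)\<^sup>2)))"
    by (subst product_integral_prod) (auto simp: g_int g_integrable)
  also have "\<dots> = of_real (exp (\<Sum>b\<in>Basis. - pi * (y \<bullet> b)\<^sup>2))"
    by (subst exp_sum) auto
  also have "(\<Sum>b\<in>Basis. - pi * (y \<bullet> b)\<^sup>2) = - pi * (norm y)\<^sup>2"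
    unfolding power2_norm_eq_inner euclidean_inner[of y y]
    by (simp add: sum_distrib_left power2_eq_square)
  finally show ?thesis .
qed

lemma gaussian_shift: "gaussian a b (u + a) = chi b a * gaussian 0 b u"
  by (simp add: gaussian_def chi_add)

text \<open>A Bochner integral is 0 unless the function is integrable, so the value just computed shows
  integrability.\<close>

lemma gaussian_integrable:
  fixes a :: "real^'n::finite"
  shows "integrable lebesgue (gaussian a b)"
proof -
  have "integrable lebesgue (gaussian 0 0 :: real^'n \<Rightarrow> complex)"
    using gaussian_fourier_origin[of "0::real^'n"]
      not_integrable_integral_eq[of lebesgue "gaussian 0 0 :: real^'n \<Rightarrow> complex"] by auto
  then have "integrable (distr lebesgue lebesgue (\<lambda>u. mat 1 *v (u + (- a)))) (gaussian 0 0 :: real^'n \<Rightarrow> complex)"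
    by (subst lebesgue_distr_isometry) (simp_all add: orthogonal_matrix_id)
  then have "integrable lebesgue (\<lambda>u. gaussian 0 0 (mat 1 *v (u + (- a))) :: complex)"
    by (subst (asm) integrable_distr_eq) (simp_all only: lebesgue_measurable_isometry[OF orthogonal_matrix_id] lebesgue_measurable_gaussian)
  then show ?thesis
    by (rule Bochner_Integration.integrable_bound) (auto simp: gaussian_def norm_mult)
qed

lemma cmod_gaussian_le: "cmod (gaussian a b u) \<le> 1"
  by (simp add: gaussian_def norm_mult)

lemma gaussian_L2: "gaussian a b \<in> L2 lebesgue"
proof (rule L2I)
  show "integrable lebesgue (\<lambda>u. (cmod (gaussian a b u))\<^sup>2)"
  proof (rule Bochner_Integration.integrable_bound[OF gaussian_integrable[of a b]])
    have "cmod (gaussian a b u) * cmod (gaussian a b u) \<le> 1 * cmod (gaussian a b u)" for u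
      by (intro mult_right_mono cmod_gaussian_le) simp
    then show "AE u in lebesgue. norm ((cmod (gaussian a b u))\<^sup>2) \<le> norm (gaussian a b u)"
      by (simp add: power2_eq_square)
  qed simp
qed simp

lemma gaussian_mult_chi: "gaussian a b u * chi y u = gaussian a (b + y) u"
  by (simp add: gaussian_def chi_add)

lemma cnj_gaussian: "cnj (gaussian a b u) = gaussian a (- b) u"
  by (simp add: gaussian_def chi_minus)

lemma fourier_gaussian: "fourier (gaussian a b) y = chi a b * gaussian (- b) a y"
proof -
  have "fourier (gaussian a b) y = (\<integral>u. gaussian a (b + y) u \<partial>lebesgue)"
    by (simp add: fourier_def gaussian_mult_chi)
  also have "\<dots> = (\<integral>u. gaussian a (b + y) (u + a) \<partial>lebesgue)"
    by (rule lebesgue_integral_translation[symmetric]) simp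
  also have "\<dots> = chi (b + y) a * of_real (exp (- pi * (norm (b + y))\<^sup>2))"
    by (simp add: gaussian_shift gaussian_fourier_origin)
  also have "\<dots> = chi a b * gaussian (- b) a y"
    by (simp add: gaussian_def chi_add chi_commute[of _ a] add.commute)
  finally show ?thesis .
qed

section \<open>Plancherel's theorem\<close>

text \<open>Fubini's theorem, as the kernel \<open>\<chi>\<^sub>y(u)\<close> is symmetric in \<open>y\<close> and \<open>u\<close>.\<close>

lemma fourier_multiplication_formula:
  fixes f :: "real^'n::finite \<Rightarrow> complex"
  assumes f: "integrable lebesgue f"
  shows "(\<integral>y. fourier f y * gaussian a b y \<partial>lebesgue) = (\<integral>u. f u * fourier (gaussian a b) u \<partial>lebesgue)"
proof -
  interpret sigma_finite_measure "lebesgue :: (real^'n) measure" by (rule sigma_finite_lebesgue)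
  interpret pair_sigma_finite "lebesgue :: (real^'n) measure" "lebesgue :: (real^'n) measure" ..
  have [measurable]: "f \<in> borel_measurable lebesgue" using f by (rule borel_measurable_integrable)
  have id [measurable]: "(\<lambda>u. u) \<in> borel_measurable (lebesgue :: (real^'n) measure)"
    by measurable
  have [measurable]: "(\<lambda>p. chi (snd p) (fst p)) \<in> borel_measurable (lebesgue \<Otimes>\<^sub>M (lebesgue :: (real^'n) measure))"
    by (intro borel_measurable_chi measurable_compose[OF measurable_fst id] measurable_compose[OF measurable_snd id])
  have int: "integrable (lebesgue \<Otimes>\<^sub>M lebesgue) (\<lambda>(u, y). f u * chi y u * gaussian a b y)"
  proof (rule Fubini_integrable)
    show "(\<lambda>(u, y). f u * chi y u * gaussian a b y) \<in> borel_measurable (lebesgue \<Otimes>\<^sub>M lebesgue)"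
      unfolding split_beta' by measurable
    show "integrable lebesgue (\<lambda>u. \<integral>y. norm (case (u, y) of (u, y) \<Rightarrow> f u * chi y u * gaussian a b y) \<partial>lebesgue)"
      using f by (simp add: norm_mult)
    have "f u * chi y u * gaussian a b y = f u * (gaussian a b y * chi u y)" for u y
      by (simp add: chi_commute[of u] mult.commute mult.left_commute)
    then have "integrable lebesgue (\<lambda>y. f u * chi y u * gaussian a b y)" for u
      by (simp only: integrable_mult_right integrable_chi_mult gaussian_integrable)
    then show "AE u in lebesgue. integrable lebesgue (\<lambda>y. case (u, y) of (u, y) \<Rightarrow> f u * chi y u * gaussian a b y)"
      by simp
  qed
  have "(\<integral>y. fourier f y * gaussian a b y \<partial>lebesgue) = (\<integral>y. (\<integral>u. f u * chi y u * gaussian a b y \<partial>lebesgue) \<partial>lebesgue)"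
    by (simp add: fourier_def)
  also have "\<dots> = (\<integral>u. (\<integral>y. f u * chi y u * gaussian a b y \<partial>lebesgue) \<partial>lebesgue)"
    by (rule Fubini_integral[OF int])
  also have "\<dots> = (\<integral>u. f u * fourier (gaussian a b) u \<partial>lebesgue)"
    by (simp add: fourier_def mult.assoc mult.commute[of "gaussian a b _"] chi_commute)
  finally show ?thesis .
qed

inductive_set gaussian_span :: "(real^'n::finite \<Rightarrow> complex) set" where
  gaussian_span_zero: "(\<lambda>_. 0) \<in> gaussian_span"
| gaussian_span_step: "f \<in> gaussian_span \<Longrightarrow> (\<lambda>u. f u + c * gaussian a b u) \<in> gaussian_span"

lemma gaussian_span_gaussian: "gaussian a b \<in> gaussian_span"
  using gaussian_span_step[OF gaussian_span_zero, of 1 a b] by simp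

lemma gaussian_span_add:
  assumes "f \<in> gaussian_span" "g \<in> gaussian_span"
  shows "(\<lambda>u. f u + g u) \<in> gaussian_span"
  using assms(2,1)
proof induction
  case (gaussian_span_step g c a b)
  then show ?case
    using gaussian_span.gaussian_span_step[of "\<lambda>u. f u + g u" c a b] by (simp add: add.assoc)
qed simp

lemma gaussian_span_scale: "f \<in> gaussian_span \<Longrightarrow> (\<lambda>u. c * f u) \<in> gaussian_span"
proof (induction rule: gaussian_span.induct)
  case (gaussian_span_step f d a b)
  then show ?case
    using gaussian_span.gaussian_span_step[of "\<lambda>u. c * f u" "c * d" a b] by (simp add: algebra_simps)
qed (simp add: gaussian_span_zero)

lemma gaussian_span_L2: "f \<in> gaussian_span \<Longrightarrow> f \<in> L2 lebesgue"
  by (induction rule: gaussian_span.induct) (intro L2_zero L2_add L2_scale gaussian_L2; assumption)+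

lemma gaussian_span_integrable: "f \<in> gaussian_span \<Longrightarrow> integrable lebesgue f"
proof (induction rule: gaussian_span.induct)
  case (gaussian_span_step f c a b)
  then show ?case
    by (intro Bochner_Integration.integrable_add integrable_mult_right gaussian_integrable)
qed simp

lemma fourier_add:
  assumes "integrable lebesgue f" "integrable lebesgue g"
  shows "fourier (\<lambda>u. f u + c * g u) y = fourier f y + c * fourier g y"
  unfolding fourier_def distrib_right mult.assoc
  using integrable_chi_mult[OF assms(1), of y] integrable_chi_mult[OF assms(2), of y] by simp

lemma fourier_gaussian_span_step:
  assumes "f \<in> gaussian_span"
  shows "fourier (\<lambda>u. f u + c * gaussian a b u) = (\<lambda>y. fourier f y + (c * chi a b) * gaussian (- b) a y)"
  by (simp add: fun_eq_iff fourier_add gaussian_span_integrable[OF assms] gaussian_integrable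
      fourier_gaussian mult.assoc)

lemma fourier_gaussian_span: "f \<in> gaussian_span \<Longrightarrow> fourier f \<in> gaussian_span"
proof (induction rule: gaussian_span.induct)
  case gaussian_span_zero
  then show ?case
    by (simp add: fourier_def gaussian_span.gaussian_span_zero)
next
  case (gaussian_span_step f c a b)
  then show ?case
    unfolding fourier_gaussian_span_step[OF gaussian_span_step.hyps]
    by (intro gaussian_span.gaussian_span_step)
qed

lemma gaussian_span_fourier_image:
  assumes "f \<in> gaussian_span"
  obtains t where "t \<in> gaussian_span" "fourier t = f"
proof -
  have "\<exists>t\<in>gaussian_span. fourier t = f"
    using assms
  proof (induction rule: gaussian_span.induct)
    case gaussian_span_zero
    then show ?case
      by (intro bexI[of _ "\<lambda>_. 0"]) (simp_all add: fourier_def gaussian_span.gaussian_span_zero)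
  next
    case (gaussian_span_step f c a b)
    then obtain t where t: "t \<in> gaussian_span" "fourier t = f" by blast
    have "fourier (\<lambda>u. t u + (c * cnj (chi b (- a))) * gaussian b (- a) u) = (\<lambda>u. f u + c * gaussian a b u)"
      unfolding fourier_gaussian_span_step[OF t(1)] t(2) by (simp add: mult.assoc)
    then show ?case
      using gaussian_span.gaussian_span_step[OF t(1)] by blast
  qed
  then show ?thesis using that by blast
qed

text \<open>Up to a scalar the conjugate of the transform of a Gaussian is again a Gaussian, and its
  transform is the conjugate of the original one. So the multiplication formula says that the
  transform preserves inner products with Gaussians.\<close>

lemma fourier_inner_gaussian:
  assumes f: "integrable lebesgue f"
  shows "L2_inner lebesgue (fourier f) (fourier (gaussian a b)) = L2_inner lebesgue f (gaussian a b)"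
proof -
  have "L2_inner lebesgue (fourier f) (fourier (gaussian a b))
      = (\<integral>y. cnj (chi a b) * (fourier f y * gaussian (- b) (- a) y) \<partial>lebesgue)"
    unfolding L2_inner_def
    by (intro Bochner_Integration.integral_cong) (simp_all add: fourier_gaussian cnj_gaussian)
  also have "\<dots> = cnj (chi a b) * (\<integral>u. f u * fourier (gaussian (- b) (- a)) u \<partial>lebesgue)"
    by (simp add: fourier_multiplication_formula[OF f])
  also have "\<dots> = (\<integral>u. f u * cnj (gaussian a b u) \<partial>lebesgue)"
  proof -
    have "f u * fourier (gaussian (- b) (- a)) u = chi a b * (f u * cnj (gaussian a b u))" for u
      by (simp add: fourier_gaussian cnj_gaussian chi_minus chi_commute[of b])
    then have "(\<integral>u. f u * fourier (gaussian (- b) (- a)) u \<partial>lebesgue)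
        = chi a b * (\<integral>u. f u * cnj (gaussian a b u) \<partial>lebesgue)"
      by (simp only: integral_mult_right_zero)
    then show ?thesis by (simp add: mult.assoc[symmetric])
  qed
  finally show ?thesis by (simp add: L2_inner_def)
qed

lemma fourier_inner_gaussian_span:
  assumes "f \<in> gaussian_span" "g \<in> gaussian_span"
  shows "L2_inner lebesgue (fourier f) (fourier g) = L2_inner lebesgue f g"
  using assms(1)
proof (induction rule: gaussian_span.induct)
  case gaussian_span_zero
  then show ?case by (simp add: L2_inner_def fourier_def)
next
  case (gaussian_span_step f c a b)
  note L2 = gaussian_span_L2[OF fourier_gaussian_span]
  have "L2_inner lebesgue (gaussian a b) g = L2_inner lebesgue (fourier (gaussian a b)) (fourier g)"
    using fourier_inner_gaussian[OF gaussian_span_integrable[OF assms(2)], of a b]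
    by (metis L2_inner_commute)
  moreover have "fourier (\<lambda>u. f u + c * gaussian a b u) = (\<lambda>y. fourier f y + c * fourier (gaussian a b) y)"
    by (simp add: fun_eq_iff fourier_add gaussian_span_integrable[OF gaussian_span_step.hyps] gaussian_integrable)
  ultimately show ?case
    using gaussian_span_step.IH
    by (simp add: L2_inner_add L2_inner_scale L2_scale L2[OF gaussian_span_step.hyps] L2[OF assms(2)]
        L2[OF gaussian_span_gaussian] gaussian_L2 gaussian_span_L2[OF gaussian_span_step.hyps]
        gaussian_span_L2[OF assms(2)])
qed

lemma sqnorm_fourier_gaussian_span:
  assumes "f \<in> gaussian_span"
  shows "sqnorm lebesgue (fourier f) = sqnorm lebesgue f"
  using fourier_inner_gaussian_span[OF assms assms] by (simp add: L2_inner_self)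

text \<open>Integrals against the Gaussians centred at the origin are the values of the Fourier transform
  of \<open>f exp (- \<pi> |u|\<^sup>2)\<close>, which therefore vanishes.\<close>

lemma orthogonal_to_gaussians:
  assumes f: "f \<in> L2 lebesgue" and orth: "\<And>a b. (\<integral>u. f u * gaussian a b u \<partial>lebesgue) = 0"
  shows "AE u in lebesgue. f u = 0"
proof -
  have "AE u in lebesgue. f u * gaussian 0 0 u = 0"
  proof (rule fourier_injective)
    show "integrable lebesgue (\<lambda>u. f u * gaussian 0 0 u)"
      by (rule L2_mult_integrable[OF f gaussian_L2])
    show "fourier (\<lambda>u. f u * gaussian 0 0 u) y = 0" for y
      using orth[of 0 y] by (simp add: fourier_def mult.assoc gaussian_mult_chi)
  qed
  then show ?thesis by (simp add: gaussian_def)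
qed

lemma gaussian_span_dense:
  assumes "f \<in> L2 lebesgue"
  obtains s where "\<And>k. s k \<in> gaussian_span" "L2_tendsto lebesgue s f"
proof (rule L2_dense_subspace[of gaussian_span lebesgue])
  fix g :: "real^'a \<Rightarrow> complex"
  assume g: "g \<in> L2 lebesgue" and orth: "\<And>h. h \<in> gaussian_span \<Longrightarrow> L2_inner lebesgue g h = 0"
  show "AE u in lebesgue. g u = 0"
    using g orth[OF gaussian_span_gaussian, of _ "- _"]
    by (intro orthogonal_to_gaussians) (simp_all add: L2_inner_def cnj_gaussian)
qed (use assms that in \<open>auto intro: gaussian_span_zero gaussian_span_add gaussian_span_scale gaussian_span_L2\<close>)

text \<open>The multiplication formula as a definition: by totality of the Gaussians it determines each of
  \<open>f\<close> and \<open>g\<close> from the other almost everywhere, and unlike an approximating sequence it is visibly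
  compatible with sums and with changes of variables.\<close>

definition plancherel_pair :: "(real^'n::finite \<Rightarrow> complex) \<Rightarrow> (real^'n \<Rightarrow> complex) \<Rightarrow> bool" where
  "plancherel_pair f g \<longleftrightarrow> f \<in> L2 lebesgue \<and> g \<in> L2 lebesgue \<and>
     (\<forall>a b. (\<integral>y. g y * gaussian a b y \<partial>lebesgue) = chi a b * (\<integral>u. f u * gaussian (- b) a u \<partial>lebesgue))"

lemma plancherel_pairD:
  assumes "plancherel_pair f g"
  shows "f \<in> L2 lebesgue" "g \<in> L2 lebesgue"
    "(\<integral>y. g y * gaussian a b y \<partial>lebesgue) = chi a b * (\<integral>u. f u * gaussian (- b) a u \<partial>lebesgue)"
  using assms unfolding plancherel_pair_def by blast+

lemma plancherel_pair_zero: "plancherel_pair (\<lambda>_. 0) (\<lambda>_. 0)"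
  by (simp add: plancherel_pair_def L2_zero)

lemma plancherel_pair_add:
  assumes "plancherel_pair f g" "plancherel_pair f' g'"
  shows "plancherel_pair (\<lambda>u. f u + c * f' u) (\<lambda>y. g y + c * g' y)"
proof -
  note L2 = plancherel_pairD(1,2)[OF assms(1)] plancherel_pairD(1,2)[OF assms(2)]
  have int: "(\<integral>u. (h u + c * h' u) * gaussian a b u \<partial>lebesgue)
      = (\<integral>u. h u * gaussian a b u \<partial>lebesgue) + c * (\<integral>u. h' u * gaussian a b u \<partial>lebesgue)"
    if "h \<in> L2 lebesgue" "h' \<in> L2 lebesgue" for h h' :: "real^'a \<Rightarrow> complex" and a b
    using L2_mult_integrable[OF that(1) gaussian_L2, of a b] L2_mult_integrable[OF that(2) gaussian_L2, of a b]
    by (simp add: distrib_right mult.assoc)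
  show ?thesis
    unfolding plancherel_pair_def
    using L2 int[OF L2(1,3)] int[OF L2(2,4)] plancherel_pairD(3)[OF assms(1)] plancherel_pairD(3)[OF assms(2)]
    by (simp add: L2_add L2_scale algebra_simps)
qed

lemma plancherel_pair_diff:
  "plancherel_pair f g \<Longrightarrow> plancherel_pair f' g' \<Longrightarrow> plancherel_pair (\<lambda>u. f u - f' u) (\<lambda>y. g y - g' y)"
  using plancherel_pair_add[of f g f' g' "-1"] by simp

lemma plancherel_pair_unique:
  assumes "plancherel_pair f g" "plancherel_pair f' g'"
  shows "(AE u in lebesgue. f u = f' u) \<longleftrightarrow> (AE y in lebesgue. g y = g' y)"
proof -
  define p where "p u = f u - f' u" for u
  define q where "q y = g y - g' y" for y
  have pq: "plancherel_pair p q"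
    unfolding p_def q_def by (rule plancherel_pair_diff[OF assms])
  note L2 = plancherel_pairD(1,2)[OF pq]
  have zero: "(\<integral>u. r u * gaussian a b u \<partial>lebesgue) = 0" if "AE u in lebesgue. r u = 0" for r :: "real^'a \<Rightarrow> complex" and a b
    by (rule integral_eq_zero_AE) (use that in eventually_elim, simp)
  have "(AE u in lebesgue. p u = 0) \<longleftrightarrow> (AE y in lebesgue. q y = 0)"
  proof
    assume "AE u in lebesgue. p u = 0"
    then show "AE y in lebesgue. q y = 0"
      by (intro orthogonal_to_gaussians[OF L2(2)]) (simp add: plancherel_pairD(3)[OF pq] zero)
  next
    assume "AE y in lebesgue. q y = 0"
    then have "(\<integral>u. p u * gaussian (- b) a u \<partial>lebesgue) = 0" for a b
      using plancherel_pairD(3)[OF pq, of a b] by (simp add: zero)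
    from this[of "- _"] show "AE u in lebesgue. p u = 0"
      by (intro orthogonal_to_gaussians[OF L2(1)]) simp
  qed
  then show ?thesis by (simp add: p_def q_def)
qed

lemma plancherel_pair_limit:
  assumes pair: "\<And>k. plancherel_pair (s k) (t k)"
    and f: "L2_tendsto lebesgue s f" and g: "L2_tendsto lebesgue t g"
  shows "plancherel_pair f g"
  unfolding plancherel_pair_def
proof (intro conjI allI)
  show "f \<in> L2 lebesgue" "g \<in> L2 lebesgue" using f g by (auto simp: L2_tendsto_def)
  fix a b
  have inner: "L2_inner lebesgue h (gaussian a (- b)) = (\<integral>u. h u * gaussian a b u \<partial>lebesgue)" for h and a b :: "real^'a"
    by (simp add: L2_inner_def cnj_gaussian)
  have lim1: "(\<lambda>k. \<integral>y. t k y * gaussian a b y \<partial>lebesgue) \<longlonglongrightarrow> (\<integral>y. g y * gaussian a b y \<partial>lebesgue)"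
    using L2_inner_tendsto[OF g gaussian_L2, of a "- b"] by (simp add: inner)
  have lim2: "(\<lambda>k. chi a b * (\<integral>u. s k u * gaussian (- b) a u \<partial>lebesgue))
      \<longlonglongrightarrow> chi a b * (\<integral>u. f u * gaussian (- b) a u \<partial>lebesgue)"
    using L2_inner_tendsto[OF f gaussian_L2, of "- b" "- a"] inner[of _ "- b" a]
    by (intro tendsto_intros) simp
  have eq: "(\<integral>y. t k y * gaussian a b y \<partial>lebesgue) = chi a b * (\<integral>u. s k u * gaussian (- b) a u \<partial>lebesgue)" for k
    by (rule plancherel_pairD(3)[OF pair])
  show "(\<integral>y. g y * gaussian a b y \<partial>lebesgue) = chi a b * (\<integral>u. f u * gaussian (- b) a u \<partial>lebesgue)"
    by (rule LIMSEQ_unique[OF lim1[unfolded eq] lim2])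
qed

lemma plancherel_pair_fourier:
  assumes "integrable lebesgue f" "f \<in> L2 lebesgue" "fourier f \<in> L2 lebesgue"
  shows "plancherel_pair f (fourier f)"
  unfolding plancherel_pair_def
proof (intro conjI allI)
  fix a b
  have "f u * fourier (gaussian a b) u = chi a b * (f u * gaussian (- b) a u)" for u
    by (simp add: fourier_gaussian)
  then show "(\<integral>y. fourier f y * gaussian a b y \<partial>lebesgue) = chi a b * (\<integral>u. f u * gaussian (- b) a u \<partial>lebesgue)"
    by (simp only: fourier_multiplication_formula[OF assms(1)] integral_mult_right_zero)
qed (fact assms(2,3))+

lemma plancherel_approx_pair:
  assumes "\<And>k. integrable lebesgue (s k)" "L2_tendsto lebesgue s f"
    "L2_tendsto lebesgue (\<lambda>k. fourier (s k)) g"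
  shows "plancherel_pair f g"
proof (rule plancherel_pair_limit[OF _ assms(2,3)])
  show "plancherel_pair (s k) (fourier (s k))" for k
    using assms(2,3) unfolding L2_tendsto_def
    by (intro plancherel_pair_fourier assms(1)) (elim conjE, erule spec)+
qed

lemma gaussian_span_diff: "f \<in> gaussian_span \<Longrightarrow> g \<in> gaussian_span \<Longrightarrow> (\<lambda>u. f u - g u) \<in> gaussian_span"
  using gaussian_span_add[of f "\<lambda>u. -1 * g u"] gaussian_span_scale[of g "-1"] by simp

lemma sqnorm_fourier_diff:
  assumes "f \<in> gaussian_span" "g \<in> gaussian_span"
  shows "sqnorm lebesgue (\<lambda>y. fourier f y - fourier g y) = sqnorm lebesgue (\<lambda>u. f u - g u)"
proof -
  have "fourier (\<lambda>u. f u - g u) = (\<lambda>y. fourier f y - fourier g y)"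
    using fourier_add[OF gaussian_span_integrable[OF assms(1)] gaussian_span_integrable[OF assms(2)], of "-1"]
    by (simp add: fun_eq_iff)
  then show ?thesis
    using sqnorm_fourier_gaussian_span[OF gaussian_span_diff[OF assms]] by simp
qed

text \<open>The transform is an isometry of the span of the Gaussians onto itself, and this span is dense,
  so it extends to a unitary operator.\<close>

lemma plancherel_approx_exists:
  assumes "f \<in> L2 lebesgue"
  obtains s g where "\<And>k. s k \<in> gaussian_span" "L2_tendsto lebesgue s f"
    "L2_tendsto lebesgue (\<lambda>k. fourier (s k)) g"
proof -
  obtain s where s: "\<And>k. s k \<in> gaussian_span" "L2_tendsto lebesgue s f"
    using gaussian_span_dense[OF assms] by blast
  obtain g where "L2_tendsto lebesgue (\<lambda>k. fourier (s k)) g"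
    using L2_complete[of "\<lambda>k. fourier (s k)" lebesgue] L2_tendsto_Cauchy[OF s(2)]
      gaussian_span_L2[OF fourier_gaussian_span[OF s(1)]]
    by (auto simp: sqnorm_fourier_diff s(1))
  with s that show ?thesis by blast
qed

text \<open>The span of the Gaussians is its own image, so a sequence in it that converges to \<open>g\<close> is the
  transform of another one, which is Cauchy by isometry.\<close>

lemma plancherel_surjective:
  assumes "g \<in> L2 lebesgue"
  obtains f where "plancherel_pair f g"
proof -
  obtain t where t: "\<And>k. t k \<in> gaussian_span" "L2_tendsto lebesgue t g"
    using gaussian_span_dense[OF assms] by blast
  have "\<exists>r. r \<in> gaussian_span \<and> fourier r = t k" for k
    using gaussian_span_fourier_image[OF t(1)[of k]] by metis
  then obtain s where s: "\<And>k. s k \<in> gaussian_span" "\<And>k. fourier (s k) = t k"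
    by metis
  have "sqnorm lebesgue (\<lambda>u. s j u - s k u) = sqnorm lebesgue (\<lambda>y. t j y - t k y)" for j k
    using sqnorm_fourier_diff[OF s(1) s(1)] by (simp add: s(2))
  then obtain f where "L2_tendsto lebesgue s f"
    using L2_complete[of s lebesgue] L2_tendsto_Cauchy[OF t(2)] gaussian_span_L2[OF s(1)] by auto
  then have "plancherel_pair f g"
    using t(2) by (intro plancherel_approx_pair[of s] gaussian_span_integrable s(1)) (simp_all add: s(2))
  with that show ?thesis by blast
qed

lemma plancherel_pair_plancherel:
  assumes "f \<in> L2 lebesgue"
  shows "plancherel_pair f (plancherel f)"
proof -
  obtain s g where "\<And>k. s k \<in> gaussian_span" "L2_tendsto lebesgue s f"
      "L2_tendsto lebesgue (\<lambda>k. fourier (s k)) g"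
    using plancherel_approx_exists[OF assms] by metis
  then have "\<exists>g s. (\<forall>k. integrable lebesgue (s k)) \<and> L2_tendsto lebesgue s f \<and>
      L2_tendsto lebesgue (\<lambda>k. fourier (s k)) g"
    using gaussian_span_integrable by blast
  from someI_ex[OF this] show ?thesis
    unfolding plancherel_def[symmetric] using plancherel_approx_pair by blast
qed

lemma plancherel_isometry:
  assumes "plancherel_pair f g"
  shows "sqnorm lebesgue g = sqnorm lebesgue f"
proof -
  note L2 = plancherel_pairD(1,2)[OF assms]
  obtain s h where s: "\<And>k. s k \<in> gaussian_span" and f: "L2_tendsto lebesgue s f"
      and h: "L2_tendsto lebesgue (\<lambda>k. fourier (s k)) h"
    using plancherel_approx_exists[OF L2(1)] by metis
  have fh: "plancherel_pair f h"
    by (rule plancherel_approx_pair[OF gaussian_span_integrable[OF s] f h])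
  have "AE y in lebesgue. g y = h y"
    using plancherel_pair_unique[OF assms fh] by simp
  then have "sqnorm lebesgue g = sqnorm lebesgue h"
    using L2(2) plancherel_pairD(2)[OF fh] by (intro sqnorm_cong_AE L2_measurable)
  also have "\<dots> = sqnorm lebesgue f"
    using LIMSEQ_unique[OF sqnorm_tendsto[OF h]] sqnorm_tendsto[OF f]
    by (simp add: sqnorm_fourier_gaussian_span[OF s])
  finally show ?thesis .
qed

section \<open>The dual representation\<close>

text \<open>The representation that corresponds to \<open>crys_rep\<close> under the Plancherel transform.\<close>

definition dual_rep ::
  "'n::finite affine \<Rightarrow> (real^'n \<Rightarrow> complex) \<Rightarrow> real^'n \<Rightarrow> complex" where
  "dual_rep g \<phi> = (\<lambda>y. chi (matrix_inv (snd g) *v y) (fst g) * \<phi> (matrix_inv (snd g) *v y))"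

lemma orthogonal_matrix_transpose':
  "orthogonal_matrix M \<Longrightarrow> orthogonal_matrix (transpose M :: real^'n::finite^'n)"
  by simp

lemma matrix_vector_neg: "(A :: real^'n::finite^'m::finite) *v (- u) = - (A *v u)"
  using matrix_vector_mult_diff_distrib[of A 0 u] by simp

lemma dual_rep_L2:
  assumes "orthogonal_matrix (snd g)" "\<phi> \<in> L2 lebesgue"
  shows "dual_rep g \<phi> \<in> L2 lebesgue"
proof -
  have *: "(\<lambda>y. \<phi> (transpose (snd g) *v (y + 0))) \<in> L2 lebesgue"
    by (rule L2_isometry[OF orthogonal_matrix_transpose'[OF assms(1)] assms(2)])
  show ?thesis
  proof (rule L2_dominated[OF *])
    show "dual_rep g \<phi> \<in> borel_measurable lebesgue"
      unfolding dual_rep_def orthogonal_matrix_inv[OF assms(1)]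
      using L2_measurable[OF *] by (intro borel_measurable_times borel_measurable_chi) (auto simp del: transpose_matrix_vector)
  qed (simp add: dual_rep_def orthogonal_matrix_inv[OF assms(1)] norm_mult)
qed

lemma crys_rep_L2:
  assumes "orthogonal_matrix (snd g)" "f \<in> L2 lebesgue"
  shows "crys_rep g f \<in> L2 lebesgue"
proof -
  have "transpose (snd g) *v (u + - (snd g *v fst g)) = transpose (snd g) *v u - fst g" for u
    by (simp only: matrix_vector_right_distrib diff_conv_add_uminus
        matrix_vector_neg orthogonal_matrix_cancel[OF assms(1)])
  then show ?thesis
    using L2_isometry[OF orthogonal_matrix_transpose'[OF assms(1)] assms(2), of "- (snd g *v fst g)"]
    by (simp only: crys_rep_def orthogonal_matrix_inv[OF assms(1)])
qed

lemma gaussian_orthogonal: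
  assumes "orthogonal_matrix L"
  shows "gaussian a b (L *v v) = gaussian (transpose L *v a) (transpose L *v b) v"
proof -
  have "norm (L *v v - a) = norm (L *v (v - transpose L *v a))"
    by (simp only: matrix_vector_mult_diff_distrib orthogonal_matrix_cancel[OF assms])
  also have "\<dots> = norm (v - transpose L *v a)"
    by (rule orthogonal_matrix_norm[OF assms])
  finally show ?thesis
    using chi_matrix[of L v b]
    by (simp only: gaussian_def chi_commute[of b "L *v v"] chi_commute[of "transpose L *v b" v])
qed

text \<open>An isometry maps Gaussians to Gaussians up to scalars, so the identities that define the pair of
  \<open>crys_rep p f\<close> and \<open>dual_rep p g\<close> are those for \<open>f\<close> and \<open>g\<close> with other parameters.\<close>

lemma plancherel_pair_rep:
  assumes L: "orthogonal_matrix (snd p)" and fg: "plancherel_pair f g"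
  shows "plancherel_pair (crys_rep p f) (dual_rep p g)"
  unfolding plancherel_pair_def
proof (intro conjI allI)
  obtain x L where p: "p = (x, L)" by (cases p)
  note L = L[unfolded p snd_conv]
  note L2 = plancherel_pairD(1,2)[OF fg]
  show c: "crys_rep p f \<in> L2 lebesgue" and d: "dual_rep p g \<in> L2 lebesgue"
    using crys_rep_L2[OF assms(1) L2(1)] dual_rep_L2[OF assms(1) L2(2)] .
  fix a b
  define a' b' where "a' = transpose L *v a" and "b' = transpose L *v b"
  have "(\<integral>y. dual_rep p g y * gaussian a b y \<partial>lebesgue)
      = (\<integral>v. dual_rep p g (L *v (v + 0)) * gaussian a b (L *v (v + 0)) \<partial>lebesgue)"
    by (rule lebesgue_integral_isometry[OF L, symmetric])
       (intro borel_measurable_times L2_measurable[OF d] lebesgue_measurable_gaussian)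
  also have "\<dots> = (\<integral>v. g v * gaussian a' (b' + x) v \<partial>lebesgue)"
  proof (intro Bochner_Integration.integral_cong refl)
    fix v
    have "dual_rep p g (L *v (v + 0)) = chi v x * g v"
      by (simp only: dual_rep_def p fst_conv snd_conv orthogonal_matrix_inv[OF L] add_0_right
          orthogonal_matrix_cancel[OF L])
    moreover have "gaussian a b (L *v (v + 0)) * chi x v = gaussian a' (b' + x) v"
      by (simp only: gaussian_orthogonal[OF L] a'_def b'_def add_0_right gaussian_mult_chi)
    ultimately show "dual_rep p g (L *v (v + 0)) * gaussian a b (L *v (v + 0)) = g v * gaussian a' (b' + x) v"
      by (simp only: chi_commute[of v x]) (simp add: mult.commute mult.left_commute)
  qed
  also have "\<dots> = chi a' (b' + x) * (\<integral>v. f v * gaussian (- (b' + x)) a' v \<partial>lebesgue)"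
    by (rule plancherel_pairD(3)[OF fg])
  also have "\<dots> = chi a b * (\<integral>v. chi a' x * (f v * gaussian (- (b' + x)) a' v) \<partial>lebesgue)"
  proof -
    have "chi a' b' = chi a b"
      by (simp only: chi_def a'_def b'_def orthogonal_matrix_inner[OF L, symmetric] orthogonal_matrix_cancel[OF L])
    then show ?thesis by (simp add: chi_add mult.assoc)
  qed
  also have "(\<integral>v. chi a' x * (f v * gaussian (- (b' + x)) a' v) \<partial>lebesgue)
      = (\<integral>v. crys_rep p f (L *v (v + x)) * gaussian (- b) a (L *v (v + x)) \<partial>lebesgue)"
  proof (intro Bochner_Integration.integral_cong refl)
    fix v
    have "crys_rep p f (L *v (v + x)) = f v"
      by (simp only: crys_rep_def p fst_conv snd_conv orthogonal_matrix_inv[OF L]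
          orthogonal_matrix_cancel[OF L] add_diff_cancel_right')
    moreover have "gaussian (- b) a (L *v (v + x)) = gaussian (- b') a' (v + x)"
      by (simp only: gaussian_orthogonal[OF L] a'_def b'_def matrix_vector_neg)
    moreover have "gaussian (- b') a' (v + x) = chi a' x * gaussian (- (b' + x)) a' v"
      by (simp add: gaussian_def chi_add algebra_simps)
    ultimately show "chi a' x * (f v * gaussian (- (b' + x)) a' v)
        = crys_rep p f (L *v (v + x)) * gaussian (- b) a (L *v (v + x))" by simp
  qed
  also have "\<dots> = (\<integral>u. crys_rep p f u * gaussian (- b) a u \<partial>lebesgue)"
    by (rule lebesgue_integral_isometry[OF L])
       (intro borel_measurable_times L2_measurable[OF c] lebesgue_measurable_gaussian)
  finally show "(\<integral>y. dual_rep p g y * gaussian a b y \<partial>lebesgue)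
      = chi a b * (\<integral>u. crys_rep p f u * gaussian (- b) a u \<partial>lebesgue)" .
qed

lemma L2_inner_dual_rep:
  assumes g: "orthogonal_matrix (snd g)" and "\<phi> \<in> L2 lebesgue" "\<psi> \<in> L2 lebesgue"
  shows "L2_inner lebesgue (dual_rep g \<phi>) (dual_rep g \<psi>) = L2_inner lebesgue \<phi> \<psi>"
proof -
  have m: "(\<lambda>y. \<phi> y * cnj (\<psi> y)) \<in> borel_measurable lebesgue"
    by (intro borel_measurable_times borel_measurable_cnj L2_measurable assms)
  have ac: "(a * b) * (cnj a * c) = (a * cnj a) * (b * c)" for a b c :: complex
    by (simp add: mult_ac)
  have "L2_inner lebesgue (dual_rep g \<phi>) (dual_rep g \<psi>)
      = (\<integral>y. \<phi> (transpose (snd g) *v (y + 0)) * cnj (\<psi> (transpose (snd g) *v (y + 0))) \<partial>lebesgue)"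
    unfolding L2_inner_def dual_rep_def orthogonal_matrix_inv[OF g] complex_cnj_mult ac chi_mult_cnj
    by simp
  also have "\<dots> = L2_inner lebesgue \<phi> \<psi>"
    unfolding L2_inner_def
    by (rule lebesgue_integral_isometry[OF orthogonal_matrix_transpose'[OF g] m])
  finally show ?thesis .
qed

lemma sqnorm_dual_rep:
  assumes "orthogonal_matrix (snd g)" "\<phi> \<in> L2 lebesgue"
  shows "sqnorm lebesgue (dual_rep g \<phi>) = sqnorm lebesgue \<phi>"
  using L2_inner_dual_rep[OF assms(1,2,2)] by (simp add: L2_inner_self)

lemma L2_tendsto_dual_rep:
  assumes g: "orthogonal_matrix (snd g)" and s: "L2_tendsto lebesgue s \<phi>"
  shows "L2_tendsto lebesgue (\<lambda>k. dual_rep g (s k)) (dual_rep g \<phi>)"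
proof -
  have "\<And>k. s k \<in> L2 lebesgue" "\<phi> \<in> L2 lebesgue"
    using s by (auto simp: L2_tendsto_def)
  moreover have "(\<lambda>y. dual_rep g (s k) y - dual_rep g \<phi> y) = dual_rep g (\<lambda>y. s k y - \<phi> y)" for k
    by (simp add: fun_eq_iff dual_rep_def algebra_simps)
  ultimately show ?thesis
    using s by (simp add: L2_tendsto_iff dual_rep_L2[OF g] sqnorm_dual_rep[OF g] L2_diff)
qed

section \<open>Unfolding an integral along disjoint images of a set\<close>

lemma measurable_pair_count_space:
  assumes "countable \<Omega>" "\<And>\<omega>. \<omega> \<in> \<Omega> \<Longrightarrow> (\<lambda>r. f (r, \<omega>)) \<in> M \<rightarrow>\<^sub>M N"
  shows "f \<in> M \<Otimes>\<^sub>M count_space \<Omega> \<rightarrow>\<^sub>M N"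
proof -
  have "(\<lambda>p. f (fst p, snd p)) \<in> M \<Otimes>\<^sub>M count_space \<Omega> \<rightarrow>\<^sub>M N"
    by (rule measurable_compose_countable'[where f = "\<lambda>\<omega> p. f (fst p, \<omega>)" and g = snd, OF _ _ assms(1)])
       (auto intro: measurable_compose[OF measurable_fst assms(2)])
  then show ?thesis by simp
qed

text \<open>Lebesgue measure is complete: changing a function on a null set keeps it measurable.\<close>

lemma lebesgue_on_measurable_AE:
  fixes f g :: "'a::euclidean_space \<Rightarrow> complex"
  assumes R: "R \<in> sets lebesgue" and f: "f \<in> borel_measurable (lebesgue_on R)"
    and ae: "AE x in lebesgue_on R. f x = g x"
  shows "g \<in> borel_measurable (lebesgue_on R)"
proof -
  have "(\<lambda>x. indicator R x *\<^sub>R f x) \<in> borel_measurable lebesgue"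
    using f R by (simp add: borel_measurable_restrict_space_iff)
  moreover have "AE x in lebesgue. indicator R x *\<^sub>R f x = indicator R x *\<^sub>R g x"
    using ae R by (auto simp: AE_restrict_space_iff indicator_def elim: eventually_mono)
  ultimately have "(\<lambda>x. indicator R x *\<^sub>R g x) \<in> borel_measurable lebesgue"
    by (rule borel_measurable_AE)
  then show ?thesis
    using R by (simp add: borel_measurable_restrict_space_iff)
qed

text \<open>Disjoint images of \<open>E\<close> under countably many isometries. Integrals over their union become
  iterated integrals over \<open>E\<close> and the index set, which is how functions on \<open>\<real>\<^sup>n\<close> turn into functions
  on \<open>R\<close> with values in \<open>l\<^sup>2(\<Omega>)\<close>.\<close>

locale disjoint_isometric_images =
  fixes \<tau> :: "'i \<Rightarrow> real^'n::finite \<Rightarrow> real^'n" and \<Omega> :: "'i set" and E :: "(real^'n) set"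
  assumes \<Omega>: "countable \<Omega>"
    and E: "E \<in> sets lebesgue"
    and \<tau>: "\<And>\<omega>. \<omega> \<in> \<Omega> \<Longrightarrow> \<exists>M x. orthogonal_matrix M \<and> \<tau> \<omega> = (\<lambda>u. M *v (u + x))"
    and disj: "\<And>\<omega> \<omega>' r r'. \<omega> \<in> \<Omega> \<Longrightarrow> \<omega>' \<in> \<Omega> \<Longrightarrow> r \<in> E \<Longrightarrow> r' \<in> E \<Longrightarrow> \<tau> \<omega> r = \<tau> \<omega>' r' \<Longrightarrow> \<omega> = \<omega>'"
begin

lemma
  shows unfold_measurable: "(\<lambda>(r, \<omega>). \<tau> \<omega> r) \<in> (lebesgue_on E \<Otimes>\<^sub>M count_space \<Omega>) \<rightarrow>\<^sub>M lebesgue"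
    and unfold_measurable_union: "(\<Union>\<omega>\<in>\<Omega>. \<tau> \<omega> ` E) \<in> sets lebesgue"
    and unfold_distr: "distr (lebesgue_on E \<Otimes>\<^sub>M count_space \<Omega>) lebesgue (\<lambda>(r, \<omega>). \<tau> \<omega> r)
      = density lebesgue (indicator (\<Union>\<omega>\<in>\<Omega>. \<tau> \<omega> ` E))"
proof -
  interpret E: sigma_finite_measure "lebesgue_on E"
    by (rule sigma_finite_measure_restrict_space[OF sigma_finite_lebesgue E])
  interpret \<Omega>: sigma_finite_measure "count_space \<Omega>"
    by (rule sigma_finite_measure_count_space_countable[OF \<Omega>])
  interpret pair_sigma_finite "lebesgue_on E" "count_space \<Omega>" ..
  interpret leb: sigma_finite_measure "lebesgue :: (real^'n) measure" by (rule sigma_finite_lebesgue)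
  interpret leb: pair_sigma_finite "lebesgue :: (real^'n) measure" "count_space \<Omega>" ..
  have \<tau>_meas: "\<tau> \<omega> \<in> lebesgue \<rightarrow>\<^sub>M lebesgue" if "\<omega> \<in> \<Omega>" for \<omega>
    using \<tau>[OF that] lebesgue_measurable_isometry by auto
  show T: "(\<lambda>(r, \<omega>). \<tau> \<omega> r) \<in> (lebesgue_on E \<Otimes>\<^sub>M count_space \<Omega>) \<rightarrow>\<^sub>M lebesgue"
    by (rule measurable_pair_count_space[OF \<Omega>]) (auto intro!: measurable_restrict_space1 \<tau>_meas)
  \<comment> \<open>the inverse isometry of \<open>\<tau> \<omega>\<close>\<close>
  have image: "\<exists>M' x'. orthogonal_matrix M' \<and> (\<forall>u. M' *v (\<tau> \<omega> u + x') = u) \<and> (\<forall>y. \<tau> \<omega> (M' *v (y + x')) = y)"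
    if \<omega>: "\<omega> \<in> \<Omega>" for \<omega>
  proof -
    obtain M x where M: "orthogonal_matrix M" "\<tau> \<omega> = (\<lambda>u. M *v (u + x))" using \<tau>[OF \<omega>] by blast
    show ?thesis
      by (intro exI[of _ "transpose M"] exI[of _ "- (M *v x)"])
         (simp add: M orthogonal_matrix_cancel[OF M(1)] matrix_vector_right_distrib matrix_vector_neg
           del: transpose_matrix_vector)
  qed
  have one: "(\<integral>\<^sup>+r. indicator E r * f (\<tau> \<omega> r) \<partial>lebesgue) = (\<integral>\<^sup>+y. indicator (\<tau> \<omega> ` E) y * f y \<partial>lebesgue)"
    and sets: "\<tau> \<omega> ` E \<in> sets lebesgue"
    if \<omega>: "\<omega> \<in> \<Omega>" and f: "f \<in> borel_measurable lebesgue" for \<omega> and f :: "real^'n \<Rightarrow> ennreal"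
  proof -
    obtain M' x' where M': "orthogonal_matrix M'" and inv: "\<And>u. M' *v (\<tau> \<omega> u + x') = u" "\<And>y. \<tau> \<omega> (M' *v (y + x')) = y"
      using image[OF \<omega>] by blast
    note T' = lebesgue_measurable_isometry[OF M', of x']
    have eq: "\<tau> \<omega> ` E = (\<lambda>y. M' *v (y + x')) -` E \<inter> space lebesgue"
      using inv by (auto simp: image_iff) metis
    then show "\<tau> \<omega> ` E \<in> sets lebesgue"
      using measurable_sets[OF T' E] by simp
    have m: "(\<lambda>r. indicator E r * f (\<tau> \<omega> r)) \<in> borel_measurable lebesgue"
      by (intro borel_measurable_times_ennreal borel_measurable_indicator E measurable_compose[OF \<tau>_meas[OF \<omega>] f])
    have "(\<integral>\<^sup>+r. indicator E r * f (\<tau> \<omega> r) \<partial>lebesgue)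
        = (\<integral>\<^sup>+y. indicator E (M' *v (y + x')) * f (\<tau> \<omega> (M' *v (y + x'))) \<partial>lebesgue)"
      by (subst lebesgue_distr_isometry[OF M', of x', symmetric]) (rule nn_integral_distr[OF T'], simp add: m)
    also have "\<dots> = (\<integral>\<^sup>+y. indicator (\<tau> \<omega> ` E) y * f y \<partial>lebesgue)"
      by (simp add: inv eq indicator_def)
    finally show "(\<integral>\<^sup>+r. indicator E r * f (\<tau> \<omega> r) \<partial>lebesgue) = (\<integral>\<^sup>+y. indicator (\<tau> \<omega> ` E) y * f y \<partial>lebesgue)" .
  qed
  note sets = sets[OF _ borel_measurable_const]
  show U: "(\<Union>\<omega>\<in>\<Omega>. \<tau> \<omega> ` E) \<in> sets lebesgue"
    using sets by (intro sets.countable_UN'[OF \<Omega>]) auto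
  show "distr (lebesgue_on E \<Otimes>\<^sub>M count_space \<Omega>) lebesgue (\<lambda>(r, \<omega>). \<tau> \<omega> r)
      = density lebesgue (indicator (\<Union>\<omega>\<in>\<Omega>. \<tau> \<omega> ` E))"
  proof (rule measure_eqI)
    fix B assume "B \<in> sets (distr (lebesgue_on E \<Otimes>\<^sub>M count_space \<Omega>) lebesgue (\<lambda>(r, \<omega>). \<tau> \<omega> r))"
    then have B: "B \<in> sets lebesgue" by simp
    then have IB: "indicator B \<in> borel_measurable lebesgue" for B' by simp
    have m: "(\<lambda>p. indicator B ((\<lambda>(r, \<omega>). \<tau> \<omega> r) p) :: ennreal) \<in> borel_measurable (lebesgue_on E \<Otimes>\<^sub>M count_space \<Omega>)"
      by (rule measurable_compose[OF T]) (use B in simp)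
    have "emeasure (distr (lebesgue_on E \<Otimes>\<^sub>M count_space \<Omega>) lebesgue (\<lambda>(r, \<omega>). \<tau> \<omega> r)) B
        = (\<integral>\<^sup>+y. indicator B y \<partial>distr (lebesgue_on E \<Otimes>\<^sub>M count_space \<Omega>) lebesgue (\<lambda>(r, \<omega>). \<tau> \<omega> r))"
      using B by simp
    also have "\<dots> = (\<integral>\<^sup>+p. indicator B ((\<lambda>(r, \<omega>). \<tau> \<omega> r) p) \<partial>(lebesgue_on E \<Otimes>\<^sub>M count_space \<Omega>))"
      by (rule nn_integral_distr[OF T]) (use B in simp)
    also have "\<dots> = (\<integral>\<^sup>+\<omega>. \<integral>\<^sup>+r. indicator B (\<tau> \<omega> r) \<partial>lebesgue_on E \<partial>count_space \<Omega>)"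
      using nn_integral_snd[OF m[unfolded split_beta']] by (simp add: split_beta')
    also have "\<dots> = (\<integral>\<^sup>+\<omega>. \<integral>\<^sup>+y. indicator (\<tau> \<omega> ` E) y * indicator B y \<partial>lebesgue \<partial>count_space \<Omega>)"
    proof (rule nn_integral_cong)
      fix \<omega> assume "\<omega> \<in> space (count_space \<Omega>)"
      then have \<omega>: "\<omega> \<in> \<Omega>" by simp
      show "(\<integral>\<^sup>+r. indicator B (\<tau> \<omega> r) \<partial>lebesgue_on E) = (\<integral>\<^sup>+y. indicator (\<tau> \<omega> ` E) y * indicator B y \<partial>lebesgue)"
        unfolding one[OF \<omega> IB, symmetric]
        using E by (simp add: nn_integral_restrict_space mult.commute)
    qed
    also have "\<dots> = (\<integral>\<^sup>+y. \<integral>\<^sup>+\<omega>. indicator (\<tau> \<omega> ` E) y * indicator B y \<partial>count_space \<Omega> \<partial>lebesgue)"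
    proof (rule leb.Fubini')
      show "(\<lambda>(y, \<omega>). indicator (\<tau> \<omega> ` E) y * indicator B y :: ennreal) \<in> borel_measurable (lebesgue \<Otimes>\<^sub>M count_space \<Omega>)"
        by (rule measurable_pair_count_space[OF \<Omega>])
           (use B in \<open>auto intro!: borel_measurable_times_ennreal borel_measurable_indicator sets\<close>)
    qed
    also have "\<dots> = (\<integral>\<^sup>+y. indicator (\<Union>\<omega>\<in>\<Omega>. \<tau> \<omega> ` E) y * indicator B y \<partial>lebesgue)"
    proof (rule nn_integral_cong)
      fix y
      show "(\<integral>\<^sup>+\<omega>. indicator (\<tau> \<omega> ` E) y * indicator B y \<partial>count_space \<Omega>)
          = indicator (\<Union>\<omega>\<in>\<Omega>. \<tau> \<omega> ` E) y * (indicator B y :: ennreal)"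
      proof (cases "y \<in> (\<Union>\<omega>\<in>\<Omega>. \<tau> \<omega> ` E)")
        case True
        then obtain \<omega> where \<omega>: "\<omega> \<in> \<Omega>" "y \<in> \<tau> \<omega> ` E" by blast
        have "y \<notin> \<tau> \<omega>' ` E" if "\<omega>' \<in> \<Omega>" "\<omega>' \<noteq> \<omega>" for \<omega>'
          using disj[of \<omega>' \<omega>] that \<omega> by blast
        then have "(\<integral>\<^sup>+\<omega>'. indicator (\<tau> \<omega>' ` E) y * indicator B y \<partial>count_space \<Omega>)
            = (\<integral>\<^sup>+\<omega>'. indicator B y * indicator {\<omega>} \<omega>' \<partial>count_space \<Omega>)"
          using \<omega> by (intro nn_integral_cong) (auto simp: indicator_def)
        also have "\<dots> = indicator B y"
          using \<omega>(1) by (subst nn_integral_cmult_indicator) (auto simp: emeasure_count_space_finite)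
        finally show ?thesis using True by simp
      next
        case False
        then have "(\<integral>\<^sup>+\<omega>. indicator (\<tau> \<omega> ` E) y * indicator B y \<partial>count_space \<Omega>)
            = (\<integral>\<^sup>+\<omega>. 0 \<partial>count_space \<Omega>)"
          by (intro nn_integral_cong) auto
        then show ?thesis using False by simp
      qed
    qed
    also have "\<dots> = emeasure (density lebesgue (indicator (\<Union>\<omega>\<in>\<Omega>. \<tau> \<omega> ` E))) B"
      using B U by (subst emeasure_density) auto
    finally show "emeasure (distr (lebesgue_on E \<Otimes>\<^sub>M count_space \<Omega>) lebesgue (\<lambda>(r, \<omega>). \<tau> \<omega> r)) B
        = emeasure (density lebesgue (indicator (\<Union>\<omega>\<in>\<Omega>. \<tau> \<omega> ` E))) B" .
  qed simp
qed

lemma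
  fixes h :: "real^'n \<Rightarrow> 'b::{banach, second_countable_topology}"
  assumes h: "integrable lebesgue h"
  shows unfold_AE_integrable: "AE r in lebesgue_on E. integrable (count_space \<Omega>) (\<lambda>\<omega>. h (\<tau> \<omega> r))"
    and unfold_integrable: "integrable (lebesgue_on E) (\<lambda>r. \<integral>\<omega>. h (\<tau> \<omega> r) \<partial>count_space \<Omega>)"
    and unfold_integral: "(\<integral>r. (\<integral>\<omega>. h (\<tau> \<omega> r) \<partial>count_space \<Omega>) \<partial>lebesgue_on E)
      = (\<integral>y. indicator (\<Union>\<omega>\<in>\<Omega>. \<tau> \<omega> ` E) y *\<^sub>R h y \<partial>lebesgue)"
proof -
  interpret E: sigma_finite_measure "lebesgue_on E"
    by (rule sigma_finite_measure_restrict_space[OF sigma_finite_lebesgue E])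
  interpret \<Omega>: sigma_finite_measure "count_space \<Omega>"
    by (rule sigma_finite_measure_count_space_countable[OF \<Omega>])
  interpret pair_sigma_finite "lebesgue_on E" "count_space \<Omega>" ..
  note T = unfold_measurable and U = unfold_measurable_union and D = unfold_distr
  have hm: "h \<in> borel_measurable lebesgue" using h by (rule borel_measurable_integrable)
  have "integrable lebesgue (\<lambda>y. indicator (\<Union>\<omega>\<in>\<Omega>. \<tau> \<omega> ` E) y *\<^sub>R h y)"
    by (rule integrable_mult_indicator[OF U h])
  then have dens: "integrable (density lebesgue (\<lambda>y. ennreal (indicator (\<Union>\<omega>\<in>\<Omega>. \<tau> \<omega> ` E) y))) h"
    using U hm by (subst integrable_density) auto
  then have int: "integrable (lebesgue_on E \<Otimes>\<^sub>M count_space \<Omega>) (\<lambda>(r, \<omega>). h (\<tau> \<omega> r))"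
    using integrable_distr[OF T, of h] unfolding D by (simp add: split_beta' ennreal_indicator)
  show "AE r in lebesgue_on E. integrable (count_space \<Omega>) (\<lambda>\<omega>. h (\<tau> \<omega> r))"
    using AE_integrable_fst'[OF int] by simp
  show "integrable (lebesgue_on E) (\<lambda>r. \<integral>\<omega>. h (\<tau> \<omega> r) \<partial>count_space \<Omega>)"
    using integrable_fst'[OF int] by simp
  have "(\<integral>r. (\<integral>\<omega>. h (\<tau> \<omega> r) \<partial>count_space \<Omega>) \<partial>lebesgue_on E)
      = (\<integral>p. h ((\<lambda>(r, \<omega>). \<tau> \<omega> r) p) \<partial>(lebesgue_on E \<Otimes>\<^sub>M count_space \<Omega>))"
    using integral_fst'[OF int] by (simp add: split_beta')
  also have "\<dots> = (\<integral>y. h y \<partial>density lebesgue (\<lambda>y. ennreal (indicator (\<Union>\<omega>\<in>\<Omega>. \<tau> \<omega> ` E) y)))"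
    using integral_distr[OF T hm] unfolding D by (simp add: ennreal_indicator)
  also have "\<dots> = (\<integral>y. indicator (\<Union>\<omega>\<in>\<Omega>. \<tau> \<omega> ` E) y *\<^sub>R h y \<partial>lebesgue)"
    using U hm by (subst integral_density) auto
  finally show "(\<integral>r. (\<integral>\<omega>. h (\<tau> \<omega> r) \<partial>count_space \<Omega>) \<partial>lebesgue_on E)
      = (\<integral>y. indicator (\<Union>\<omega>\<in>\<Omega>. \<tau> \<omega> ` E) y *\<^sub>R h y \<partial>lebesgue)" .
qed

lemma unfold_nn_integral:
  assumes f: "f \<in> borel_measurable lebesgue"
  shows "(\<integral>\<^sup>+r. (\<integral>\<^sup>+\<omega>. f (\<tau> \<omega> r) \<partial>count_space \<Omega>) \<partial>lebesgue_on E)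
    = (\<integral>\<^sup>+y. indicator (\<Union>\<omega>\<in>\<Omega>. \<tau> \<omega> ` E) y * f y \<partial>lebesgue)"
proof -
  interpret \<Omega>: sigma_finite_measure "count_space \<Omega>"
    by (rule sigma_finite_measure_count_space_countable[OF \<Omega>])
  have m: "(\<lambda>p. f ((\<lambda>(r, \<omega>). \<tau> \<omega> r) p)) \<in> borel_measurable (lebesgue_on E \<Otimes>\<^sub>M count_space \<Omega>)"
    by (rule measurable_compose[OF unfold_measurable f])
  have "(\<integral>\<^sup>+r. (\<integral>\<^sup>+\<omega>. f (\<tau> \<omega> r) \<partial>count_space \<Omega>) \<partial>lebesgue_on E)
      = (\<integral>\<^sup>+p. f ((\<lambda>(r, \<omega>). \<tau> \<omega> r) p) \<partial>(lebesgue_on E \<Otimes>\<^sub>M count_space \<Omega>))"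
    using \<Omega>.nn_integral_fst[OF m] by simp
  also have "\<dots> = (\<integral>\<^sup>+y. f y \<partial>density lebesgue (indicator (\<Union>\<omega>\<in>\<Omega>. \<tau> \<omega> ` E)))"
    unfolding unfold_distr[symmetric] by (subst nn_integral_distr[OF unfold_measurable]) (simp_all add: f)
  also have "\<dots> = (\<integral>\<^sup>+y. indicator (\<Union>\<omega>\<in>\<Omega>. \<tau> \<omega> ` E) y * f y \<partial>lebesgue)"
    using unfold_measurable_union f by (subst nn_integral_density) auto
  finally show ?thesis .
qed

end

section \<open>The group, its lattice and the dual group\<close>

lemma isometry_group_m_inv:
  assumes "orthogonal_matrix L"
  shows "inv\<^bsub>isometry_group\<^esub> (x, L) = (- (L *v x), transpose L)"
  unfolding m_inv_def
proof (rule the_equality)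
  show "(- (L *v x), transpose L) \<in> carrier isometry_group \<and>
      (x, L) \<otimes>\<^bsub>isometry_group\<^esub> (- (L *v x), transpose L) = \<one>\<^bsub>isometry_group\<^esub> \<and>
      (- (L *v x), transpose L) \<otimes>\<^bsub>isometry_group\<^esub> (x, L) = \<one>\<^bsub>isometry_group\<^esub>"
    using assms
    by (simp add: isometry_group_def orthogonal_matrix_inv matrix_vector_neg orthogonal_matrix_cancel
        orthogonal_matrix_def del: transpose_matrix_vector)
next
  fix y :: "(real^'a) \<times> (real^'a^'a)"
  assume y: "y \<in> carrier isometry_group \<and> (x, L) \<otimes>\<^bsub>isometry_group\<^esub> y = \<one>\<^bsub>isometry_group\<^esub> \<and>
      y \<otimes>\<^bsub>isometry_group\<^esub> (x, L) = \<one>\<^bsub>isometry_group\<^esub>"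
  obtain v M where yv: "y = (v, M)" by (cases y)
  have "M ** L = mat 1" and v: "matrix_inv M *v x + v = 0" and M: "orthogonal_matrix M"
    using y by (auto simp: yv isometry_group_def)
  then have "transpose M = L"
    by (metis matrix_mul_assoc matrix_mul_lid matrix_mul_rid orthogonal_matrix_def)
  then show "y = (- (L *v x), transpose L)"
    using v by (auto simp: yv orthogonal_matrix_inv[OF M] eq_neg_iff_add_eq_0 add.commute)
qed

text \<open>The setting of the rest: a group of isometries, with lattice \<open>\<Lambda>\<close>, dual lattice \<open>A\<close> and point
  group \<open>P\<close>, and a fundamental domain \<open>R\<close> of the dual group.\<close>

locale crystallographic_domain =
  fixes \<Gamma> :: "'n::finite affine set" and R :: "(real^'n) set"
  assumes subgroup: "subgroup \<Gamma> isometry_group"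
    and domain: "fundamental_domain (dual_group \<Gamma>) R"
begin

abbreviation \<Lambda> where "\<Lambda> \<equiv> lattice \<Gamma>"
abbreviation A where "A \<equiv> dual_lattice \<Gamma>"
abbreviation P where "P \<equiv> point_group \<Gamma>"

lemma group_orthogonal: "(x, L) \<in> \<Gamma> \<Longrightarrow> orthogonal_matrix L"
  using subgroup.subset[OF subgroup] by (auto simp: isometry_group_def)

lemma group_orthogonal': "g \<in> \<Gamma> \<Longrightarrow> orthogonal_matrix (snd g)"
  by (cases g) (simp add: group_orthogonal)

lemma group_one: "(0, mat 1) \<in> \<Gamma>"
  using subgroup.one_closed[OF subgroup] by (simp add: isometry_group_def)

lemma group_mult: "(x, L) \<in> \<Gamma> \<Longrightarrow> (y, M) \<in> \<Gamma> \<Longrightarrow> (transpose M *v x + y, L ** M) \<in> \<Gamma>"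
  using subgroup.m_closed[OF subgroup, of "(x, L)" "(y, M)"]
  by (simp add: isometry_group_def orthogonal_matrix_inv[OF group_orthogonal] del: transpose_matrix_vector)

lemma group_inv: "(x, L) \<in> \<Gamma> \<Longrightarrow> (- (L *v x), transpose L) \<in> \<Gamma>"
  using subgroup.m_inv_closed[OF subgroup, of "(x, L)"]
  by (simp add: isometry_group_m_inv[OF group_orthogonal])

lemma point_group_orthogonal: "M \<in> P \<Longrightarrow> orthogonal_matrix M"
  using group_orthogonal by (auto simp: point_group_def)

lemma point_group_one: "mat 1 \<in> P"
  using group_one by (auto simp: point_group_def)

lemma point_group_transpose: "M \<in> P \<Longrightarrow> transpose M \<in> P"
  using group_inv by (auto simp: point_group_def)

lemma lattice_zero: "0 \<in> \<Lambda>"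
  using group_one by (simp add: lattice_def)

lemma lattice_add: "x \<in> \<Lambda> \<Longrightarrow> y \<in> \<Lambda> \<Longrightarrow> x + y \<in> \<Lambda>"
  using group_mult[of x "mat 1" y "mat 1"] by (simp add: lattice_def transpose_mat)

lemma lattice_minus: "x \<in> \<Lambda> \<Longrightarrow> - x \<in> \<Lambda>"
  using group_inv[of x "mat 1"] by (simp add: lattice_def transpose_mat)

lemma dual_lattice_zero: "0 \<in> A"
  by (simp add: dual_lattice_def)

lemma dual_lattice_chi: "z \<in> A \<Longrightarrow> x \<in> \<Lambda> \<Longrightarrow> chi z x = 1"
  by (simp add: chi_eq_1_iff dual_lattice_def inner_commute)

lemma dual_group_eq: "dual_group \<Gamma> = A \<times> P"
  by (auto simp: dual_group_def)

lemma
  shows domain_open: "open R" and domain_convex: "convex R"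
    and domain_disjoint: "disjoint_family_on (\<lambda>g. aff_act g ` R) (A \<times> P)"
    and domain_cover: "(\<Union>g\<in>A \<times> P. aff_act g ` closure R) = UNIV"
  using domain by (auto simp: fundamental_domain_def dual_group_eq)

lemma domain_sets [simp, measurable]: "R \<in> sets lebesgue"
  using domain_open by (simp add: borel_open)

lemma domain_nonempty: "R \<noteq> {}"
  using domain_cover by auto

lemma domain_images_disjoint:
  assumes "z \<in> A" "M \<in> P" "z' \<in> A" "M' \<in> P" "r \<in> R" "r' \<in> R"
    and eq: "M *v (r + z) = M' *v (r' + z')"
  shows "z = z'" "M = M'"
proof -
  have "(z, M) = (z', M')"
  proof (rule ccontr)
    assume "(z, M) \<noteq> (z', M')"
    then have "aff_act (z, M) ` R \<inter> aff_act (z', M') ` R = {}"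
      using disjoint_family_onD[OF domain_disjoint] assms(1-4) by auto
    moreover have "M *v (r + z) \<in> aff_act (z, M) ` R" "M' *v (r' + z') \<in> aff_act (z', M') ` R"
      using assms(5,6) by (simp_all add: aff_act_def image_iff) blast+
    ultimately show False using eq by auto
  qed
  then show "z = z'" "M = M'" by auto
qed

text \<open>The images of \<open>R\<close> are disjoint nonempty open sets, of which a separable space holds only
  countably many. So sums over the dual lattice and the point group are countable sums, and almost
  everywhere statements may be combined over them.\<close>

lemma countable_dual_group: "countable (A \<times> P)"
proof -
  have op: "open (aff_act g ` R)" if "g \<in> A \<times> P" for g
  proof -
    obtain z M where g: "g = (z, M)" "M \<in> P" using \<open>g \<in> A \<times> P\<close> by auto
    note M = point_group_orthogonal[OF g(2)]
    have "aff_act g ` R = (\<lambda>y. transpose M *v y - z) -` R"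
    proof (intro equalityI subsetI)
      fix y assume "y \<in> (\<lambda>y. transpose M *v y - z) -` R"
      moreover have "y = aff_act g (transpose M *v y - z)"
        by (simp add: g aff_act_def orthogonal_matrix_cancel[OF M] del: transpose_matrix_vector)
      ultimately show "y \<in> aff_act g ` R" by blast
    qed (auto simp: g aff_act_def orthogonal_matrix_cancel[OF M] simp del: transpose_matrix_vector)
    moreover have "continuous_on UNIV (\<lambda>y. transpose M *v y - z)"
      by (intro continuous_intros matrix_vector_mult_linear_continuous_on)
    ultimately show ?thesis
      using domain_open by (simp add: open_vimage)
  qed
  have inj: "inj_on (\<lambda>g. aff_act g ` R) (A \<times> P)"
  proof (rule inj_onI, rule ccontr)
    fix g h assume "g \<in> A \<times> P" "h \<in> A \<times> P" and eq: "aff_act g ` R = aff_act h ` R" and "g \<noteq> h"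
    then have "aff_act g ` R \<inter> aff_act h ` R = {}"
      by (intro disjoint_family_onD[OF domain_disjoint])
    then show False using eq domain_nonempty by simp
  qed
  have "countable ((\<lambda>g. aff_act g ` R) ` (A \<times> P))"
  proof (rule countable_disjoint_open_subsets)
    show "disjoint ((\<lambda>g. aff_act g ` R) ` (A \<times> P))"
      using domain_disjoint by (rule disjoint_family_on_disjoint_image)
  qed (use op in auto)
  then show ?thesis by (rule countable_image_inj_on[OF _ inj])
qed

lemma countable_dual_lattice: "countable A"
proof -
  have "A = fst ` (A \<times> P)" using point_group_one by auto
  then show ?thesis using countable_dual_group by (metis countable_image)
qed

lemma countable_point_group: "countable P"
proof -
  have "P = snd ` (A \<times> P)" using dual_lattice_zero by auto
  then show ?thesis using countable_dual_group by (metis countable_image)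
qed

text \<open>The images of the closure of \<open>R\<close> cover the space and the boundary of a convex set is null.\<close>

lemma domain_images_conull: "AE y in lebesgue. \<exists>z\<in>A. \<exists>M\<in>P. \<exists>r\<in>R. y = M *v (r + z)"
proof -
  have "negligible (frontier R)" by (rule negligible_convex_frontier[OF domain_convex])
  then have fr: "AE y in lebesgue. y \<notin> frontier R"
    by (simp add: AE_not_in negligible_iff_null_sets)
  have "AE y in lebesgue. \<forall>g\<in>A \<times> P. transpose (snd g) *v (y + - (snd g *v fst g)) \<notin> frontier R"
    unfolding AE_ball_countable[OF countable_dual_group]
  proof
    fix g assume "g \<in> A \<times> P"
    then have "orthogonal_matrix (snd g)" by (auto intro: point_group_orthogonal)
    then show "AE y in lebesgue. transpose (snd g) *v (y + - (snd g *v fst g)) \<notin> frontier R"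
      by (intro AE_lebesgue_isometry[OF _ fr] orthogonal_matrix_transpose')
  qed
  then show ?thesis
  proof eventually_elim
    case (elim y)
    obtain z M c where zM: "z \<in> A" "M \<in> P" and c: "c \<in> closure R" "y = M *v (c + z)"
    proof -
      have "y \<in> (\<Union>g\<in>A \<times> P. aff_act g ` closure R)" using domain_cover by simp
      then show thesis using that by (auto simp: aff_act_def)
    qed
    note M = point_group_orthogonal[OF zM(2)]
    have "transpose M *v (y + - (M *v z)) = c"
      by (simp add: c(2) matrix_vector_right_distrib orthogonal_matrix_cancel[OF M] matrix_vector_neg del: transpose_matrix_vector)
    then have "c \<notin> frontier R"
      using bspec[OF elim, of "(z, M)"] zM by (simp del: transpose_matrix_vector)
    then have "c \<in> R"
      using c(1) domain_open by (auto simp: frontier_def interior_open)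
    with zM c(2) show ?case by blast
  qed
qed

end

section \<open>Square-summable functions\<close>

lemma closed_count_space_cong:
  assumes "closed_L2_subspace (count_space \<Omega>) K" "f \<in> K" "\<And>z. z \<in> \<Omega> \<Longrightarrow> f z = g z"
  shows "g \<in> K"
proof (rule closed_L2_subspace_AE[OF assms(1,2)])
  show "g \<in> L2 (count_space \<Omega>)"
    using closed_L2_subspaceD(1)[OF assms(1)] assms(2,3) L2_cong[of "count_space \<Omega>" f g] by auto
  show "AE z in count_space \<Omega>. f z = g z"
    using assms(3) by (simp add: AE_count_space)
qed

lemma closed_count_space_cong_scale:
  assumes "closed_L2_subspace (count_space \<Omega>) K" "c \<noteq> 0" "\<And>z. z \<in> \<Omega> \<Longrightarrow> g z = c * f z"
  shows "g \<in> K \<longleftrightarrow> f \<in> K"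
proof
  assume "g \<in> K"
  then show "f \<in> K"
    by (rule closed_count_space_cong[OF assms(1) closed_L2_subspaceD(4)[OF assms(1), of g "1/c"]])
       (simp_all add: assms(2,3))
next
  assume "f \<in> K"
  then show "g \<in> K"
    by (rule closed_count_space_cong[OF assms(1) closed_L2_subspaceD(4)[OF assms(1), of f c]])
       (simp_all add: assms(3))
qed

lemma L2_inner_delta:
  assumes "\<omega> \<in> \<Omega>"
  shows "L2_inner (count_space \<Omega>) f (delta \<omega>) = f \<omega>"
proof -
  have "L2_inner (count_space \<Omega>) f (delta \<omega>) = (\<Sum>x | x \<in> \<Omega> \<and> f x * cnj (delta \<omega> x) \<noteq> 0. f x * cnj (delta \<omega> x))"
    unfolding L2_inner_def
    by (rule lebesgue_integral_count_space_finite_support)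
       (auto simp: delta_def intro!: finite_subset[of _ "{\<omega>}"] split: if_splits)
  also have "\<dots> = (\<Sum>x\<in>{\<omega>}. f x * cnj (delta \<omega> x))"
    using assms by (intro sum.mono_neutral_left) (auto simp: delta_def split: if_splits)
  finally show ?thesis by (simp add: delta_def)
qed

lemma delta_L2: "delta \<omega> \<in> L2 (count_space \<Omega>)"
proof (rule L2I)
  have "integrable (count_space \<Omega>) (\<lambda>x. (cmod (delta \<omega> x))\<^sup>2) \<longleftrightarrow>
      integrable (count_space (\<Omega> \<inter> {\<omega>})) (\<lambda>x. (cmod (delta \<omega> x))\<^sup>2)"
    by (rule abs_summable_on_cong_neutral[unfolded abs_summable_on_def]) (auto simp: delta_def)
  then show "integrable (count_space \<Omega>) (\<lambda>x. (cmod (delta \<omega> x))\<^sup>2)"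
    by (simp add: integrable_count_space)
qed simp

lemma L2_inner_delta_left:
  assumes "\<omega> \<in> \<Omega>"
  shows "L2_inner (count_space \<Omega>) (delta \<omega>) f = cnj (f \<omega>)"
  using L2_inner_delta[OF assms, of f] L2_inner_commute[of "count_space \<Omega>" "delta \<omega>" f] by simp

lemma tensor_delta: "tensor (delta x) (delta y) = delta (x, y)"
  by (auto simp: tensor_def delta_def fun_eq_iff)

lemma
  assumes G: "G \<in> L2 (count_space (P \<times> A))" and M: "M \<in> P"
  shows L2_slice: "(\<lambda>z. G (M, z)) \<in> L2 (count_space A)"
    and sqnorm_slice_le: "sqnorm (count_space A) (\<lambda>z. G (M, z)) \<le> sqnorm (count_space (P \<times> A)) G"
proof -
  have sum: "Infinite_Set_Sum.abs_summable_on (\<lambda>p. (cmod (G p))\<^sup>2) (P \<times> A)"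
    using L2_integrable[OF G] by (simp add: abs_summable_on_def)
  have inj: "inj_on (Pair M) A" by (simp add: inj_on_def)
  have sub: "Pair M ` A \<subseteq> P \<times> A" using M by auto
  have s1: "Infinite_Set_Sum.abs_summable_on (\<lambda>p. (cmod (G p))\<^sup>2) (Pair M ` A)"
    by (rule abs_summable_on_subset[OF sum sub])
  then have "Infinite_Set_Sum.abs_summable_on (\<lambda>z. (cmod (G (M, z)))\<^sup>2) A"
    using abs_summable_on_reindex_iff[OF inj, of "\<lambda>p. (cmod (G p))\<^sup>2"] by simp
  then show "(\<lambda>z. G (M, z)) \<in> L2 (count_space A)"
    by (intro L2I) (simp_all add: abs_summable_on_def)
  have "(\<Sum>\<^sub>az\<in>A. (cmod (G (M, z)))\<^sup>2) = (\<Sum>\<^sub>ap\<in>Pair M ` A. (cmod (G p))\<^sup>2)"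
    using infsetsum_reindex[OF inj, of "\<lambda>p. (cmod (G p))\<^sup>2"] by simp
  also have "\<dots> \<le> (\<Sum>\<^sub>ap\<in>P \<times> A. (cmod (G p))\<^sup>2)"
    by (rule infsetsum_mono_neutral_left[OF s1 sum]) (use sub in auto)
  finally show "sqnorm (count_space A) (\<lambda>z. G (M, z)) \<le> sqnorm (count_space (P \<times> A)) G"
    by (simp add: sqnorm_def infsetsum_def)
qed

lemma tensor_L2:
  assumes "countable P" "countable A" "a \<in> L2 (count_space P)" "b \<in> L2 (count_space A)"
  shows "tensor a b \<in> L2 (count_space (P \<times> A))"
proof (rule L2I)
  have "Infinite_Set_Sum.abs_summable_on (\<lambda>(x, y). (cmod (a x))\<^sup>2 * (cmod (b y))\<^sup>2) (P \<times> A)"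
    using assms(3,4)[THEN L2_integrable]
    by (intro abs_summable_on_product assms(1,2)) (simp_all add: abs_summable_on_def)
  then show "integrable (count_space (P \<times> A)) (\<lambda>p. (cmod (tensor a b p))\<^sup>2)"
    by (simp add: abs_summable_on_def tensor_def split_beta' norm_mult power_mult_distrib)
qed simp

text \<open>In \<open>l\<^sup>2(P) \<otimes> K\<close> the first factor is the whole space, so membership is a condition on each slice
  separately; conversely \<open>G\<close> is the sum of the elementary tensors of \<open>\<delta>\<^sub>M\<close> with its slices.\<close>

lemma l2_tensor_iff_slices:
  assumes P: "countable P" and A: "countable A" and K: "closed_L2_subspace (count_space A) K"
  shows "G \<in> l2_tensor P A (L2 (count_space P)) K \<longleftrightarrow>
    G \<in> L2 (count_space (P \<times> A)) \<and> (\<forall>M\<in>P. (\<lambda>z. G (M, z)) \<in> K)"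
proof
  define W where "W = {G \<in> L2 (count_space (P \<times> A)). \<forall>M\<in>P. (\<lambda>z. G (M, z)) \<in> K}"
  have "closed_L2_subspace (count_space (P \<times> A)) W"
  proof (rule closed_L2_subspaceI)
    fix s F assume s: "\<And>k. s k \<in> W" and lim: "L2_tendsto (count_space (P \<times> A)) s F"
    have F: "F \<in> L2 (count_space (P \<times> A))" and s_L2: "\<And>k. s k \<in> L2 (count_space (P \<times> A))"
      and lim0: "(\<lambda>k. sqnorm (count_space (P \<times> A)) (\<lambda>p. s k p - F p)) \<longlonglongrightarrow> 0"
      using lim by (auto simp: L2_tendsto_iff)
    have "(\<lambda>z. F (M, z)) \<in> K" if M: "M \<in> P" for M
    proof (rule closed_L2_subspaceD(5)[OF K])
      show "(\<lambda>z. s k (M, z)) \<in> K" for k using s M by (auto simp: W_def)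
      have "(\<lambda>k. sqnorm (count_space A) (\<lambda>z. s k (M, z) - F (M, z))) \<longlonglongrightarrow> 0"
        by (rule sqnorm_tendsto_0[OF sqnorm_slice_le[OF L2_diff[OF s_L2 F] M] lim0])
      then show "L2_tendsto (count_space A) (\<lambda>k z. s k (M, z)) (\<lambda>z. F (M, z))"
        using L2_slice[OF s_L2 M] L2_slice[OF F M] by (simp add: L2_tendsto_iff)
    qed
    with F show "F \<in> W" by (simp add: W_def)
  qed (auto simp: W_def L2_zero L2_add L2_scale closed_L2_subspaceD[OF K])
  moreover have "tensor a b \<in> W" if "a \<in> L2 (count_space P)" "b \<in> K" for a b
    using that closed_L2_subspaceD(1,4)[OF K] by (auto simp: W_def tensor_L2[OF P A]) (simp add: tensor_def)
  moreover assume "G \<in> l2_tensor P A (L2 (count_space P)) K"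
  ultimately have "G \<in> W" unfolding l2_tensor_def by blast
  then show "G \<in> L2 (count_space (P \<times> A)) \<and> (\<forall>M\<in>P. (\<lambda>z. G (M, z)) \<in> K)" by (simp add: W_def)
next
  assume G: "G \<in> L2 (count_space (P \<times> A)) \<and> (\<forall>M\<in>P. (\<lambda>z. G (M, z)) \<in> K)"
  show "G \<in> l2_tensor P A (L2 (count_space P)) K"
    unfolding l2_tensor_def
  proof (intro InterI, elim CollectE conjE)
    fix W assume W: "closed_L2_subspace (count_space (P \<times> A)) W"
      and tens: "\<forall>a\<in>L2 (count_space P). \<forall>b\<in>K. tensor a b \<in> W"
    define part where "part F p = (if fst p \<in> F then G p else 0)" for F p
    have part_W: "part F \<in> W" if "finite F" "F \<subseteq> P" for F
      using that
    proof (induction F)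
      case empty
      then show ?case using closed_L2_subspaceD(2)[OF W] by (simp add: part_def[abs_def])
    next
      case (insert M F)
      have "part (insert M F) = (\<lambda>p. part F p + tensor (delta M) (\<lambda>z. G (M, z)) p)"
        using insert.hyps by (auto simp: fun_eq_iff part_def tensor_def delta_def)
      then show ?case
        using insert.IH insert.prems G tens delta_L2[of M P]
        by (simp add: closed_L2_subspaceD(3)[OF W])
    qed
    show "G \<in> W"
    proof (cases "P = {}")
      case True
      then show ?thesis
        using closed_count_space_cong[OF W closed_L2_subspaceD(2)[OF W], of G] by simp
    next
      case False
      define F where "F k = from_nat_into P ` {..<k}" for k :: nat
      have F: "finite (F k)" "F k \<subseteq> P" for k
        using from_nat_into[OF False] by (auto simp: F_def)
      have exhaust: "\<forall>\<^sub>F k in sequentially. M \<in> F k" if M: "M \<in> P" for M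
      proof -
        obtain i where i: "from_nat_into P i = M"
          using from_nat_into_surj[OF P M] by blast
        then have "M \<in> F k" if "k > i" for k
          unfolding F_def using that by (intro image_eqI[of _ _ i]) simp_all
        then show ?thesis by (meson eventually_gt_at_top eventually_mono)
      qed
      have part_L2: "part (F k) \<in> L2 (count_space (P \<times> A))" for k
        using closed_L2_subspaceD(1)[OF W] part_W[OF F] by auto
      have "(\<lambda>k. sqnorm (count_space (P \<times> A)) (\<lambda>p. part (F k) p - G p))
          \<longlonglongrightarrow> (\<integral>p. 0 \<partial>count_space (P \<times> A))"
        unfolding sqnorm_def
      proof (rule integral_dominated_convergence[where w = "\<lambda>p. (cmod (G p))\<^sup>2"])
        show "integrable (count_space (P \<times> A)) (\<lambda>p. (cmod (G p))\<^sup>2)"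
          using G L2_integrable by blast
        show "AE p in count_space (P \<times> A). (\<lambda>k. (cmod (part (F k) p - G p))\<^sup>2) \<longlonglongrightarrow> 0"
        proof (simp only: AE_count_space, intro ballI)
          fix p assume "p \<in> P \<times> A"
          then have "\<forall>\<^sub>F k in sequentially. fst p \<in> F k" by (intro exhaust) auto
          then have "\<forall>\<^sub>F k in sequentially. (cmod (part (F k) p - G p))\<^sup>2 = 0"
            by eventually_elim (simp add: part_def)
          then show "(\<lambda>k. (cmod (part (F k) p - G p))\<^sup>2) \<longlonglongrightarrow> 0" by (rule tendsto_eventually)
        qed
        show "AE p in count_space (P \<times> A). norm ((cmod (part (F k) p - G p))\<^sup>2) \<le> (cmod (G p))\<^sup>2" for k
          by (auto simp: part_def AE_count_space)
      qed simp_all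
      then have "L2_tendsto (count_space (P \<times> A)) (\<lambda>k. part (F k)) G"
        using part_L2 G by (simp add: L2_tendsto_iff)
      then show "G \<in> W" by (rule closed_L2_subspaceD(5)[OF W part_W[OF F]])
    qed
  qed
qed

lemma sqnorm_count_space_zero_iff:
  assumes "f \<in> L2 (count_space \<Omega>)"
  shows "sqnorm (count_space \<Omega>) f = 0 \<longleftrightarrow> (\<forall>z\<in>\<Omega>. f z = 0)"
  using sqnorm_zero_iff[OF assms] by (simp add: AE_count_space)

text \<open>A closed subspace is determined by the projections of the basis vectors: a vector of \<open>K\<close>
  orthogonal to all of them has vanishing coordinates.\<close>

lemma closed_subspace_le_if_proj_delta:
  assumes K: "closed_L2_subspace (count_space \<Omega>) K" and K': "closed_L2_subspace (count_space \<Omega>) K'"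
    and proj: "\<And>z. z \<in> \<Omega> \<Longrightarrow> L2_proj (count_space \<Omega>) K (delta z) \<in> K'"
  shows "K \<subseteq> K'"
proof
  fix v assume v: "v \<in> K"
  define I where "I = K \<inter> K'"
  have I: "closed_L2_subspace (count_space \<Omega>) I"
    using closed_L2_subspace_Inter[of "{K, K'}"] K K' by (auto simp: I_def)
  have vL2: "v \<in> L2 (count_space \<Omega>)" using v closed_L2_subspaceD(1)[OF K] by blast
  define q where "q x = v x - L2_proj (count_space \<Omega>) I v x" for x
  have pI: "L2_proj (count_space \<Omega>) I v \<in> I" by (rule L2_proj(1)[OF I vL2])
  have qK: "q \<in> K"
    unfolding q_def using pI by (intro closed_L2_subspace_diff[OF K v]) (simp add: I_def)
  have q0: "q z = 0" if z: "z \<in> \<Omega>" for z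
  proof -
    have "q z = L2_inner (count_space \<Omega>) q (delta z)" by (simp add: L2_inner_delta[OF z])
    also have "\<dots> = L2_inner (count_space \<Omega>) q (L2_proj (count_space \<Omega>) K (delta z))"
      using L2_proj_inner[OF K delta_L2 qK] by (metis L2_inner_commute)
    also have "\<dots> = 0"
      unfolding q_def using proj[OF z] L2_proj(1)[OF K delta_L2, of z]
      by (intro L2_proj(2)[OF I vL2]) (simp add: I_def)
    finally show ?thesis .
  qed
  have "v \<in> I"
    by (rule closed_count_space_cong[OF I pI]) (use q0 in \<open>simp add: q_def\<close>)
  then show "v \<in> K'" by (simp add: I_def)
qed

section \<open>Range functions and invariant subspaces\<close>

definition fibre :: "(real^'n::finite \<Rightarrow> complex) \<Rightarrow> real^'n \<Rightarrow> real^'n \<Rightarrow> complex" where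
  "fibre \<phi> r = (\<lambda>z. \<phi> (r + z))"

context crystallographic_domain
begin

lemma AE_in_domain: "AE r in lebesgue_on R. r \<in> R"
  using AE_space[of "lebesgue_on R"] by simp

lemma translates_tile:
  assumes "E \<in> sets lebesgue" "E \<subseteq> R"
  shows "disjoint_isometric_images (\<lambda>z u. u + z) A E"
proof
  show "\<exists>M x. orthogonal_matrix M \<and> (\<lambda>u. u + z) = (\<lambda>u. M *v (u + x))" for z :: "real^'n"
    by (intro exI[of _ "mat 1"] exI[of _ z]) (simp add: orthogonal_matrix_id)
  show "z = z'" if "z \<in> A" "z' \<in> A" "r \<in> E" "r' \<in> E" "r + z = r' + z'" for z z' r r'
    by (rule domain_images_disjoint(1)[of z "mat 1" z' "mat 1" r r'])
       (use that assms(2) in \<open>auto simp: point_group_one\<close>)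
qed (fact countable_dual_lattice, fact assms(1))

lemma dual_group_tiles:
  "disjoint_isometric_images (\<lambda>(M, z) u. M *v (u + z)) (P \<times> A) R"
proof
  show "countable (P \<times> A)"
    using countable_point_group countable_dual_lattice by blast
  show "\<exists>M x. orthogonal_matrix M \<and> (case p of (M, z) \<Rightarrow> \<lambda>u. M *v (u + z)) = (\<lambda>u. M *v (u + x))"
    if "p \<in> P \<times> A" for p
    using that by (cases p) (auto intro: point_group_orthogonal)
  show "p = p'" if "p \<in> P \<times> A" "p' \<in> P \<times> A" "r \<in> R" "r' \<in> R"
      "(case p of (M, z) \<Rightarrow> \<lambda>u. M *v (u + z)) r = (case p' of (M, z) \<Rightarrow> \<lambda>u. M *v (u + z)) r'" for p p' r r'
    using that domain_images_disjoint by (cases p; cases p') auto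
qed simp

definition orbit :: "(real^'n) set \<Rightarrow> (real^'n) set" where
  "orbit E = (\<Union>z\<in>A. (+) z ` E)"

lemma orbit_eq: "orbit E = (\<Union>z\<in>A. (\<lambda>u. u + z) ` E)"
  unfolding orbit_def by (simp add: add.commute)

lemma orbit_sets: "E \<in> sets lebesgue \<Longrightarrow> orbit E \<in> sets lebesgue"
  unfolding orbit_def by (rule lebesgue_measurable_translates[OF countable_dual_lattice])

lemma fibre_L2_AE:
  assumes "\<phi> \<in> L2 lebesgue"
  shows "AE r in lebesgue_on R. fibre \<phi> r \<in> L2 (count_space A)"
  using disjoint_isometric_images.unfold_AE_integrable[OF translates_tile[OF domain_sets order_refl] L2_integrable[OF assms]]
  by eventually_elim (auto intro: L2I simp: fibre_def)

lemma
  assumes "\<phi> \<in> L2 lebesgue" "\<psi> \<in> L2 lebesgue" and E: "E \<in> sets lebesgue" "E \<subseteq> R"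
  shows fibre_inner_integrable:
      "integrable (lebesgue_on E) (\<lambda>r. L2_inner (count_space A) (fibre \<phi> r) (fibre \<psi> r))"
    and fibre_inner_integral:
      "(\<integral>r. L2_inner (count_space A) (fibre \<phi> r) (fibre \<psi> r) \<partial>lebesgue_on E)
        = (\<integral>y. (\<phi> y * cnj (\<psi> y)) * indicator (orbit E) y \<partial>lebesgue)"
  using disjoint_isometric_images.unfold_integrable[OF translates_tile[OF E] L2_inner_integrable[OF assms(1,2)]]
    disjoint_isometric_images.unfold_integral[OF translates_tile[OF E] L2_inner_integrable[OF assms(1,2)]]
  by (simp_all add: L2_inner_def fibre_def orbit_eq scaleR_conv_of_real of_real_indicator mult.commute)

lemma
  assumes \<phi>: "\<phi> \<in> L2 lebesgue"
  shows fibre_sqnorm_integrable: "integrable (lebesgue_on R) (\<lambda>r. sqnorm (count_space A) (fibre \<phi> r))"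
    and fibre_sqnorm_integral_le: "(\<integral>r. sqnorm (count_space A) (fibre \<phi> r) \<partial>lebesgue_on R) \<le> sqnorm lebesgue \<phi>"
proof -
  note tile = translates_tile[OF domain_sets order_refl]
  show "integrable (lebesgue_on R) (\<lambda>r. sqnorm (count_space A) (fibre \<phi> r))"
    using disjoint_isometric_images.unfold_integrable[OF tile L2_integrable[OF \<phi>]]
    by (simp add: sqnorm_def fibre_def)
  have "(\<integral>r. sqnorm (count_space A) (fibre \<phi> r) \<partial>lebesgue_on R)
      = (\<integral>y. indicator (orbit R) y *\<^sub>R (cmod (\<phi> y))\<^sup>2 \<partial>lebesgue)"
    using disjoint_isometric_images.unfold_integral[OF tile L2_integrable[OF \<phi>]]
    by (simp add: sqnorm_def fibre_def orbit_eq)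
  also have "\<dots> \<le> sqnorm lebesgue \<phi>"
    unfolding sqnorm_def
    by (intro integral_mono integrable_mult_indicator orbit_sets domain_sets L2_integrable[OF \<phi>])
       (auto simp: indicator_def)
  finally show "(\<integral>r. sqnorm (count_space A) (fibre \<phi> r) \<partial>lebesgue_on R) \<le> sqnorm lebesgue \<phi>" .
qed

definition fibre_space :: "(real^'n \<Rightarrow> (real^'n \<Rightarrow> complex) set) \<Rightarrow> (real^'n \<Rightarrow> complex) set" where
  "fibre_space K = {\<phi> \<in> L2 lebesgue. AE r in lebesgue_on R. fibre \<phi> r \<in> K r}"

text \<open>The squared norms of the fibres integrate to at most the squared norm of the function. So along
  a subsequence of a convergent sequence the fibres converge almost everywhere.\<close>

lemma fibre_space_closed:
  assumes K: "\<And>r. r \<in> R \<Longrightarrow> closed_L2_subspace (count_space A) (K r)"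
  shows "closed_L2_subspace lebesgue (fibre_space K)"
proof (rule closed_L2_subspaceI)
  show "(\<lambda>_. 0) \<in> fibre_space K"
    using AE_in_domain closed_L2_subspaceD(2)[OF K]
    by (auto simp: fibre_space_def fibre_def L2_zero elim: eventually_mono)
  show "(\<lambda>x. f x + g x) \<in> fibre_space K" if "f \<in> fibre_space K" "g \<in> fibre_space K" for f g
  proof -
    have "AE r in lebesgue_on R. fibre f r \<in> K r" "AE r in lebesgue_on R. fibre g r \<in> K r"
      using that by (auto simp: fibre_space_def)
    with AE_in_domain have "AE r in lebesgue_on R. fibre (\<lambda>x. f x + g x) r \<in> K r"
      by eventually_elim (use closed_L2_subspaceD(3)[OF K] in \<open>simp add: fibre_def\<close>)
    with that show ?thesis by (auto simp: fibre_space_def L2_add)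
  qed
  show "(\<lambda>x. c * f x) \<in> fibre_space K" if "f \<in> fibre_space K" for c f
  proof -
    have "AE r in lebesgue_on R. fibre f r \<in> K r" using that by (auto simp: fibre_space_def)
    with AE_in_domain have "AE r in lebesgue_on R. fibre (\<lambda>x. c * f x) r \<in> K r"
      by eventually_elim (use closed_L2_subspaceD(4)[OF K] in \<open>simp add: fibre_def\<close>)
    with that show ?thesis by (auto simp: fibre_space_def L2_scale)
  qed
  fix s \<phi> assume s: "\<And>k. s k \<in> fibre_space K" and lim: "L2_tendsto lebesgue s \<phi>"
  have L2: "\<And>k. s k \<in> L2 lebesgue" "\<phi> \<in> L2 lebesgue"
    and lim0: "(\<lambda>k. sqnorm lebesgue (\<lambda>x. s k x - \<phi> x)) \<longlonglongrightarrow> 0"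
    using lim by (auto simp: L2_tendsto_iff)
  define d where "d k r = sqnorm (count_space A) (fibre (\<lambda>x. s k x - \<phi> x) r)" for k r
  have d: "integrable (lebesgue_on R) (d k)" "(\<integral>r. d k r \<partial>lebesgue_on R) \<le> sqnorm lebesgue (\<lambda>x. s k x - \<phi> x)" for k
    unfolding d_def by (intro fibre_sqnorm_integrable fibre_sqnorm_integral_le L2_diff L2)+
  have "(\<lambda>k. \<integral>r. d k r \<partial>lebesgue_on R) \<longlonglongrightarrow> 0"
    by (rule tendsto_sandwich[OF _ _ tendsto_const lim0])
       (use d(2) in \<open>auto simp: d_def sqnorm_nonneg intro!: always_eventually Bochner_Integration.integral_nonneg\<close>)
  then have "(\<lambda>k. \<integral>r. norm (d k r) \<partial>lebesgue_on R) \<longlonglongrightarrow> 0"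
    by (simp add: d_def sqnorm_nonneg)
  then obtain \<rho> where \<rho>: "AE r in lebesgue_on R. (\<lambda>k. d (\<rho> k) r) \<longlonglongrightarrow> 0"
    using tendsto_L1_AE_subseq[of "lebesgue_on R" d, OF d(1)] by blast
  have "AE r in lebesgue_on R. \<forall>k. fibre (s k) r \<in> K r"
    using s by (simp add: AE_all_countable fibre_space_def)
  moreover have "AE r in lebesgue_on R. fibre \<phi> r \<in> L2 (count_space A)"
    by (rule fibre_L2_AE[OF L2(2)])
  ultimately have "AE r in lebesgue_on R. fibre \<phi> r \<in> K r"
    using \<rho> AE_in_domain
  proof eventually_elim
    case (elim r)
    note Kr = K[OF elim(4)]
    have mem: "fibre (s (\<rho> k)) r \<in> K r" for k using elim(1) by blast
    then have "fibre (s (\<rho> k)) r \<in> L2 (count_space A)" for k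
      using subsetD[OF closed_L2_subspaceD(1)[OF Kr]] by blast
    then have "L2_tendsto (count_space A) (\<lambda>k. fibre (s (\<rho> k)) r) (fibre \<phi> r)"
      using elim(2,3) by (simp add: L2_tendsto_iff d_def fibre_def)
    then show ?case
      by (rule closed_L2_subspaceD(5)[OF Kr mem])
  qed
  with L2(2) show "\<phi> \<in> fibre_space K" by (simp add: fibre_space_def)
qed (auto simp: fibre_space_def)

text \<open>The largest subspace of \<open>fibre_space K\<close> that is invariant under the dual representation. It
  describes the condition on all \<open>M \<in> P\<close> in \<open>range_space\<close> without the choice of a cross-section.\<close>

definition invariant_fibre_space :: "(real^'n \<Rightarrow> (real^'n \<Rightarrow> complex) set) \<Rightarrow> (real^'n \<Rightarrow> complex) set" where
  "invariant_fibre_space K = {\<phi> \<in> L2 lebesgue. \<forall>g\<in>\<Gamma>. dual_rep g \<phi> \<in> fibre_space K}"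

lemma invariant_fibre_space_closed:
  assumes K: "\<And>r. r \<in> R \<Longrightarrow> closed_L2_subspace (count_space A) (K r)"
  shows "closed_L2_subspace lebesgue (invariant_fibre_space K)"
proof (rule closed_L2_subspaceI)
  note W = fibre_space_closed[OF K]
  have lin: "dual_rep g (\<lambda>_. 0) = (\<lambda>_. 0)"
      "dual_rep g (\<lambda>x. f x + f' x) = (\<lambda>x. dual_rep g f x + dual_rep g f' x)"
      "dual_rep g (\<lambda>x. c * f x) = (\<lambda>x. c * dual_rep g f x)"
    for g and f f' :: "real^'n \<Rightarrow> complex" and c
    by (simp_all add: dual_rep_def fun_eq_iff algebra_simps)
  show "(\<lambda>_. 0) \<in> invariant_fibre_space K"
    "\<And>f f'. f \<in> invariant_fibre_space K \<Longrightarrow> f' \<in> invariant_fibre_space K \<Longrightarrow> (\<lambda>x. f x + f' x) \<in> invariant_fibre_space K"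
    "\<And>c f. f \<in> invariant_fibre_space K \<Longrightarrow> (\<lambda>x. c * f x) \<in> invariant_fibre_space K"
    using closed_L2_subspaceD(2-4)[OF W]
    by (auto simp: invariant_fibre_space_def lin L2_zero L2_add L2_scale)
  fix s \<phi> assume s: "\<And>k. s k \<in> invariant_fibre_space K" and lim: "L2_tendsto lebesgue s \<phi>"
  have "dual_rep g \<phi> \<in> fibre_space K" if "g \<in> \<Gamma>" for g
    by (rule closed_L2_subspaceD(5)[OF W, where s = "\<lambda>k. dual_rep g (s k)"])
       (use s that L2_tendsto_dual_rep[OF group_orthogonal' lim] in \<open>auto simp: invariant_fibre_space_def\<close>)
  then show "\<phi> \<in> invariant_fibre_space K"
    using lim by (auto simp: invariant_fibre_space_def L2_tendsto_def)
qed (auto simp: invariant_fibre_space_def)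

lemma dual_rep_mult:
  assumes "(x, L) \<in> \<Gamma>" "(y, M) \<in> \<Gamma>"
  shows "dual_rep (x, L) (dual_rep (y, M) \<phi>) = dual_rep (transpose M *v x + y, L ** M) \<phi>"
proof
  fix u
  note L = group_orthogonal[OF assms(1)] and M = group_orthogonal[OF assms(2)]
  have LM: "matrix_inv (L ** M) = transpose M ** transpose L"
    using orthogonal_matrix_inv[OF group_orthogonal[OF group_mult[OF assms]]] by (simp add: matrix_transpose_mul)
  define v where "v = transpose M *v (transpose L *v u)"
  have "chi v (transpose M *v x) = chi (transpose L *v u) x"
    by (simp only: chi_commute[of v] chi_matrix transpose_transpose v_def orthogonal_matrix_cancel[OF M] chi_commute[of x])
  then show "dual_rep (x, L) (dual_rep (y, M) \<phi>) u = dual_rep (transpose M *v x + y, L ** M) \<phi> u"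
    by (simp only: dual_rep_def fst_conv snd_conv orthogonal_matrix_inv[OF L] orthogonal_matrix_inv[OF M]
        LM matrix_vector_mul_assoc[symmetric] v_def[symmetric] chi_add mult.assoc)
qed

lemma dual_rep_one: "dual_rep (0, mat 1) \<phi> = \<phi>"
  by (simp add: dual_rep_def orthogonal_matrix_inv[OF orthogonal_matrix_id] transpose_mat)

lemma invariant_fibre_space_invariant:
  assumes "\<phi> \<in> invariant_fibre_space K" "g \<in> \<Gamma>"
  shows "dual_rep g \<phi> \<in> invariant_fibre_space K"
  unfolding invariant_fibre_space_def
proof (intro CollectI conjI ballI)
  show "dual_rep g \<phi> \<in> L2 lebesgue"
    using assms by (intro dual_rep_L2 group_orthogonal') (auto simp: invariant_fibre_space_def)
  fix h assume "h \<in> \<Gamma>"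
  then obtain x L y M where h: "h = (x, L)" "(x, L) \<in> \<Gamma>" "g = (y, M)" "(y, M) \<in> \<Gamma>"
    using assms(2) by (cases h; cases g) auto
  show "dual_rep h (dual_rep g \<phi>) \<in> fibre_space K"
    unfolding h(1,3) dual_rep_mult[OF h(2,4)]
    using assms(1) group_mult[OF h(2,4)] by (auto simp: invariant_fibre_space_def)
qed

text \<open>Up to a factor that does not depend on \<open>z\<close>, the fibre of \<open>dual_rep (x, L) \<phi>\<close> at \<open>r\<close> is the
  \<open>M\<close>-component of the description of \<open>\<phi>\<close> over \<open>r\<close>, for \<open>M = L\<^sup>-\<^sup>1\<close>: the vector \<open>L x + x\<^sub>M\<close> lies in the
  lattice, so \<open>\<chi>\<^sub>z\<close> has conjugate values at \<open>L x\<close> and \<open>x\<^sub>M\<close>.\<close>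

lemma dual_rep_fibre:
  assumes \<gamma>: "cross_section \<Gamma> \<gamma>" and g: "(x, L) \<in> \<Gamma>" and z: "z \<in> A"
  shows "dual_rep (x, L) \<phi> (r + z)
    = chi r (L *v x) * (cnj (chi z (fst (\<gamma> (transpose L)))) * \<phi> (transpose L *v (r + z)))"
proof -
  note L = group_orthogonal[OF g]
  have "transpose L \<in> P" using group_inv[OF g] by (auto simp: point_group_def)
  then obtain v where v: "\<gamma> (transpose L) = (v, transpose L)" "(v, transpose L) \<in> \<Gamma>"
    using \<gamma> unfolding cross_section_def by (metis prod.collapse)
  have "(transpose (transpose L) *v x + v, L ** transpose L) \<in> \<Gamma>"
    by (rule group_mult[OF g v(2)])
  then have "L *v x + v \<in> \<Lambda>"
    using L by (simp add: lattice_def orthogonal_matrix_def transpose_transpose)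
  from dual_lattice_chi[OF z this] have "chi z (L *v x) * chi z v = 1"
    by (simp only: chi_add)
  then have "chi z (L *v x) = cnj (chi z v)"
    by (metis chi_mult_cnj(1) mult.assoc mult.commute mult.right_neutral)
  moreover have "chi (transpose L *v (r + z)) x = chi r (L *v x) * chi z (L *v x)"
    by (simp only: chi_matrix transpose_transpose chi_add)
  ultimately show ?thesis
    by (simp only: dual_rep_def fst_conv snd_conv orthogonal_matrix_inv[OF L] v(1) mult.assoc)
qed

lemma cross_section_exists: obtains \<gamma> where "cross_section \<Gamma> \<gamma>"
proof -
  have "\<forall>M\<in>P. \<exists>g. g \<in> \<Gamma> \<and> snd g = M" by (auto simp: point_group_def)
  then show ?thesis using that unfolding cross_section_def by metis
qed

text \<open>The entry \<open>\<langle>F(r), \<delta>\<^sub>M \<otimes> \<delta>\<^sub>z\<rangle>\<close> of the element \<open>F\<close> of the direct integral that describes a function with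
  Plancherel transform \<open>\<phi>\<close>.\<close>

definition component :: "(real^'n^'n \<Rightarrow> 'n affine) \<Rightarrow> (real^'n \<Rightarrow> complex) \<Rightarrow> real^'n \<Rightarrow> (real^'n^'n) \<times> (real^'n) \<Rightarrow> complex" where
  "component \<gamma> \<phi> r = (\<lambda>(M, z). cnj (chi z (fst (\<gamma> M))) * \<phi> (M *v (r + z)))"

lemma invariant_fibre_space_iff_components:
  assumes \<gamma>: "cross_section \<Gamma> \<gamma>" and K: "\<And>r. r \<in> R \<Longrightarrow> closed_L2_subspace (count_space A) (K r)"
    and \<phi>: "\<phi> \<in> L2 lebesgue"
  shows "\<phi> \<in> invariant_fibre_space K \<longleftrightarrow>
    (AE r in lebesgue_on R. \<forall>M\<in>P. (\<lambda>z. component \<gamma> \<phi> r (M, z)) \<in> K r)"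
proof -
  have iff: "fibre (dual_rep (x, L) \<phi>) r \<in> K r \<longleftrightarrow> (\<lambda>z. component \<gamma> \<phi> r (transpose L, z)) \<in> K r"
    if "(x, L) \<in> \<Gamma>" "r \<in> R" for x L r
    by (rule closed_count_space_cong_scale[OF K[OF that(2)], of "chi r (L *v x)"])
       (simp_all only: chi_nonzero fibre_def component_def prod.case dual_rep_fibre[OF \<gamma> that(1)] not_False_eq_True)
  show ?thesis
  proof
    assume \<phi>K: "\<phi> \<in> invariant_fibre_space K"
    have "AE r in lebesgue_on R. (\<lambda>z. component \<gamma> \<phi> r (M, z)) \<in> K r" if M: "M \<in> P" for M
    proof -
      obtain x where x: "(x, transpose M) \<in> \<Gamma>"
        using point_group_transpose[OF M] by (auto simp: point_group_def)
      then have "AE r in lebesgue_on R. fibre (dual_rep (x, transpose M) \<phi>) r \<in> K r"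
        using \<phi>K by (auto simp: invariant_fibre_space_def fibre_space_def)
      with AE_in_domain show ?thesis
        by eventually_elim (simp add: iff[OF x] transpose_transpose)
    qed
    then show "AE r in lebesgue_on R. \<forall>M\<in>P. (\<lambda>z. component \<gamma> \<phi> r (M, z)) \<in> K r"
      by (simp add: AE_ball_countable[OF countable_point_group])
  next
    assume *: "AE r in lebesgue_on R. \<forall>M\<in>P. (\<lambda>z. component \<gamma> \<phi> r (M, z)) \<in> K r"
    have "dual_rep g \<phi> \<in> fibre_space K" if g: "g \<in> \<Gamma>" for g
    proof -
      obtain x L where xL: "g = (x, L)" "(x, L) \<in> \<Gamma>" using g by (cases g) auto
      then have L: "transpose L \<in> P" using group_inv by (auto simp: point_group_def)
      have "AE r in lebesgue_on R. fibre (dual_rep (x, L) \<phi>) r \<in> K r"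
        using * AE_in_domain by eventually_elim (use L iff[OF xL(2)] in blast)
      then show ?thesis
        using dual_rep_L2[OF group_orthogonal'[OF g] \<phi>] by (simp add: fibre_space_def xL(1))
    qed
    then show "\<phi> \<in> invariant_fibre_space K"
      using \<phi> by (simp add: invariant_fibre_space_def)
  qed
qed

text \<open>The components form an element of \<open>L\<^sup>2(R; l\<^sup>2(P \<times> A))\<close> once they are replaced by zero on the
  null set where they are not square-summable.\<close>

lemma component_valued:
  assumes \<phi>: "\<phi> \<in> L2 lebesgue"
  obtains F where "F \<in> L2_valued (lebesgue_on R) (count_space (P \<times> A))"
    "AE r in lebesgue_on R. F r = component \<gamma> \<phi> r"
proof -
  define N where "N = count_space (P \<times> A)"
  note tile = dual_group_tiles
  have count: "countable (P \<times> A)" using countable_point_group countable_dual_lattice by blast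
  interpret N: sigma_finite_measure N
    unfolding N_def by (rule sigma_finite_measure_count_space_countable[OF count])
  have \<phi>m: "\<phi> \<in> borel_measurable lebesgue" by (rule L2_measurable[OF \<phi>])
  have norm_c: "cmod (component \<gamma> \<phi> r p) = cmod (\<phi> ((case p of (M, z) \<Rightarrow> \<lambda>u. M *v (u + z)) r))" for r p
    by (cases p) (simp add: component_def norm_mult)
  have cm: "(\<lambda>p. component \<gamma> \<phi> (fst p) (snd p)) \<in> borel_measurable (lebesgue_on R \<Otimes>\<^sub>M N)"
    unfolding N_def
  proof (rule measurable_pair_count_space[OF count])
    fix p assume "p \<in> P \<times> A"
    then obtain M z where p: "p = (M, z)" "M \<in> P" by auto
    have "(\<lambda>r. \<phi> (M *v (r + z))) \<in> borel_measurable lebesgue"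
      by (rule measurable_compose[OF lebesgue_measurable_isometry[OF point_group_orthogonal[OF p(2)]] \<phi>m])
    then show "(\<lambda>r. component \<gamma> \<phi> (fst (r, p)) (snd (r, p))) \<in> borel_measurable (lebesgue_on R)"
      by (auto simp: component_def p intro!: measurable_restrict_space1)
  qed
  define good where "good r \<longleftrightarrow> (\<integral>\<^sup>+p. ennreal ((cmod (component \<gamma> \<phi> r p))\<^sup>2) \<partial>N) < \<infinity>" for r
  have good_iff: "good r \<longleftrightarrow> component \<gamma> \<phi> r \<in> L2 N" for r
    unfolding good_def L2_def N_def by (simp add: integrable_iff_bounded)
  have good_meas: "Measurable.pred (lebesgue_on R) good"
  proof -
    have "(\<lambda>r. \<integral>\<^sup>+p. ennreal ((cmod (component \<gamma> \<phi> r p))\<^sup>2) \<partial>N) \<in> borel_measurable (lebesgue_on R)"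
      using cm by (intro N.borel_measurable_nn_integral) (simp add: split_beta')
    then show ?thesis unfolding good_def by measurable
  qed
  have good_AE: "AE r in lebesgue_on R. good r"
    using disjoint_isometric_images.unfold_AE_integrable[OF tile L2_integrable[OF \<phi>]]
    by eventually_elim (simp add: good_iff L2_def N_def norm_c)
  define F where "F r = (if good r then component \<gamma> \<phi> r else (\<lambda>_. 0))" for r
  have AE_F: "AE r in lebesgue_on R. F r = component \<gamma> \<phi> r"
    using good_AE by eventually_elim (simp add: F_def)
  have "F \<in> L2_valued (lebesgue_on R) N"
    unfolding L2_valued_def
  proof (intro CollectI conjI ballI)
    show "F r \<in> L2 N" for r by (simp add: F_def good_iff L2_zero)
    fix a assume a: "a \<in> L2 N"
    have "(\<lambda>r. L2_inner N (component \<gamma> \<phi> r) a) \<in> borel_measurable (lebesgue_on R)"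
      unfolding L2_inner_def
    proof (rule N.borel_measurable_lebesgue_integral)
      show "(\<lambda>(r, p). component \<gamma> \<phi> r p * cnj (a p)) \<in> borel_measurable (lebesgue_on R \<Otimes>\<^sub>M N)"
        unfolding split_beta'
        by (intro borel_measurable_times cm borel_measurable_cnj measurable_compose[OF measurable_snd L2_measurable[OF a]])
    qed
    then have "(\<lambda>r. if good r then L2_inner N (component \<gamma> \<phi> r) a else 0) \<in> borel_measurable (lebesgue_on R)"
      using good_meas by measurable
    moreover have "L2_inner N (F r) a = (if good r then L2_inner N (component \<gamma> \<phi> r) a else 0)" for r
      by (simp add: F_def L2_inner_def)
    ultimately show "(\<lambda>r. L2_inner N (F r) a) \<in> borel_measurable (lebesgue_on R)" by simp
  next
    have i: "integrable (lebesgue_on R) (\<lambda>r. sqnorm N (component \<gamma> \<phi> r))"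
      using disjoint_isometric_images.unfold_integrable[OF tile L2_integrable[OF \<phi>]]
      by (simp add: sqnorm_def N_def norm_c)
    have "(\<lambda>r. sqnorm N (F r)) = (\<lambda>r. if good r then sqnorm N (component \<gamma> \<phi> r) else 0)"
      by (auto simp: F_def sqnorm_def)
    then have "(\<lambda>r. sqnorm N (F r)) \<in> borel_measurable (lebesgue_on R)"
      using borel_measurable_integrable[OF i] good_meas by simp
    then have "integrable (lebesgue_on R) (\<lambda>r. sqnorm N (F r))"
      by (rule integrable_cong_AE_imp[OF i]) (use AE_F in \<open>eventually_elim, simp\<close>)
    then show "integrable (lebesgue_on R) (\<lambda>r. (L2_norm N (F r))\<^sup>2)"
      by (simp add: L2_norm_squared)
  qed
  then show ?thesis using that AE_F by (simp add: N_def)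
qed

text \<open>The equations for \<open>F\<close> say that \<open>F(r)\<close> has the components of the Plancherel transform as its
  entries, and membership in the tensor product is a condition on its slices.\<close>

lemma range_space_eq:
  assumes \<gamma>: "cross_section \<Gamma> \<gamma>" and K: "\<And>r. r \<in> R \<Longrightarrow> closed_L2_subspace (count_space A) (K r)"
  shows "range_space \<Gamma> R \<gamma> K = {f \<in> L2 lebesgue. plancherel f \<in> invariant_fibre_space K}"
proof -
  have cond: "(\<forall>(z, M)\<in>dual_group \<Gamma>. plancherel f (M *v (r + z)) = chi z (fst (\<gamma> M)) *
        L2_inner (count_space (P \<times> A)) (F r) (tensor (delta M) (delta z)))
      \<longleftrightarrow> (\<forall>p\<in>P \<times> A. F r p = component \<gamma> (plancherel f) r p)"
    for f r and F :: "real^'n \<Rightarrow> (real^'n^'n) \<times> (real^'n) \<Rightarrow> complex"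
  proof -
    have "w = chi z x * t \<longleftrightarrow> t = cnj (chi z x) * w" for w t z x
      by (metis chi_mult_cnj mult.assoc mult.left_neutral)
    then show ?thesis
      by (auto simp: dual_group_eq tensor_delta L2_inner_delta component_def)
  qed
  show ?thesis
  proof (intro equalityI subsetI)
    fix f assume "f \<in> range_space \<Gamma> R \<gamma> K"
    then obtain F where f: "f \<in> L2 lebesgue" and F: "F \<in> direct_integral R P A K"
      and eq: "AE r in lebesgue_on R. \<forall>p\<in>P \<times> A. F r p = component \<gamma> (plancherel f) r p"
      unfolding range_space_def cond by blast
    have "AE r in lebesgue_on R. F r \<in> l2_tensor P A (L2 (count_space P)) (K r)"
      using F by (simp add: direct_integral_def)
    with eq AE_in_domain have "AE r in lebesgue_on R. \<forall>M\<in>P. (\<lambda>z. component \<gamma> (plancherel f) r (M, z)) \<in> K r"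
    proof eventually_elim
      case (elim r)
      show ?case
      proof
        fix M assume M: "M \<in> P"
        then have "(\<lambda>z. F r (M, z)) \<in> K r"
          using elim l2_tensor_iff_slices[OF countable_point_group countable_dual_lattice K] by blast
        then show "(\<lambda>z. component \<gamma> (plancherel f) r (M, z)) \<in> K r"
          by (rule closed_count_space_cong[OF K[OF elim(2)]]) (use elim(1) M in auto)
      qed
    qed
    then show "f \<in> {f \<in> L2 lebesgue. plancherel f \<in> invariant_fibre_space K}"
      using f invariant_fibre_space_iff_components[OF \<gamma> K plancherel_pairD(2)[OF plancherel_pair_plancherel[OF f]]]
      by simp
  next
    fix f assume "f \<in> {f \<in> L2 lebesgue. plancherel f \<in> invariant_fibre_space K}"
    then have f: "f \<in> L2 lebesgue" and fK: "plancherel f \<in> invariant_fibre_space K" by auto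
    note pf = plancherel_pairD(2)[OF plancherel_pair_plancherel[OF f]]
    obtain F where F: "F \<in> L2_valued (lebesgue_on R) (count_space (P \<times> A))"
      and AE_F: "AE r in lebesgue_on R. F r = component \<gamma> (plancherel f) r"
      using component_valued[OF pf] by blast
    have F_L2: "F r \<in> L2 (count_space (P \<times> A))" if "r \<in> R" for r
      using F that by (simp add: L2_valued_def)
    have "AE r in lebesgue_on R. \<forall>M\<in>P. (\<lambda>z. component \<gamma> (plancherel f) r (M, z)) \<in> K r"
      using fK invariant_fibre_space_iff_components[OF \<gamma> K pf] by simp
    with AE_F AE_in_domain have "AE r in lebesgue_on R. F r \<in> l2_tensor P A (L2 (count_space P)) (K r)"
      by eventually_elim (simp add: l2_tensor_iff_slices[OF countable_point_group countable_dual_lattice K], metis F_L2)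
    then have "F \<in> direct_integral R P A K"
      using F by (simp add: direct_integral_def)
    moreover have "AE r in lebesgue_on R. \<forall>p\<in>P \<times> A. F r p = component \<gamma> (plancherel f) r p"
      using AE_F by eventually_elim simp
    ultimately show "f \<in> range_space \<Gamma> R \<gamma> K"
      unfolding range_space_def cond using f by blast
  qed
qed

end

section \<open>Localization over the fundamental domain\<close>

context crystallographic_domain
begin

lemma sigma_finite_domain: "sigma_finite_measure (lebesgue_on R)"
  by (rule sigma_finite_measure_restrict_space[OF sigma_finite_lebesgue domain_sets])

lemma orthogonal_localize:
  assumes inv: "\<And>x \<phi>. x \<in> \<Lambda> \<Longrightarrow> \<phi> \<in> V \<Longrightarrow> dual_rep (x, mat 1) \<phi> \<in> V"
    and V: "V \<subseteq> L2 lebesgue" and \<phi>: "\<phi> \<in> V" and w: "w \<in> L2 lebesgue"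
    and orth: "\<And>v. v \<in> V \<Longrightarrow> L2_inner lebesgue v w = 0" and E: "E \<in> sets lebesgue"
  shows "(\<integral>y. (\<phi> y * cnj (w y)) * indicator (orbit E) y \<partial>lebesgue) = 0"
  unfolding orbit_def
proof (rule annihilated_by_characters[of \<Lambda>])
  show "integrable lebesgue (\<lambda>y. \<phi> y * cnj (w y))"
    using \<phi> V by (intro L2_inner_integrable w) auto
  show "A = {z. \<forall>x\<in>\<Lambda>. x \<bullet> z \<in> \<int>}" by (simp add: dual_lattice_def)
  fix x assume x: "x \<in> \<Lambda>"
  have "(\<integral>y. \<phi> y * cnj (w y) * chi x y \<partial>lebesgue) = L2_inner lebesgue (dual_rep (x, mat 1) \<phi>) w"
    by (simp add: L2_inner_def dual_rep_def orthogonal_matrix_inv[OF orthogonal_matrix_id] transpose_mat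
        chi_commute[of x] mult_ac)
  then show "(\<integral>y. \<phi> y * cnj (w y) * chi x y \<partial>lebesgue) = 0"
    using orth[OF inv[OF x \<phi>]] by simp
qed (auto simp: lattice_zero lattice_add lattice_minus countable_dual_lattice E)

lemma L2_restrict_orbit:
  assumes "\<phi> \<in> L2 lebesgue" "E \<in> sets lebesgue"
  shows "(\<lambda>y. \<phi> y * indicator (orbit E) y) \<in> L2 lebesgue"
  by (rule L2_dominated[OF assms(1)])
     (use L2_measurable[OF assms(1)] orbit_sets[OF assms(2)] in \<open>auto simp: indicator_def\<close>)

lemma L2_inner_restrict_orbit:
  "L2_inner lebesgue (\<lambda>y. \<phi> y * indicator (orbit E) y) \<psi> = (\<integral>y. (\<phi> y * cnj (\<psi> y)) * indicator (orbit E) y \<partial>lebesgue)"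
  unfolding L2_inner_def by (intro Bochner_Integration.integral_cong) simp_all

text \<open>Invariance under multiplication by the characters \<open>\<chi>\<^sub>x\<close>, \<open>x \<in> \<Lambda>\<close>, implies invariance under
  multiplication by the indicator of \<open>E + A\<close>: the product is orthogonal to the orthogonal complement
  of \<open>V\<close>.\<close>

lemma localize_closed_invariant:
  assumes V: "closed_L2_subspace lebesgue V"
    and inv: "\<And>x \<phi>. x \<in> \<Lambda> \<Longrightarrow> \<phi> \<in> V \<Longrightarrow> dual_rep (x, mat 1) \<phi> \<in> V"
    and \<phi>: "\<phi> \<in> V" and E: "E \<in> sets lebesgue"
  shows "(\<lambda>y. \<phi> y * indicator (orbit E) y) \<in> V"
proof (rule L2_proj_fixed[OF V])
  let ?\<psi> = "\<lambda>y. \<phi> y * indicator (orbit E) y"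
  have \<phi>L2: "\<phi> \<in> L2 lebesgue" using \<phi> closed_L2_subspaceD(1)[OF V] by blast
  show \<psi>: "?\<psi> \<in> L2 lebesgue" by (rule L2_restrict_orbit[OF \<phi>L2 E])
  show "L2_inner lebesgue ?\<psi> (\<lambda>x. ?\<psi> x - L2_proj lebesgue V ?\<psi> x) = 0"
    unfolding L2_inner_restrict_orbit
  proof (rule orthogonal_localize[OF inv closed_L2_subspaceD(1)[OF V] \<phi> _ _ E])
    show "(\<lambda>x. ?\<psi> x - L2_proj lebesgue V ?\<psi> x) \<in> L2 lebesgue"
      by (rule L2_diff[OF \<psi> L2_proj_L2[OF V \<psi>]])
    show "L2_inner lebesgue v (\<lambda>x. ?\<psi> x - L2_proj lebesgue V ?\<psi> x) = 0" if "v \<in> V" for v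
      using L2_proj(2)[OF V \<psi> that] L2_inner_zero_sym by blast
  qed
qed

text \<open>Unfolding turns the hypothesis into equality of the integrals of both sides over all measurable
  subsets of \<open>R\<close>.\<close>

lemma fibre_inner_AE_eq:
  assumes L2: "\<phi> \<in> L2 lebesgue" "\<psi> \<in> L2 lebesgue" "\<psi>' \<in> L2 lebesgue"
    and eq: "\<And>E. E \<in> sets lebesgue \<Longrightarrow>
      (\<integral>y. (\<phi> y * cnj (\<psi> y)) * indicator (orbit E) y \<partial>lebesgue)
      = (\<integral>y. (\<phi> y * cnj (\<psi>' y)) * indicator (orbit E) y \<partial>lebesgue)"
  shows "AE r in lebesgue_on R. L2_inner (count_space A) (fibre \<phi> r) (fibre \<psi> r)
    = L2_inner (count_space A) (fibre \<phi> r) (fibre \<psi>' r)"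
proof (rule sigma_finite_measure.density_unique_banach[OF sigma_finite_domain])
  show "integrable (lebesgue_on R) (\<lambda>r. L2_inner (count_space A) (fibre \<phi> r) (fibre \<psi> r))"
    "integrable (lebesgue_on R) (\<lambda>r. L2_inner (count_space A) (fibre \<phi> r) (fibre \<psi>' r))"
    by (intro fibre_inner_integrable L2 domain_sets order_refl)+
  fix E assume "E \<in> sets (lebesgue_on R)"
  then have E: "E \<in> sets lebesgue" "E \<subseteq> R"
    by (auto simp: sets_restrict_space)
  have sub: "set_lebesgue_integral (lebesgue_on R) E f = (\<integral>r. f r \<partial>lebesgue_on E)" for f :: "real^'n \<Rightarrow> complex"
  proof -
    have "(\<integral>r. f r \<partial>restrict_space (lebesgue_on R) E) = (\<integral>r. indicator E r *\<^sub>R f r \<partial>lebesgue_on R)"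
      by (rule integral_restrict_space) (use E in \<open>auto simp: sets_restrict_space\<close>)
    moreover have "restrict_space (lebesgue_on R) E = lebesgue_on E"
      using E by (subst restrict_restrict_space) (auto simp: Int_absorb1)
    ultimately show ?thesis by (simp add: set_lebesgue_integral_def)
  qed
  show "set_lebesgue_integral (lebesgue_on R) E (\<lambda>r. L2_inner (count_space A) (fibre \<phi> r) (fibre \<psi> r))
      = set_lebesgue_integral (lebesgue_on R) E (\<lambda>r. L2_inner (count_space A) (fibre \<phi> r) (fibre \<psi>' r))"
    unfolding sub fibre_inner_integral[OF L2(1,2) E] fibre_inner_integral[OF L2(1,3) E]
    by (rule eq[OF E(1)])
qed

text \<open>For \<open>w \<in> A\<close> its fibre over \<open>r \<in> R\<close> is \<open>\<rho>(r) \<delta>\<^sub>w\<close> with the Gaussian weight \<open>\<rho>(r) = exp (- \<pi> |r|\<^sup>2)\<close>, which ensures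
  square-integrability and is positive, so that nothing is lost.\<close>

definition basis_field :: "real^'n \<Rightarrow> real^'n \<Rightarrow> complex" where
  "basis_field w y = indicator R (y - w) * gaussian w 0 y"

lemma basis_field_L2: "basis_field w \<in> L2 lebesgue"
proof (rule L2_dominated[OF gaussian_L2[of w 0]])
  have "(\<lambda>y. indicator R (mat 1 *v (y + - w)) :: complex) \<in> borel_measurable lebesgue"
    by (rule measurable_compose[OF lebesgue_measurable_isometry[OF orthogonal_matrix_id]]) simp
  then show "basis_field w \<in> borel_measurable lebesgue"
    unfolding basis_field_def by (intro borel_measurable_times lebesgue_measurable_gaussian) simp
qed (simp add: basis_field_def indicator_def)

lemma translate_in_domain:
  assumes "r \<in> R" "z \<in> A" "w \<in> A" "r + z - w \<in> R"
  shows "z = w"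
  by (rule domain_images_disjoint(1)[of z "mat 1" w "mat 1" r "r + z - w"])
     (use assms in \<open>auto simp: point_group_one\<close>)

lemma gaussian_origin: "gaussian 0 0 r = of_real (exp (- pi * (norm r)\<^sup>2))"
  by (simp add: gaussian_def)

lemma fibre_basis_field:
  assumes "r \<in> R" "z \<in> A" "w \<in> A"
  shows "fibre (basis_field w) r z = gaussian 0 0 r * delta w z"
  using assms translate_in_domain[OF assms]
  by (auto simp: fibre_def basis_field_def delta_def indicator_def gaussian_def)

lemma fibre_inner_basis_field:
  assumes "r \<in> R" "w \<in> A"
  shows "L2_inner (count_space A) f (fibre (basis_field w) r) = gaussian 0 0 r * f w"
proof -
  have "L2_inner (count_space A) f (fibre (basis_field w) r)
      = L2_inner (count_space A) f (\<lambda>z. gaussian 0 0 r * delta w z)"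
    unfolding L2_inner_def by (intro Bochner_Integration.integral_cong) (simp_all add: fibre_basis_field[OF assms(1) _ assms(2)])
  then show ?thesis
    by (simp add: L2_inner_scale_right L2_inner_delta[OF assms(2)] gaussian_origin)
qed

section \<open>Existence of the range function\<close>

context
  fixes V :: "(real^'n \<Rightarrow> complex) set"
  assumes V: "closed_L2_subspace lebesgue V"
    and V_inv: "\<And>g \<phi>. g \<in> \<Gamma> \<Longrightarrow> \<phi> \<in> V \<Longrightarrow> dual_rep g \<phi> \<in> V"
begin

lemma V_L2: "\<phi> \<in> V \<Longrightarrow> \<phi> \<in> L2 lebesgue"
  using closed_L2_subspaceD(1)[OF V] by blast

lemma V_inv_lattice: "x \<in> \<Lambda> \<Longrightarrow> \<phi> \<in> V \<Longrightarrow> dual_rep (x, mat 1) \<phi> \<in> V"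
  using V_inv by (simp add: lattice_def)

definition generator :: "real^'n \<Rightarrow> real^'n \<Rightarrow> complex" where
  "generator w = L2_proj lebesgue V (basis_field w)"

lemma generator_V: "generator w \<in> V"
  unfolding generator_def by (rule L2_proj(1)[OF V basis_field_L2])

text \<open>The projection onto \<open>V\<close> commutes with the multiplications by indicators of \<open>E + A\<close>, so it acts
  fibre by fibre: over almost every \<open>r\<close>, inner products of fibres of elements of \<open>V\<close> with those of
  \<open>basis_field w\<close> and of its projection agree.\<close>

lemma generator_reproduces:
  assumes \<psi>: "\<psi> \<in> V" and w: "w \<in> A"
  shows "AE r in lebesgue_on R.
    gaussian 0 0 r * \<psi> (r + w) = L2_inner (count_space A) (fibre \<psi> r) (fibre (generator w) r)"
proof -
  have "AE r in lebesgue_on R. L2_inner (count_space A) (fibre \<psi> r) (fibre (basis_field w) r)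
    = L2_inner (count_space A) (fibre \<psi> r) (fibre (generator w) r)"
  proof (rule fibre_inner_AE_eq[OF V_L2[OF \<psi>] basis_field_L2 V_L2[OF generator_V]])
    fix E :: "(real^'n) set" assume E: "E \<in> sets lebesgue"
    let ?\<psi> = "\<lambda>y. \<psi> y * indicator (orbit E) y"
    have "?\<psi> \<in> V" by (rule localize_closed_invariant[OF V V_inv_lattice \<psi> E])
    from L2_proj_inner[OF V basis_field_L2 this, of w]
    have "L2_inner lebesgue ?\<psi> (basis_field w) = L2_inner lebesgue ?\<psi> (generator w)"
      unfolding generator_def by (metis L2_inner_commute)
    then show "(\<integral>y. (\<psi> y * cnj (basis_field w y)) * indicator (orbit E) y \<partial>lebesgue)
      = (\<integral>y. (\<psi> y * cnj (generator w y)) * indicator (orbit E) y \<partial>lebesgue)"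
      by (simp only: L2_inner_restrict_orbit)
  qed
  then show ?thesis
    using AE_in_domain
  proof eventually_elim
    case (elim r)
    then show ?case
      unfolding fibre_inner_basis_field[OF elim(2) w] by (simp only: fibre_def)
  qed
qed

text \<open>The points at which \<open>generator_reproduces\<close> holds for all the generators themselves.\<close>

definition good :: "real^'n \<Rightarrow> bool" where
  "good r \<longleftrightarrow> (\<forall>w\<in>A. fibre (generator w) r \<in> L2 (count_space A)) \<and>
     (\<forall>w\<in>A. \<forall>z\<in>A. gaussian 0 0 r * generator w (r + z)
        = L2_inner (count_space A) (fibre (generator w) r) (fibre (generator z) r))"

lemma good_AE: "AE r in lebesgue_on R. good r"
proof -
  have "AE r in lebesgue_on R. \<forall>w\<in>A. fibre (generator w) r \<in> L2 (count_space A)"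
    unfolding AE_ball_countable[OF countable_dual_lattice] by (intro ballI fibre_L2_AE V_L2 generator_V)
  moreover have "AE r in lebesgue_on R. \<forall>w\<in>A. \<forall>z\<in>A. gaussian 0 0 r * generator w (r + z)
        = L2_inner (count_space A) (fibre (generator w) r) (fibre (generator z) r)"
    unfolding AE_ball_countable[OF countable_dual_lattice] by (intro ballI generator_reproduces generator_V)
  ultimately show ?thesis by eventually_elim (simp add: good_def)
qed

text \<open>The closed span of the fibres of the generators. On the null set of bad points the value is
  some closed subspace, because the values of a range function are closed everywhere.\<close>

definition range_fun :: "real^'n \<Rightarrow> (real^'n \<Rightarrow> complex) set" where
  "range_fun r = (if good r
     then \<Inter>{W. closed_L2_subspace (count_space A) W \<and> (\<forall>w\<in>A. fibre (generator w) r \<in> W)}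
     else L2 (count_space A))"

lemma range_fun_closed: "closed_L2_subspace (count_space A) (range_fun r)"
proof (cases "good r")
  case True
  have "L2 (count_space A) \<in> {W. closed_L2_subspace (count_space A) W \<and> (\<forall>w\<in>A. fibre (generator w) r \<in> W)}"
    using True by (simp add: good_def closed_L2_subspace_UNIV)
  then show ?thesis
    using True unfolding range_fun_def by (auto intro!: closed_L2_subspace_Inter)
qed (simp add: range_fun_def closed_L2_subspace_UNIV)

lemma range_fun_L2: "v \<in> range_fun r \<Longrightarrow> v \<in> L2 (count_space A)"
  using closed_L2_subspaceD(1)[OF range_fun_closed] by blast

lemma generator_in_range_fun: "good r \<Longrightarrow> w \<in> A \<Longrightarrow> fibre (generator w) r \<in> range_fun r"
  unfolding range_fun_def by auto

lemma orthogonal_to_range_fun: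
  assumes r: "good r" and u: "u \<in> L2 (count_space A)"
    and orth: "\<And>w. w \<in> A \<Longrightarrow> L2_inner (count_space A) (fibre (generator w) r) u = 0"
    and v: "v \<in> range_fun r"
  shows "L2_inner (count_space A) v u = 0"
proof -
  define W where "W = {v \<in> L2 (count_space A). \<forall>g\<in>{u}. L2_inner (count_space A) v g = 0}"
  have "closed_L2_subspace (count_space A) W"
    unfolding W_def by (rule orthogonal_complement_closed) (use u in simp)
  moreover have "\<forall>w\<in>A. fibre (generator w) r \<in> W"
    using orth r by (simp add: W_def good_def)
  ultimately have "v \<in> W" using v r unfolding range_fun_def by auto
  then show ?thesis by (simp add: W_def)
qed

text \<open>At a good point the difference of \<open>\<delta>\<^sub>z\<close> and the fibre of the generator, divided by the weight, is
  orthogonal to the fibres of all generators.\<close>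

lemma range_fun_proj_delta:
  assumes r: "good r" and z: "z \<in> A" and y: "y \<in> A"
  shows "L2_proj (count_space A) (range_fun r) (delta z) y = (1 / gaussian 0 0 r) * generator z (r + y)"
proof -
  define p where "p y = (1 / gaussian 0 0 r) * fibre (generator z) r y" for y
  have nz: "gaussian 0 0 r \<noteq> 0" by (simp add: gaussian_origin)
  have p: "p \<in> range_fun r"
    unfolding p_def by (intro closed_L2_subspaceD(4)[OF range_fun_closed] generator_in_range_fun r z)
  have u: "(\<lambda>x. delta z x - p x) \<in> L2 (count_space A)"
    by (rule L2_diff[OF delta_L2 range_fun_L2[OF p]])
  have "AE y in count_space A. L2_proj (count_space A) (range_fun r) (delta z) y = p y"
  proof (rule L2_proj_unique[OF range_fun_closed delta_L2 p])
    fix v assume v: "v \<in> range_fun r"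
    have "L2_inner (count_space A) v (\<lambda>x. delta z x - p x) = 0"
    proof (rule orthogonal_to_range_fun[OF r u _ v])
      fix w assume w: "w \<in> A"
      define f where "f = fibre (generator w) r"
      have f: "f \<in> L2 (count_space A)" using r w by (simp add: f_def good_def)
      have "L2_inner (count_space A) (\<lambda>x. delta z x - p x) f
          = cnj (f z) - (1 / gaussian 0 0 r) * L2_inner (count_space A) (fibre (generator z) r) f"
        unfolding L2_inner_diff[OF delta_L2 range_fun_L2[OF p] f] L2_inner_delta_left[OF z]
        by (simp only: p_def[abs_def] L2_inner_scale)
      also have "L2_inner (count_space A) (fibre (generator z) r) f = cnj (gaussian 0 0 r * f z)"
      proof -
        have "gaussian 0 0 r * f z = L2_inner (count_space A) f (fibre (generator z) r)"
          using r w z by (simp add: good_def f_def fibre_def)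
        then show ?thesis by (metis L2_inner_commute)
      qed
      also have "cnj (f z) - (1 / gaussian 0 0 r) * cnj (gaussian 0 0 r * f z) = 0"
        using nz by (simp add: gaussian_origin)
      finally show "L2_inner (count_space A) (fibre (generator w) r) (\<lambda>x. delta z x - p x) = 0"
        using L2_inner_zero_sym by (metis f_def)
    qed
    then show "L2_inner (count_space A) (\<lambda>x. delta z x - p x) v = 0"
      using L2_inner_zero_sym by blast
  qed
  then show ?thesis using y by (simp add: AE_count_space p_def fibre_def)
qed

lemma range_fun_proj_coordinate:
  assumes r: "good r" and a: "a \<in> L2 (count_space A)" and w: "w \<in> A"
  shows "L2_proj (count_space A) (range_fun r) a w
    = (1 / gaussian 0 0 r) * L2_inner (count_space A) a (fibre (generator w) r)"
proof -
  have "L2_proj (count_space A) (range_fun r) a w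
      = L2_inner (count_space A) (L2_proj (count_space A) (range_fun r) a) (delta w)"
    by (simp add: L2_inner_delta[OF w])
  also have "\<dots> = L2_inner (count_space A) a (L2_proj (count_space A) (range_fun r) (delta w))"
    by (rule L2_proj_self_adjoint[OF range_fun_closed a delta_L2])
  also have "\<dots> = L2_inner (count_space A) a (\<lambda>y. (1 / gaussian 0 0 r) * fibre (generator w) r y)"
    unfolding L2_inner_def
    by (intro Bochner_Integration.integral_cong refl) (simp add: range_fun_proj_delta[OF r w] fibre_def)
  also have "\<dots> = (1 / gaussian 0 0 r) * L2_inner (count_space A) a (fibre (generator w) r)"
    unfolding L2_inner_scale_right by (simp add: gaussian_origin)
  finally show ?thesis .
qed

text \<open>The coordinates of a projection are inner products with fibres of the generators, which depend
  measurably on \<open>r\<close>.\<close>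

lemma range_fun_measurable: "measurable_range_function R A range_fun"
  unfolding measurable_range_function_def
proof (intro conjI ballI range_fun_closed)
  fix a b assume a: "a \<in> L2 (count_space A)" and b: "b \<in> L2 (count_space A)"
  interpret N: sigma_finite_measure "count_space A"
    by (rule sigma_finite_measure_count_space_countable[OF countable_dual_lattice])
  define coord where "coord r w = (1 / gaussian 0 0 r) * L2_inner (count_space A) a (fibre (generator w) r)" for r w
  have gen: "(\<lambda>r. generator w (r + z)) \<in> borel_measurable (lebesgue_on R)" for w z
  proof -
    have "(\<lambda>r. generator w (mat 1 *v (r + z))) \<in> borel_measurable lebesgue"
      by (rule measurable_compose[OF lebesgue_measurable_isometry[OF orthogonal_matrix_id] L2_measurable[OF V_L2[OF generator_V]]])
    then show ?thesis by (intro measurable_restrict_space1) simp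
  qed
  have gauss: "(\<lambda>r. 1 / gaussian 0 0 r) \<in> borel_measurable (lebesgue_on R)"
    by (intro borel_measurable_divide measurable_restrict_space1 lebesgue_measurable_gaussian) simp
  have coord: "(\<lambda>r. coord r w) \<in> borel_measurable (lebesgue_on R)" for w
    unfolding coord_def L2_inner_def
  proof (intro borel_measurable_times gauss N.borel_measurable_lebesgue_integral)
    show "(\<lambda>(r, z). a z * cnj (fibre (generator w) r z)) \<in> borel_measurable (lebesgue_on R \<Otimes>\<^sub>M count_space A)"
      by (rule measurable_pair_count_space[OF countable_dual_lattice])
         (use gen in \<open>auto simp: fibre_def intro!: borel_measurable_times borel_measurable_cnj\<close>)
  qed
  have "(\<lambda>r. \<integral>w. coord r w * cnj (b w) \<partial>count_space A) \<in> borel_measurable (lebesgue_on R)"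
  proof (rule N.borel_measurable_lebesgue_integral)
    show "(\<lambda>(r, w). coord r w * cnj (b w)) \<in> borel_measurable (lebesgue_on R \<Otimes>\<^sub>M count_space A)"
      by (rule measurable_pair_count_space[OF countable_dual_lattice]) (use coord in auto)
  qed
  moreover have "AE r in lebesgue_on R. (\<integral>w. coord r w * cnj (b w) \<partial>count_space A)
      = L2_inner (count_space A) (L2_proj (count_space A) (range_fun r) a) b"
    using good_AE
  proof eventually_elim
    case (elim r)
    show ?case
      unfolding L2_inner_def[of _ _ b]
      by (intro Bochner_Integration.integral_cong refl)
         (simp add: range_fun_proj_coordinate[OF elim a] coord_def)
  qed
  ultimately show "(\<lambda>r. L2_inner (count_space A) (L2_proj (count_space A) (range_fun r) a) b)
      \<in> borel_measurable (lebesgue_on R)"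
    by (rule lebesgue_on_measurable_AE[OF domain_sets])
qed

text \<open>By \<open>generator_reproduces\<close> each coordinate of a fibre of \<open>\<phi>\<close> equals that of its projection.\<close>

lemma subset_fibre_space: "V \<subseteq> fibre_space range_fun"
proof
  fix \<phi> assume \<phi>: "\<phi> \<in> V"
  have "AE r in lebesgue_on R. \<forall>w\<in>A. gaussian 0 0 r * \<phi> (r + w)
      = L2_inner (count_space A) (fibre \<phi> r) (fibre (generator w) r)"
    unfolding AE_ball_countable[OF countable_dual_lattice] by (intro ballI generator_reproduces \<phi>)
  then have "AE r in lebesgue_on R. fibre \<phi> r \<in> range_fun r"
    using fibre_L2_AE[OF V_L2[OF \<phi>]] good_AE
  proof eventually_elim
    case (elim r)
    have "L2_proj (count_space A) (range_fun r) (fibre \<phi> r) w = fibre \<phi> r w" if w: "w \<in> A" for w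
    proof -
      have "gaussian 0 0 r * \<phi> (r + w) = L2_inner (count_space A) (fibre \<phi> r) (fibre (generator w) r)"
        using elim(1) w by blast
      moreover have "gaussian 0 0 r \<noteq> 0" by (simp add: gaussian_origin)
      ultimately show ?thesis
        unfolding range_fun_proj_coordinate[OF elim(3,2) w] by (simp only: fibre_def) (simp add: nonzero_divide_eq_eq mult.commute)
    qed
    then show ?case
      by (rule closed_count_space_cong[OF range_fun_closed L2_proj(1)[OF range_fun_closed elim(2)]])
  qed
  then show "\<phi> \<in> fibre_space range_fun" using V_L2[OF \<phi>] by (simp add: fibre_space_def)
qed

text \<open>The operators \<open>dual_rep g\<close> are unitary and \<open>V\<close> is invariant under their inverses.\<close>

lemma orthogonal_dual_rep:
  assumes \<psi>: "\<psi> \<in> L2 lebesgue" and orth: "\<And>v. v \<in> V \<Longrightarrow> L2_inner lebesgue v \<psi> = 0"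
    and g: "g \<in> \<Gamma>" and v: "v \<in> V"
  shows "L2_inner lebesgue v (dual_rep g \<psi>) = 0"
proof -
  obtain x L where xL: "g = (x, L)" "(x, L) \<in> \<Gamma>" using g by (cases g) auto
  note L = group_orthogonal[OF xL(2)] and inv = group_inv[OF xL(2)]
  define v' where "v' = dual_rep (- (L *v x), transpose L) v"
  have v': "v' \<in> V" unfolding v'_def by (rule V_inv[OF inv v])
  have "dual_rep g v' = v"
    unfolding v'_def xL(1) dual_rep_mult[OF xL(2) inv]
    using L by (simp add: transpose_transpose orthogonal_matrix_def dual_rep_one)
  then have "L2_inner lebesgue v (dual_rep g \<psi>) = L2_inner lebesgue v' \<psi>"
    using L2_inner_dual_rep[OF group_orthogonal'[OF g] V_L2[OF v'] \<psi>] by simp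
  then show ?thesis using orth[OF v'] by simp
qed

text \<open>An element of the right-hand side orthogonal to \<open>V\<close> has, after each \<open>dual_rep g\<close>, fibres in
  \<open>range_fun r\<close> that are orthogonal to the generators of that space, hence zero. As \<open>g\<close> varies these
  fibres exhaust the values of the function almost everywhere.\<close>

lemma eq_invariant_fibre_space: "V = invariant_fibre_space range_fun"
proof (intro equalityI subsetI)
  show sub: "\<phi> \<in> invariant_fibre_space range_fun" if "\<phi> \<in> V" for \<phi>
    using that V_inv subset_fibre_space V_L2 by (auto simp: invariant_fibre_space_def)
  note U = invariant_fibre_space_closed[OF range_fun_closed]
  fix \<phi> assume \<phi>: "\<phi> \<in> invariant_fibre_space range_fun"
  then have \<phi>L2: "\<phi> \<in> L2 lebesgue" by (simp add: invariant_fibre_space_def)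
  define \<psi> where "\<psi> x = \<phi> x - L2_proj lebesgue V \<phi> x" for x
  have \<psi>: "\<psi> \<in> invariant_fibre_space range_fun"
    unfolding \<psi>_def by (rule closed_L2_subspace_diff[OF U \<phi> sub[OF L2_proj(1)[OF V \<phi>L2]]])
  then have \<psi>L2: "\<psi> \<in> L2 lebesgue" by (simp add: invariant_fibre_space_def)
  have orth: "L2_inner lebesgue v \<psi> = 0" if "v \<in> V" for v
    using L2_proj(2)[OF V \<phi>L2 that] L2_inner_zero_sym unfolding \<psi>_def by blast
  have zero: "AE r in lebesgue_on R. \<forall>z\<in>A. dual_rep g \<psi> (r + z) = 0" if g: "g \<in> \<Gamma>" for g
  proof -
    have gL2: "dual_rep g \<psi> \<in> L2 lebesgue" by (rule dual_rep_L2[OF group_orthogonal'[OF g] \<psi>L2])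
    have "AE r in lebesgue_on R. \<forall>w\<in>A. L2_inner (count_space A) (fibre (generator w) r) (fibre (dual_rep g \<psi>) r) = 0"
      unfolding AE_ball_countable[OF countable_dual_lattice]
    proof
      fix w assume "w \<in> A"
      have "AE r in lebesgue_on R. L2_inner (count_space A) (fibre (generator w) r) (fibre (dual_rep g \<psi>) r)
          = L2_inner (count_space A) (fibre (generator w) r) (fibre (\<lambda>_. 0) r)"
        by (rule fibre_inner_AE_eq[OF V_L2[OF generator_V] gL2 L2_zero])
           (simp add: orthogonal_localize[OF V_inv_lattice closed_L2_subspaceD(1)[OF V] generator_V gL2
              orthogonal_dual_rep[OF \<psi>L2 orth g]])
      then show "AE r in lebesgue_on R. L2_inner (count_space A) (fibre (generator w) r) (fibre (dual_rep g \<psi>) r) = 0"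
        by (simp add: L2_inner_def fibre_def)
    qed
    moreover have "AE r in lebesgue_on R. fibre (dual_rep g \<psi>) r \<in> range_fun r"
      using \<psi> g by (simp add: invariant_fibre_space_def fibre_space_def)
    ultimately show ?thesis
      using good_AE
    proof eventually_elim
      case (elim r)
      note u = elim(2) range_fun_L2[OF elim(2)]
      have "L2_inner (count_space A) (fibre (dual_rep g \<psi>) r) (fibre (dual_rep g \<psi>) r) = 0"
        by (rule orthogonal_to_range_fun[OF elim(3) u(2) _ u(1)]) (use elim(1) in blast)
      then show ?case
        using sqnorm_count_space_zero_iff[OF u(2)] by (simp add: L2_inner_self fibre_def)
    qed
  qed
  have zero': "AE r in lebesgue_on R. \<forall>M\<in>P. \<forall>z\<in>A. \<psi> (M *v (r + z)) = 0"
    unfolding AE_ball_countable[OF countable_point_group]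
  proof
    fix M assume M: "M \<in> P"
    obtain x where x: "(x, transpose M) \<in> \<Gamma>"
      using point_group_transpose[OF M] by (auto simp: point_group_def)
    from zero[OF x] show "AE r in lebesgue_on R. \<forall>z\<in>A. \<psi> (M *v (r + z)) = 0"
      by (simp add: dual_rep_def orthogonal_matrix_inv[OF group_orthogonal[OF x]] transpose_transpose)
  qed
  have "sqnorm lebesgue \<psi> = 0"
  proof -
    let ?U = "\<Union>p\<in>P \<times> A. (case p of (M, z) \<Rightarrow> \<lambda>u. M *v (u + z)) ` R"
    have "sqnorm lebesgue \<psi> = (\<integral>y. indicator ?U y *\<^sub>R (cmod (\<psi> y))\<^sup>2 \<partial>lebesgue)"
      unfolding sqnorm_def
    proof (rule integral_cong_AE)
      show "AE y in lebesgue. (cmod (\<psi> y))\<^sup>2 = indicator ?U y *\<^sub>R (cmod (\<psi> y))\<^sup>2"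
        using domain_images_conull
      proof eventually_elim
        case (elim y)
        then have "y \<in> ?U" by force
        then show ?case by (simp only: indicator_simps scaleR_one)
      qed
    qed (use L2_measurable[OF \<psi>L2] disjoint_isometric_images.unfold_measurable_union[OF dual_group_tiles]
        in \<open>auto intro!: borel_measurable_scaleR borel_measurable_indicator\<close>)
    also have "\<dots> = (\<integral>r. (\<integral>p. (cmod (\<psi> ((case p of (M, z) \<Rightarrow> \<lambda>u. M *v (u + z)) r)))\<^sup>2 \<partial>count_space (P \<times> A)) \<partial>lebesgue_on R)"
      by (rule disjoint_isometric_images.unfold_integral[OF dual_group_tiles L2_integrable[OF \<psi>L2], symmetric])
    also have "\<dots> = 0"
    proof (rule integral_eq_zero_AE)
      show "AE r in lebesgue_on R. (\<integral>p. (cmod (\<psi> ((case p of (M, z) \<Rightarrow> \<lambda>u. M *v (u + z)) r)))\<^sup>2 \<partial>count_space (P \<times> A)) = 0"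
        using zero' by eventually_elim (intro integral_eq_zero_AE, auto simp: AE_count_space)
    qed
    finally show ?thesis .
  qed
  then have "AE x in lebesgue. \<psi> x = 0" using sqnorm_zero_iff[OF \<psi>L2] by simp
  then have "AE x in lebesgue. L2_proj lebesgue V \<phi> x = \<phi> x"
    by eventually_elim (simp add: \<psi>_def)
  then show "\<phi> \<in> V" by (rule closed_L2_subspace_AE[OF V L2_proj(1)[OF V \<phi>L2] \<phi>L2])
qed

end

lemma range_function_exists:
  assumes "closed_L2_subspace lebesgue V" "\<And>g \<phi>. g \<in> \<Gamma> \<Longrightarrow> \<phi> \<in> V \<Longrightarrow> dual_rep g \<phi> \<in> V"
  obtains K where "measurable_range_function R A K" "V = invariant_fibre_space K"
  using range_fun_measurable[OF assms] eq_invariant_fibre_space[OF assms] that by blast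

end

section \<open>Uniqueness of the range function\<close>

context crystallographic_domain
begin

lemma range_functionD:
  assumes "measurable_range_function R A K"
  shows "r \<in> R \<Longrightarrow> closed_L2_subspace (count_space A) (K r)"
    and "a \<in> L2 (count_space A) \<Longrightarrow> b \<in> L2 (count_space A) \<Longrightarrow>
      (\<lambda>r. L2_inner (count_space A) (L2_proj (count_space A) (K r) a) b) \<in> borel_measurable (lebesgue_on R)"
  using assms unfolding measurable_range_function_def by blast+

text \<open>The function on \<open>\<real>\<^sup>n\<close> whose fibre over \<open>r\<close> is a Gaussian weight times the projection of
  \<open>\<delta>\<^sub>z\<close> onto \<open>K r\<close>, and which vanishes off \<open>R + A\<close>. At most one term of the sum over \<open>w\<close> is nonzero.\<close>

definition proj_field :: "(real^'n \<Rightarrow> (real^'n \<Rightarrow> complex) set) \<Rightarrow> real^'n \<Rightarrow> real^'n \<Rightarrow> complex" where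
  "proj_field K z y = (\<integral>w. indicator R (y - w) * gaussian 0 0 (y - w) *
     L2_inner (count_space A) (L2_proj (count_space A) (K (y - w)) (delta z)) (delta w) \<partial>count_space A)"

lemma proj_field_fibre:
  assumes "r \<in> R" "w \<in> A"
  shows "proj_field K z (r + w) = gaussian 0 0 r * L2_proj (count_space A) (K r) (delta z) w"
proof -
  define f where "f w' = gaussian 0 0 (r + w - w') *
     L2_inner (count_space A) (L2_proj (count_space A) (K (r + w - w')) (delta z)) (delta w')" for w'
  have "proj_field K z (r + w) = L2_inner (count_space A) f (delta w)"
    unfolding proj_field_def L2_inner_def[of _ f]
  proof (intro Bochner_Integration.integral_cong refl)
    fix w' assume "w' \<in> space (count_space A)"
    then have "r + w - w' \<in> R \<longleftrightarrow> w' = w"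
      using translate_in_domain[OF assms(1,2), of w'] assms(1) by auto
    then show "indicator R (r + w - w') * gaussian 0 0 (r + w - w') *
        L2_inner (count_space A) (L2_proj (count_space A) (K (r + w - w')) (delta z)) (delta w')
        = f w' * cnj (delta w w')"
      by (auto simp: f_def delta_def indicator_def)
  qed
  then show ?thesis by (simp add: L2_inner_delta[OF assms(2)] f_def)
qed

lemma proj_field_off_orbit:
  assumes "y \<notin> orbit R"
  shows "proj_field K z y = 0"
proof -
  have "y - w \<notin> R" if "w \<in> A" for w
  proof
    assume "y - w \<in> R"
    moreover have "y = w + (y - w)" by simp
    ultimately show False using assms that unfolding orbit_def by blast
  qed
  then have "proj_field K z y = (\<integral>w. 0 \<partial>count_space A)"
    unfolding proj_field_def by (intro Bochner_Integration.integral_cong) auto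
  then show ?thesis by simp
qed

lemma proj_field_L2:
  assumes K: "measurable_range_function R A K" and z: "z \<in> A"
  shows "proj_field K z \<in> L2 lebesgue"
proof -
  interpret N: sigma_finite_measure "count_space A"
    by (rule sigma_finite_measure_count_space_countable[OF countable_dual_lattice])
  define c where "c w r = L2_inner (count_space A) (L2_proj (count_space A) (K r) (delta z)) (delta w)" for w r
  have c: "(\<lambda>r. indicator R r *\<^sub>R c w r) \<in> borel_measurable lebesgue" for w
    using range_functionD(2)[OF K delta_L2 delta_L2] domain_sets
    by (simp add: c_def borel_measurable_restrict_space_iff)
  have m: "proj_field K z \<in> borel_measurable lebesgue"
    unfolding proj_field_def
  proof (rule N.borel_measurable_lebesgue_integral)
    show "(\<lambda>(y, w). indicator R (y - w) * gaussian 0 0 (y - w) *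
        L2_inner (count_space A) (L2_proj (count_space A) (K (y - w)) (delta z)) (delta w))
      \<in> borel_measurable (lebesgue \<Otimes>\<^sub>M count_space A)"
    proof (rule measurable_pair_count_space[OF countable_dual_lattice])
      fix w
      have "(\<lambda>r. (indicator R r *\<^sub>R c w r) * gaussian 0 0 r) \<in> borel_measurable lebesgue"
        by (intro borel_measurable_times c lebesgue_measurable_gaussian)
      from measurable_compose[OF lebesgue_measurable_isometry[OF orthogonal_matrix_id, of "- w"] this]
      show "(\<lambda>y. case (y, w) of (y, w) \<Rightarrow> indicator R (y - w) * gaussian 0 0 (y - w) *
          L2_inner (count_space A) (L2_proj (count_space A) (K (y - w)) (delta z)) (delta w))
        \<in> borel_measurable lebesgue"
        by (rule measurable_cong[THEN iffD1, rotated]) (auto simp: c_def indicator_def)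
    qed
  qed
  have "(\<integral>\<^sup>+y. ennreal ((cmod (proj_field K z y))\<^sup>2) \<partial>lebesgue)
      = (\<integral>\<^sup>+y. indicator (\<Union>w\<in>A. (\<lambda>u. u + w) ` R) y * ennreal ((cmod (proj_field K z y))\<^sup>2) \<partial>lebesgue)"
    by (intro nn_integral_cong) (auto simp: orbit_eq[symmetric] indicator_def proj_field_off_orbit)
  also have "\<dots> = (\<integral>\<^sup>+r. \<integral>\<^sup>+w. ennreal ((cmod (proj_field K z (r + w)))\<^sup>2) \<partial>count_space A \<partial>lebesgue_on R)"
    by (rule disjoint_isometric_images.unfold_nn_integral[OF translates_tile[OF domain_sets order_refl], symmetric])
       (use m in measurable)
  also have "\<dots> \<le> (\<integral>\<^sup>+r. ennreal ((cmod (gaussian 0 0 r))\<^sup>2) \<partial>lebesgue_on R)"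
  proof (rule nn_integral_mono)
    fix r assume "r \<in> space (lebesgue_on R)"
    then have r: "r \<in> R" by simp
    note Kr = range_functionD(1)[OF K r]
    let ?p = "L2_proj (count_space A) (K r) (delta z)"
    have p: "?p \<in> L2 (count_space A)" by (rule L2_proj_L2[OF Kr delta_L2])
    have "(\<integral>\<^sup>+w. ennreal ((cmod (proj_field K z (r + w)))\<^sup>2) \<partial>count_space A)
        = (\<integral>\<^sup>+w. ennreal ((cmod (gaussian 0 0 r * ?p w))\<^sup>2) \<partial>count_space A)"
      by (intro nn_integral_cong) (simp add: proj_field_fibre[OF r])
    also have "\<dots> = ennreal (sqnorm (count_space A) (\<lambda>w. gaussian 0 0 r * ?p w))"
      unfolding sqnorm_def by (rule nn_integral_eq_integral[OF L2_integrable[OF L2_scale[OF p]]]) simp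
    also have "\<dots> \<le> ennreal ((cmod (gaussian 0 0 r))\<^sup>2)"
    proof (rule ennreal_leI)
      have "complex_of_real (sqnorm (count_space A) (delta z)) = 1"
        using L2_inner_self[of "count_space A" "delta z"] by (simp add: L2_inner_delta[OF z]) (simp add: delta_def)
      then have "sqnorm (count_space A) ?p \<le> 1"
        using L2_proj_sqnorm_le[OF Kr delta_L2, of z] by simp
      then show "sqnorm (count_space A) (\<lambda>w. gaussian 0 0 r * ?p w) \<le> (cmod (gaussian 0 0 r))\<^sup>2"
        unfolding sqnorm_scale by (intro mult_left_le) auto
    qed
    finally show "(\<integral>\<^sup>+w. ennreal ((cmod (proj_field K z (r + w)))\<^sup>2) \<partial>count_space A)
        \<le> ennreal ((cmod (gaussian 0 0 r))\<^sup>2)" .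
  qed
  also have "\<dots> = (\<integral>\<^sup>+r. ennreal ((cmod (gaussian 0 0 r))\<^sup>2) * indicator R r \<partial>lebesgue)"
    by (rule nn_integral_restrict_space) simp
  also have "\<dots> \<le> (\<integral>\<^sup>+r. ennreal ((cmod (gaussian (0 :: real^'n) 0 r))\<^sup>2) \<partial>lebesgue)"
    by (intro nn_integral_mono) (auto simp: indicator_def)
  also have "\<dots> < \<infinity>"
    using L2_integrable[OF gaussian_L2[of 0 0]] by (simp add: integrable_iff_bounded)
  finally show ?thesis
    using m by (intro L2I) (auto simp: integrable_iff_bounded)
qed

text \<open>For \<open>L = 1\<close> the operator multiplies each fibre by a scalar, since the characters of \<open>\<Lambda>\<close> are
  constant on \<open>A\<close>. Otherwise it moves the function to an image of \<open>R + A\<close> disjoint from \<open>R + A\<close>, so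
  the fibres over \<open>R\<close> vanish.\<close>

lemma proj_field_invariant:
  assumes K: "measurable_range_function R A K" and z: "z \<in> A"
  shows "proj_field K z \<in> invariant_fibre_space K"
  unfolding invariant_fibre_space_def fibre_space_def
proof (intro CollectI conjI ballI)
  note pL2 = proj_field_L2[OF K z]
  show "proj_field K z \<in> L2 lebesgue" by (rule pL2)
  fix g assume g: "g \<in> \<Gamma>"
  show "dual_rep g (proj_field K z) \<in> L2 lebesgue"
    by (rule dual_rep_L2[OF group_orthogonal'[OF g] pL2])
  obtain x L where xL: "g = (x, L)" "(x, L) \<in> \<Gamma>" using g by (cases g) auto
  note L = group_orthogonal[OF xL(2)]
  have LP: "transpose L \<in> P" using group_inv[OF xL(2)] by (auto simp: point_group_def)
  show "AE r in lebesgue_on R. fibre (dual_rep g (proj_field K z)) r \<in> K r"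
    using AE_in_domain
  proof eventually_elim
    case (elim r)
    note Kr = range_functionD(1)[OF K elim]
    show ?case
    proof (cases "L = mat 1")
      case True
      then have x: "x \<in> \<Lambda>" using xL(2) by (simp add: lattice_def)
      have "fibre (dual_rep g (proj_field K z)) r w
          = (chi r x * gaussian 0 0 r) * L2_proj (count_space A) (K r) (delta z) w" if w: "w \<in> A" for w
        using dual_lattice_chi[OF w x]
        by (simp add: fibre_def dual_rep_def xL(1) True orthogonal_matrix_inv[OF orthogonal_matrix_id]
            transpose_mat chi_add proj_field_fibre[OF elim w])
      then show ?thesis
        by (intro closed_count_space_cong[OF Kr closed_L2_subspaceD(4)[OF Kr L2_proj(1)[OF Kr delta_L2]]]) simp
    next
      case False
      have "proj_field K z (transpose L *v (r + w)) = 0" if w: "w \<in> A" for w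
      proof (rule proj_field_off_orbit, rule notI)
        assume "transpose L *v (r + w) \<in> orbit R"
        then obtain z' r' where z': "z' \<in> A" "r' \<in> R" "transpose L *v (r + w) = mat 1 *v (r' + z')"
          unfolding orbit_eq by auto
        have "transpose L = mat 1"
          by (rule domain_images_disjoint(2)[OF w LP z'(1) point_group_one elim z'(2,3)])
        then have "L = mat 1" by (metis transpose_transpose transpose_mat)
        with False show False by simp
      qed
      then have "fibre (dual_rep g (proj_field K z)) r w = 0" if "w \<in> A" for w
        using that by (simp only: fibre_def dual_rep_def xL(1) snd_conv orthogonal_matrix_inv[OF L] mult_zero_right)
      then show ?thesis
        by (intro closed_count_space_cong[OF Kr closed_L2_subspaceD(2)[OF Kr]]) simp
    qed
  qed
qed

lemma range_function_mono:
  assumes K: "measurable_range_function R A K" and K': "measurable_range_function R A K'"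
    and sub: "invariant_fibre_space K \<subseteq> invariant_fibre_space K'"
  shows "AE r in lebesgue_on R. K r \<subseteq> K' r"
proof -
  have "AE r in lebesgue_on R. \<forall>z\<in>A. fibre (proj_field K z) r \<in> K' r"
    unfolding AE_ball_countable[OF countable_dual_lattice]
  proof
    fix z assume "z \<in> A"
    then have "proj_field K z \<in> invariant_fibre_space K'"
      using proj_field_invariant[OF K] sub by blast
    then have "dual_rep (0, mat 1) (proj_field K z) \<in> fibre_space K'"
      using group_one by (simp only: invariant_fibre_space_def mem_Collect_eq)
    then show "AE r in lebesgue_on R. fibre (proj_field K z) r \<in> K' r"
      by (simp add: dual_rep_one fibre_space_def)
  qed
  then show ?thesis
    using AE_in_domain
  proof eventually_elim
    case (elim r)
    note Kr = range_functionD(1)[OF K elim(2)] and K'r = range_functionD(1)[OF K' elim(2)]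
    show ?case
    proof (rule closed_subspace_le_if_proj_delta[OF Kr K'r])
      fix z assume z: "z \<in> A"
      have "fibre (proj_field K z) r \<in> K' r \<longleftrightarrow> L2_proj (count_space A) (K r) (delta z) \<in> K' r"
        by (rule closed_count_space_cong_scale[OF K'r, of "gaussian 0 0 r"])
           (simp_all add: gaussian_origin fibre_def proj_field_fibre[OF elim(2)])
      then show "L2_proj (count_space A) (K r) (delta z) \<in> K' r" using elim(1) z by blast
    qed
  qed
qed

lemma range_function_unique:
  assumes K: "measurable_range_function R A K" and K': "measurable_range_function R A K'"
  shows "invariant_fibre_space K = invariant_fibre_space K' \<longleftrightarrow> (AE r in lebesgue_on R. K r = K' r)"
proof
  assume eq: "invariant_fibre_space K = invariant_fibre_space K'"
  have "AE r in lebesgue_on R. K r \<subseteq> K' r" "AE r in lebesgue_on R. K' r \<subseteq> K r"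
    using range_function_mono[OF K K'] range_function_mono[OF K' K] eq by auto
  then show "AE r in lebesgue_on R. K r = K' r" by eventually_elim blast
next
  assume ae: "AE r in lebesgue_on R. K r = K' r"
  have "(AE r in lebesgue_on R. fibre \<phi> r \<in> K r) \<longleftrightarrow> (AE r in lebesgue_on R. fibre \<phi> r \<in> K' r)" for \<phi>
    by (rule eventually_cong[OF ae]) simp
  then show "invariant_fibre_space K = invariant_fibre_space K'"
    by (simp add: invariant_fibre_space_def fibre_space_def)
qed

end

section \<open>Transport along the Plancherel transform\<close>

text \<open>Membership in a closed subspace does not depend on the representative that \<open>plancherel\<close> chooses.\<close>

lemma closed_subspace_plancherel_iff:
  assumes S: "closed_L2_subspace lebesgue S" and fg: "plancherel_pair f g"
  shows "plancherel f \<in> S \<longleftrightarrow> g \<in> S"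
proof -
  have "plancherel_pair f (plancherel f)"
    by (rule plancherel_pair_plancherel[OF plancherel_pairD(1)[OF fg]])
  then have ae: "AE y in lebesgue. plancherel f y = g y" and L2: "plancherel f \<in> L2 lebesgue"
    using plancherel_pair_unique[OF _ fg] plancherel_pairD(2) by auto
  have ae': "AE y in lebesgue. g y = plancherel f y"
    using ae by eventually_elim simp
  show ?thesis
    using closed_L2_subspace_AE[OF S _ plancherel_pairD(2)[OF fg] ae]
      closed_L2_subspace_AE[OF S _ L2 ae'] by blast
qed

lemma plancherel_preimage_closed:
  assumes S: "closed_L2_subspace lebesgue S"
  shows "closed_L2_subspace lebesgue {f \<in> L2 lebesgue. plancherel f \<in> S}"
proof (rule closed_L2_subspaceI)
  note iff = closed_subspace_plancherel_iff[OF S]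
  note pair = plancherel_pair_plancherel
  show "(\<lambda>_. 0) \<in> {f \<in> L2 lebesgue. plancherel f \<in> S}"
    using iff[OF plancherel_pair_zero] closed_L2_subspaceD(2)[OF S] by (simp add: L2_zero)
  show "(\<lambda>x. f x + g x) \<in> {f \<in> L2 lebesgue. plancherel f \<in> S}"
    if "f \<in> {f \<in> L2 lebesgue. plancherel f \<in> S}" "g \<in> {f \<in> L2 lebesgue. plancherel f \<in> S}" for f g
    using that iff[OF plancherel_pair_add[OF pair[of f] pair[of g], of 1]] closed_L2_subspaceD(3)[OF S]
    by (simp add: L2_add)
  show "(\<lambda>x. c * f x) \<in> {f \<in> L2 lebesgue. plancherel f \<in> S}"
    if "f \<in> {f \<in> L2 lebesgue. plancherel f \<in> S}" for c f
    using that iff[OF plancherel_pair_add[OF plancherel_pair_zero pair[of f], of c]] closed_L2_subspaceD(4)[OF S]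
    by (simp add: L2_scale)
  fix s f assume s: "\<And>k. s k \<in> {f \<in> L2 lebesgue. plancherel f \<in> S}" and lim: "L2_tendsto lebesgue s f"
  have L2: "s k \<in> L2 lebesgue" "f \<in> L2 lebesgue" for k
    using lim by (auto simp: L2_tendsto_def)
  have "sqnorm lebesgue (\<lambda>x. plancherel (s k) x - plancherel f x) = sqnorm lebesgue (\<lambda>x. s k x - f x)" for k
    by (rule plancherel_isometry[OF plancherel_pair_diff[OF pair[OF L2(1)] pair[OF L2(2)]]])
  then have "L2_tendsto lebesgue (\<lambda>k. plancherel (s k)) (plancherel f)"
    using lim plancherel_pairD(2)[OF pair[OF L2(1)]] plancherel_pairD(2)[OF pair[OF L2(2)]]
    by (simp add: L2_tendsto_iff)
  moreover have "plancherel (s k) \<in> S" for k using s by blast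
  ultimately have "plancherel f \<in> S" by (rule closed_L2_subspaceD(5)[OF S, rotated])
  with L2(2) show "f \<in> {f \<in> L2 lebesgue. plancherel f \<in> S}" by simp
qed auto

lemma plancherel_preimage_eq_iff:
  assumes S: "closed_L2_subspace lebesgue S" and S': "closed_L2_subspace lebesgue S'"
  shows "{f \<in> L2 lebesgue. plancherel f \<in> S} = {f \<in> L2 lebesgue. plancherel f \<in> S'} \<longleftrightarrow> S = S'"
proof
  assume eq: "{f \<in> L2 lebesgue. plancherel f \<in> S} = {f \<in> L2 lebesgue. plancherel f \<in> S'}"
  have "g \<in> S \<longleftrightarrow> g \<in> S'" if g: "g \<in> L2 lebesgue" for g
  proof -
    obtain f where fg: "plancherel_pair f g" using plancherel_surjective[OF g] by blast
    have "plancherel f \<in> S \<longleftrightarrow> plancherel f \<in> S'"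
      using eq plancherel_pairD(1)[OF fg] by blast
    then show ?thesis
      using closed_subspace_plancherel_iff[OF S fg] closed_subspace_plancherel_iff[OF S' fg] by simp
  qed
  then show "S = S'"
    using closed_L2_subspaceD(1)[OF S] closed_L2_subspaceD(1)[OF S'] by blast
qed simp

lemma plancherel_image_closed:
  assumes V: "closed_L2_subspace lebesgue V"
  shows "closed_L2_subspace lebesgue {\<phi>. \<exists>f\<in>V. plancherel_pair f \<phi>}"
    and "V = {f \<in> L2 lebesgue. plancherel f \<in> {\<phi>. \<exists>f\<in>V. plancherel_pair f \<phi>}}"
proof -
  show "closed_L2_subspace lebesgue {\<phi>. \<exists>f\<in>V. plancherel_pair f \<phi>}"
  proof (rule closed_L2_subspaceI)
    show "{\<phi>. \<exists>f\<in>V. plancherel_pair f \<phi>} \<subseteq> L2 lebesgue" using plancherel_pairD(2) by blast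
    show "(\<lambda>_. 0) \<in> {\<phi>. \<exists>f\<in>V. plancherel_pair f \<phi>}"
      using closed_L2_subspaceD(2)[OF V] plancherel_pair_zero by blast
    show "(\<lambda>x. \<phi> x + \<psi> x) \<in> {\<phi>. \<exists>f\<in>V. plancherel_pair f \<phi>}"
      if "\<phi> \<in> {\<phi>. \<exists>f\<in>V. plancherel_pair f \<phi>}" "\<psi> \<in> {\<phi>. \<exists>f\<in>V. plancherel_pair f \<phi>}" for \<phi> \<psi>
    proof -
      obtain f g where "f \<in> V" "plancherel_pair f \<phi>" "g \<in> V" "plancherel_pair g \<psi>" using \<open>\<phi> \<in> _\<close> \<open>\<psi> \<in> _\<close> by blast
      then show ?thesis
        using plancherel_pair_add[of f \<phi> g \<psi> 1] closed_L2_subspaceD(3)[OF V]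
        by (intro CollectI bexI[of _ "\<lambda>x. f x + g x"]) simp_all
    qed
    show "(\<lambda>x. c * \<phi> x) \<in> {\<phi>. \<exists>f\<in>V. plancherel_pair f \<phi>}"
      if "\<phi> \<in> {\<phi>. \<exists>f\<in>V. plancherel_pair f \<phi>}" for c \<phi>
    proof -
      obtain f where "f \<in> V" "plancherel_pair f \<phi>" using \<open>\<phi> \<in> _\<close> by blast
      then show ?thesis
        using plancherel_pair_add[OF plancherel_pair_zero, of f \<phi> c] closed_L2_subspaceD(4)[OF V]
        by (intro CollectI bexI[of _ "\<lambda>x. c * f x"]) simp_all
    qed
    fix s \<phi> assume "\<And>k. s k \<in> {\<phi>. \<exists>f\<in>V. plancherel_pair f \<phi>}" and lim: "L2_tendsto lebesgue s \<phi>"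
    then have "\<forall>k. \<exists>f. f \<in> V \<and> plancherel_pair f (s k)" by blast
    then obtain f where f: "\<And>k. f k \<in> V" "\<And>k. plancherel_pair (f k) (s k)" by metis
    have "sqnorm lebesgue (\<lambda>x. f j x - f k x) = sqnorm lebesgue (\<lambda>x. s j x - s k x)" for j k
      using plancherel_isometry[OF plancherel_pair_diff[OF f(2) f(2)]] by simp
    then obtain h where h: "L2_tendsto lebesgue f h"
      using L2_complete[of f lebesgue] plancherel_pairD(1)[OF f(2)] L2_tendsto_Cauchy[OF lim] by auto
    have "h \<in> V" by (rule closed_L2_subspaceD(5)[OF V f(1) h])
    moreover have "plancherel_pair h \<phi>" by (rule plancherel_pair_limit[OF f(2) h lim])
    ultimately show "\<phi> \<in> {\<phi>. \<exists>f\<in>V. plancherel_pair f \<phi>}" by blast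
  qed
  show "V = {f \<in> L2 lebesgue. plancherel f \<in> {\<phi>. \<exists>f\<in>V. plancherel_pair f \<phi>}}"
  proof (intro equalityI subsetI)
    fix f assume "f \<in> V"
    then show "f \<in> {f \<in> L2 lebesgue. plancherel f \<in> {\<phi>. \<exists>f\<in>V. plancherel_pair f \<phi>}}"
      using closed_L2_subspaceD(1)[OF V] plancherel_pair_plancherel by blast
  next
    fix f assume "f \<in> {f \<in> L2 lebesgue. plancherel f \<in> {\<phi>. \<exists>f\<in>V. plancherel_pair f \<phi>}}"
    then obtain f' where f: "f \<in> L2 lebesgue" and f': "f' \<in> V" "plancherel_pair f' (plancherel f)" by blast
    have "AE x in lebesgue. f' x = f x"
      using plancherel_pair_unique[OF f'(2) plancherel_pair_plancherel[OF f]] by simp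
    then show "f \<in> V" by (rule closed_L2_subspace_AE[OF V f'(1) f])
  qed
qed

context crystallographic_domain
begin

lemma invariant_fibre_space_range_function_closed:
  assumes "measurable_range_function R A K"
  shows "closed_L2_subspace lebesgue (invariant_fibre_space K)"
  by (rule invariant_fibre_space_closed) (rule range_functionD(1)[OF assms])

lemma range_space_range_function:
  assumes "cross_section \<Gamma> \<gamma>" "measurable_range_function R A K"
  shows "range_space \<Gamma> R \<gamma> K = {f \<in> L2 lebesgue. plancherel f \<in> invariant_fibre_space K}"
  by (rule range_space_eq[OF assms(1)]) (rule range_functionD(1)[OF assms(2)])

lemma
  assumes \<gamma>: "cross_section \<Gamma> \<gamma>" and K: "measurable_range_function R A K"
  shows range_space_closed: "closed_L2_subspace lebesgue (range_space \<Gamma> R \<gamma> K)"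
    and range_space_invariant: "crys_invariant \<Gamma> (range_space \<Gamma> R \<gamma> K)"
proof -
  note S = invariant_fibre_space_range_function_closed[OF K] and eq = range_space_range_function[OF \<gamma> K]
  show "closed_L2_subspace lebesgue (range_space \<Gamma> R \<gamma> K)"
    unfolding eq by (rule plancherel_preimage_closed[OF S])
  show "crys_invariant \<Gamma> (range_space \<Gamma> R \<gamma> K)"
    unfolding crys_invariant_def eq
  proof (intro ballI subsetI, elim imageE, simp only: mem_Collect_eq, elim conjE)
    fix g f assume g: "g \<in> \<Gamma>" and f: "f \<in> L2 lebesgue" and fS: "plancherel f \<in> invariant_fibre_space K"
    note o = group_orthogonal'[OF g]
    have "plancherel (crys_rep g f) \<in> invariant_fibre_space K"
      using closed_subspace_plancherel_iff[OF S plancherel_pair_rep[OF o plancherel_pair_plancherel[OF f]]]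
        invariant_fibre_space_invariant[OF fS g] by blast
    then show "crys_rep g f \<in> L2 lebesgue \<and> plancherel (crys_rep g f) \<in> invariant_fibre_space K"
      using crys_rep_L2[OF o f] by blast
  qed
qed

lemma range_space_eq_iff:
  assumes \<gamma>: "cross_section \<Gamma> \<gamma>" "cross_section \<Gamma> \<gamma>'"
    and K: "measurable_range_function R A K" and K': "measurable_range_function R A K'"
  shows "range_space \<Gamma> R \<gamma> K = range_space \<Gamma> R \<gamma>' K' \<longleftrightarrow> (AE r in lebesgue_on R. K r = K' r)"
  unfolding range_space_range_function[OF \<gamma>(1) K] range_space_range_function[OF \<gamma>(2) K']
    plancherel_preimage_eq_iff[OF invariant_fibre_space_range_function_closed[OF K]
      invariant_fibre_space_range_function_closed[OF K']]
  by (rule range_function_unique[OF K K'])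

lemma invariant_subspace_is_range_space:
  assumes V: "closed_L2_subspace lebesgue V" and inv: "crys_invariant \<Gamma> V"
  obtains K where "measurable_range_function R A K" "\<And>\<gamma>. cross_section \<Gamma> \<gamma> \<Longrightarrow> V = range_space \<Gamma> R \<gamma> K"
proof -
  define W where "W = {\<phi>. \<exists>f\<in>V. plancherel_pair f \<phi>}"
  have "dual_rep g \<phi> \<in> W" if "g \<in> \<Gamma>" "\<phi> \<in> W" for g \<phi>
  proof -
    obtain f where f: "f \<in> V" "plancherel_pair f \<phi>" using \<open>\<phi> \<in> W\<close> by (auto simp: W_def)
    then have "crys_rep g f \<in> V" using inv \<open>g \<in> \<Gamma>\<close> by (auto simp: crys_invariant_def)
    moreover have "plancherel_pair (crys_rep g f) (dual_rep g \<phi>)"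
      by (rule plancherel_pair_rep[OF group_orthogonal'[OF \<open>g \<in> \<Gamma>\<close>] f(2)])
    ultimately show ?thesis by (auto simp: W_def)
  qed
  then obtain K where K: "measurable_range_function R A K" "W = invariant_fibre_space K"
    using range_function_exists[OF plancherel_image_closed(1)[OF V, folded W_def]] by metis
  have "V = range_space \<Gamma> R \<gamma> K" if "cross_section \<Gamma> \<gamma>" for \<gamma>
    using plancherel_image_closed(2)[OF V, folded W_def]
    unfolding range_space_range_function[OF that K(1)] K(2)[symmetric] .
  with K(1) that show ?thesis by blast
qed

end

theorem theorem7p1p7:
  fixes \<Gamma> :: "((real^'n::finite) \<times> (real^'n^'n)) set"
    and R :: "(real^'n) set"
  assumes "crystallographic \<Gamma>"
    and "fundamental_domain (dual_group \<Gamma>) R"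
  shows
    "(\<forall>V. closed_L2_subspace lebesgue V \<longrightarrow>
        (crys_invariant \<Gamma> V \<longleftrightarrow>
          (\<exists>K. measurable_range_function R (dual_lattice \<Gamma>) K \<and>
               (\<forall>\<gamma>. cross_section \<Gamma> \<gamma> \<longrightarrow> V = range_space \<Gamma> R \<gamma> K) \<and>
               (\<forall>K' \<gamma>. measurable_range_function R (dual_lattice \<Gamma>) K' \<and> cross_section \<Gamma> \<gamma> \<and>
                        V = range_space \<Gamma> R \<gamma> K' \<longrightarrow>
                        (AE r in lebesgue_on R. K' r = K r)))))
     \<and> (\<forall>\<gamma> K. cross_section \<Gamma> \<gamma> \<and> measurable_range_function R (dual_lattice \<Gamma>) K \<longrightarrow>
          closed_L2_subspace lebesgue (range_space \<Gamma> R \<gamma> K) \<and>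
          crys_invariant \<Gamma> (range_space \<Gamma> R \<gamma> K))
     \<and> (\<forall>\<gamma> K K'. cross_section \<Gamma> \<gamma> \<and>
          measurable_range_function R (dual_lattice \<Gamma>) K \<and>
          measurable_range_function R (dual_lattice \<Gamma>) K' \<longrightarrow>
          (range_space \<Gamma> R \<gamma> K = range_space \<Gamma> R \<gamma> K' \<longleftrightarrow>
             (AE r in lebesgue_on R. K r = K' r)))"
proof -
  interpret crystallographic_domain \<Gamma> R
    by (rule crystallographic_domain.intro) (use assms in \<open>simp_all add: crystallographic_def\<close>)
  show ?thesis
  proof (intro conjI allI impI; (elim conjE)?)
    fix V :: "(real^'n \<Rightarrow> complex) set" assume V: "closed_L2_subspace lebesgue V"
    show "crys_invariant \<Gamma> V \<longleftrightarrow>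
          (\<exists>K. measurable_range_function R A K \<and>
               (\<forall>\<gamma>. cross_section \<Gamma> \<gamma> \<longrightarrow> V = range_space \<Gamma> R \<gamma> K) \<and>
               (\<forall>K' \<gamma>. measurable_range_function R A K' \<and> cross_section \<Gamma> \<gamma> \<and>
                        V = range_space \<Gamma> R \<gamma> K' \<longrightarrow>
                        (AE r in lebesgue_on R. K' r = K r)))"
      (is "_ \<longleftrightarrow> (\<exists>K. ?describes K)")
    proof
      assume "crys_invariant \<Gamma> V"
      then obtain K where K: "measurable_range_function R A K"
        and eq: "\<And>\<gamma>. cross_section \<Gamma> \<gamma> \<Longrightarrow> V = range_space \<Gamma> R \<gamma> K"
        using invariant_subspace_is_range_space[OF V] by metis
      have "AE r in lebesgue_on R. K' r = K r"
        if "measurable_range_function R A K'" "cross_section \<Gamma> \<gamma>" "V = range_space \<Gamma> R \<gamma> K'" for K' \<gamma>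
        using range_space_eq_iff[OF that(2,2,1) K] that(3) eq[OF that(2)] by simp
      with K eq have "?describes K"
        by (intro conjI allI impI) blast+
      then show "\<exists>K. ?describes K" by (rule exI[where x = K])
    next
      assume "\<exists>K. ?describes K"
      then obtain K where K: "measurable_range_function R A K"
        and eq: "\<And>\<gamma>. cross_section \<Gamma> \<gamma> \<Longrightarrow> V = range_space \<Gamma> R \<gamma> K"
        by (elim exE conjE) simp
      obtain \<gamma> where "cross_section \<Gamma> \<gamma>" using cross_section_exists by blast
      then show "crys_invariant \<Gamma> V"
        using range_space_invariant[OF _ K] eq by simp
    qed
  qed (auto intro: range_space_closed range_space_invariant simp: range_space_eq_iff)
qed

end
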